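(* Let $\{\Gamma_t\}_{t\in[0,T)}$, $0<T\le\infty$, be a curve shortening flow on the unit round sphere $S^2\subset\mathbb{R}^3$ starting from a simple closed curve $\Gamma_0$, with Euclidean chordlength $d$, arclength $\ell$, total length $L$ and curvature $\kappa$. Suppose that for some $a>0$, at time $t=0$, \[ \frac{d}{L}\ \ge\ \frac{1}{a}\arctan\left(\frac{a}{\pi}\sin\left(\frac{\pi\ell}{L}\right)\right) \] for all pairs of points of the curve. Then, at every time $t\in[0,T)$ and at every point of $\Gamma_t$, \[ \kappa^2+1\ \le\ \left(\frac{2\pi}{L}\right)^2\left(1+\frac{2a^2}{\pi^2}\,e^{-8\pi^2\tau}\right), \] where $\tau(t):=\int_0^t L(t')^{-2}\,dt'$.
   Context: $S^2$ is the unit sphere in $\mathbb{R}^3$. A family $\{\Gamma_t\}_{t\in[0,T)}$ of closed curves in $S^2$ evolves by curve shortening flow if there is a smooth map $\gamma:S^1\times[0,T)\to S^2$ (with $S^1$ the circle) such that each $\gamma(\cdot,t)$ is a smooth immersion with image $\Gamma_t=\gamma(S^1,t)$ and $\partial_t\gamma=\vec\kappa$, where $\vec\kappa(\cdot,t)$ is the (geodesic) curvature vector of $\gamma(\cdot,t)$ in $S^2$. The curve $\Gamma_0$ is simple if $\gamma(\cdot,0)$ is injective. The curvature $\kappa$ is defined by $\vec\kappa=-\kappa N$, where $T$ (as a vector field) is the unit tangent field and $N$ is the unit normal field along the curve in $S^2$ with $\gamma=N\times T$; thus $\kappa$ is the geodesic curvature up to sign, and $\kappa^2+1$ is the square of the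 curvature of the curve as a curve in $\mathbb{R}^3$. For parameters $x,y\in S^1$ and $t\in[0,T)$: $d=d(x,y,t):=|\gamma(x,t)-\gamma(y,t)|$ is the Euclidean chordlength in $\mathbb{R}^3$ (not the spherical distance); $\ell=\ell(x,y,t)$ is the arclength along $\Gamma_t$ between the two points (of the shorter of the two portions joining them; using the other portion replaces $\ell$ by $L-\ell$, which does not change $\sin(\pi\ell/L)$); and $L=L(t)$ is the total length of $\Gamma_t$. *)

theory Defs
  imports "HOL-Analysis.Analysis"
begin

text \<open>
  Closed curves are parametrised by the circle \<open>\<real>/2\<pi>\<int>\<close>, i.e. by \<open>2\<pi>\<close>-periodic functions on the
  real line.
\<close>

text \<open>
  Smoothness, including one-sided smoothness at those boundary points that belong to the domain:
  \<open>f\<close> is differentiable on \<open>S\<close> and all its directional derivatives are again smooth on \<open>S\<close>.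
  The notion is meant for sets such as \<open>UNIV \<times> {0..<T}\<close> on which derivatives within \<open>S\<close> are unique.
\<close>

coinductive smooth_within :: "'a::real_normed_vector set \<Rightarrow> ('a \<Rightarrow> 'b::real_normed_vector) \<Rightarrow> bool"
  for S where
  "(\<And>p. p \<in> S \<Longrightarrow> (f has_derivative (\<lambda>h. D h p)) (at p within S)) \<Longrightarrow>
   (\<And>h. smooth_within S (D h)) \<Longrightarrow> smooth_within S f"

definition periodic_curve :: "(real \<Rightarrow> real^3) \<Rightarrow> bool" where
  "periodic_curve c \<longleftrightarrow> (\<forall>x. c (x + 2 * pi) = c x)"

definition speed :: "(real \<Rightarrow> real^3) \<Rightarrow> real \<Rightarrow> real" where
  "speed c x = norm (vector_derivative c (at x))"

definition curve_length :: "(real \<Rightarrow> real^3) \<Rightarrow> real" where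
  "curve_length c = integral {0..2 * pi} (speed c)"

text \<open>The parameters are meant to lie in the fundamental domain \<open>{0..<2 * pi}\<close>.\<close>

definition arclength :: "(real \<Rightarrow> real^3) \<Rightarrow> real \<Rightarrow> real \<Rightarrow> real" where
  "arclength c x y =
     (let s = integral {min x y..max x y} (speed c) in min s (curve_length c - s))"

definition unit_tangent :: "(real \<Rightarrow> real^3) \<Rightarrow> real \<Rightarrow> real^3" where
  "unit_tangent c x = (1 / speed c x) *\<^sub>R vector_derivative c (at x)"

text \<open>The unit normal \<open>N\<close> in the sphere, oriented so that \<open>c = N \<times> T\<close>; see \<open>unit_normal_frame\<close> below.\<close>

definition unit_normal :: "(real \<Rightarrow> real^3) \<Rightarrow> real \<Rightarrow> real^3" where
  "unit_normal c x = cross3 (unit_tangent c x) (c x)"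

text \<open>
  The curvature vector in the sphere: the arclength derivative of the unit tangent, projected
  orthogonally to the tangent plane of the sphere at \<open>c x\<close>.
\<close>

definition curvature_vector :: "(real \<Rightarrow> real^3) \<Rightarrow> real \<Rightarrow> real^3" where
  "curvature_vector c x =
     (let k = (1 / speed c x) *\<^sub>R vector_derivative (unit_tangent c) (at x)
      in k - (k \<bullet> c x) *\<^sub>R c x)"

text \<open>The scalar determined by \<open>curvature_vector = - curvature * N\<close>; see \<open>curvature_vector_eq\<close> below.\<close>

definition curvature :: "(real \<Rightarrow> real^3) \<Rightarrow> real \<Rightarrow> real" where
  "curvature c x = - (curvature_vector c x \<bullet> unit_normal c x)"

definition time_interval :: "ereal \<Rightarrow> real set" where
  "time_interval T = {t. 0 \<le> t \<and> ereal t < T}"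

text \<open>A family of curves is written \<open>\<gamma> t x\<close>, with the time \<open>t\<close> as first argument.\<close>

definition curve_shortening_flow :: "ereal \<Rightarrow> (real \<Rightarrow> real \<Rightarrow> real^3) \<Rightarrow> bool" where
  "curve_shortening_flow T \<gamma> \<longleftrightarrow>
     smooth_within (UNIV \<times> time_interval T) (\<lambda>(x, t). \<gamma> t x) \<and>
     (\<forall>t \<in> time_interval T.
        periodic_curve (\<gamma> t) \<and>
        (\<forall>x. \<gamma> t x \<in> sphere 0 1 \<and>
             vector_derivative (\<gamma> t) (at x) \<noteq> 0 \<and>
             ((\<lambda>s. \<gamma> s x) has_vector_derivative curvature_vector (\<gamma> t) x)
               (at t within time_interval T)))"

definition simple_closed_curve :: "(real \<Rightarrow> real^3) \<Rightarrow> bool" where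
  "simple_closed_curve c \<longleftrightarrow> periodic_curve c \<and> inj_on c {0..<2 * pi}"

definition tau :: "(real \<Rightarrow> real \<Rightarrow> real^3) \<Rightarrow> real \<Rightarrow> real" where
  "tau \<gamma> t = integral {0..t} (\<lambda>s. 1 / (curve_length (\<gamma> s))\<^sup>2)"

lemma sphere_curve_orthogonal:
  fixes c :: "real \<Rightarrow> real^3"
  assumes "\<And>x. norm (c x) = r" and "c differentiable (at x)"
  shows "c x \<bullet> vector_derivative c (at x) = 0"
proof -
  let ?v = "vector_derivative c (at x)"
  have "(c has_derivative (\<lambda>h. h *\<^sub>R ?v)) (at x)"
    using assms(2) vector_derivative_works has_vector_derivative_def by blast
  then have "((\<lambda>y. c y \<bullet> c y) has_derivative (\<lambda>h. c x \<bullet> (h *\<^sub>R ?v) + (h *\<^sub>R ?v) \<bullet> c x)) (at x)"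
    by (intro has_derivative_inner)
  moreover have "(\<lambda>y. c y \<bullet> c y) = (\<lambda>y. r\<^sup>2)"
    using assms(1) by (simp add: power2_norm_eq_inner[symmetric])
  ultimately have "((\<lambda>y. r\<^sup>2) has_derivative (\<lambda>h. c x \<bullet> (h *\<^sub>R ?v) + (h *\<^sub>R ?v) \<bullet> c x)) (at x)"
    by simp
  from has_derivative_unique[OF this has_derivative_const]
  have "c x \<bullet> (1 *\<^sub>R ?v) + (1 *\<^sub>R ?v) \<bullet> c x = 0"
    by meson
  then show ?thesis by (simp add: inner_commute)
qed

lemma unit_tangent:
  assumes "\<And>x. norm (c x) = 1" and "c differentiable (at x)" and "vector_derivative c (at x) \<noteq> 0"
  shows "norm (unit_tangent c x) = 1" and "c x \<bullet> unit_tangent c x = 0"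
  using assms(3) sphere_curve_orthogonal[OF assms(1,2)]
  by (auto simp: unit_tangent_def speed_def)

lemma unit_normal_frame:
  assumes "\<And>x. norm (c x) = 1" and "c differentiable (at x)" and "vector_derivative c (at x) \<noteq> 0"
  shows "norm (unit_normal c x) = 1"
    and "unit_normal c x \<bullet> unit_tangent c x = 0"
    and "unit_normal c x \<bullet> c x = 0"
    and "c x = cross3 (unit_normal c x) (unit_tangent c x)"
proof -
  note t = unit_tangent[of c x, OF assms]
  have tt: "unit_tangent c x \<bullet> unit_tangent c x = 1" "unit_tangent c x \<bullet> c x = 0"
    using t by (auto simp: norm_eq_1 inner_commute)
  have cc: "c x \<bullet> c x = 1" using assms(1)[of x] by (simp add: norm_eq_1)
  show "norm (unit_normal c x) = 1"
    using norm_cross_dot[of "unit_tangent c x" "c x"] t tt assms(1)[of x]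
    by (simp add: unit_normal_def power2_eq_1_iff) (smt (verit) norm_ge_zero)
  show "unit_normal c x \<bullet> unit_tangent c x = 0" "unit_normal c x \<bullet> c x = 0"
    by (simp_all add: unit_normal_def dot_cross_self)
  show "c x = cross3 (unit_normal c x) (unit_tangent c x)"
    using Lagrange[of "unit_tangent c x" "unit_tangent c x" "c x"] tt
    by (simp add: unit_normal_def cross_skew[of "cross3 _ _"])
qed

lemma curvature_vector_eq:
  assumes "\<And>x. norm (c x) = 1" and "\<And>x. c differentiable (at x)"
    and "\<And>x. vector_derivative c (at x) \<noteq> 0" and "unit_tangent c differentiable (at x)"
  shows "curvature_vector c x = - curvature c x *\<^sub>R unit_normal c x"
proof -
  let ?N = "unit_normal c x" and ?T = "unit_tangent c x" and ?k = "curvature_vector c x"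
  have t: "norm (unit_tangent c y) = 1" "c y \<bullet> unit_tangent c y = 0" for y
    using unit_tangent[of c y] assms by auto
  have n: "?N \<bullet> ?N = 1"
    using unit_normal_frame(1)[of c x] assms by (simp add: norm_eq_1)
  have cc: "c x \<bullet> c x = 1" using assms(1)[of x] by (simp add: norm_eq_1)
  have "?T \<bullet> vector_derivative (unit_tangent c) (at x) = 0"
    by (rule sphere_curve_orthogonal[OF t(1) assms(4)])
  then have kT: "?k \<bullet> ?T = 0"
    using t(2)[of x]
    by (simp add: curvature_vector_def Let_def inner_diff_left inner_commute[of _ ?T])
       (simp add: inner_diff_right inner_commute)
  have kc: "?k \<bullet> c x = 0"
    using cc by (simp add: curvature_vector_def Let_def inner_diff_left)
  have "cross3 ?k ?N = 0"
    using kT kc by (simp add: unit_normal_def Lagrange inner_commute)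
  then have "0 = cross3 ?N (cross3 ?k ?N)" by simp
  also have "\<dots> = ?k - (?N \<bullet> ?k) *\<^sub>R ?N"
    using n by (simp add: Lagrange)
  finally show ?thesis by (simp add: curvature_def inner_commute)
qed

end

theory Submission
  imports Defs "HOL-Real_Asymp.Real_Asymp"
begin

text \<open>
  Write \<open>d\<close> for the chordlength, \<open>\<ell>\<close> for the arclength and \<open>\<phi> b z = arctan (b sin (\<pi> z)) / (\<pi> b)\<close>. The chord-arc
  inequality \<open>d \<ge> L \<phi> b (\<ell> / L)\<close> with \<open>b = (a / \<pi>) exp (- 4 \<pi>\<^sup>2 \<tau>)\<close> is preserved by the flow, and its
  third-order expansion at the diagonal is the curvature bound.

  Preservation is a maximum principle for \<open>d - L \<phi>\<close>. In \<open>\<real>\<^sup>3\<close> the flow reads \<open>\<gamma>\<^sub>t = \<gamma>\<^sub>s\<^sub>s + \<gamma>\<close>. At a first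
  touching pair both tangents make the same angle with the chord, and since they are tangent to the
  sphere there are two configurations. If the tangents are placed as on a circle cut by the chord, the
  second variation moving the points in opposite directions, the Cauchy-Schwarz inequality for the
  total curvature of the subarc, and Fenchel's theorem for the whole curve give a contradiction. If they
  lie on the same side of the chord, the points are moved in the same direction instead; the loss
  is controlled because \<open>d \<le> 2\<close> for a pair at arclength \<open>L / 2\<close> bounds \<open>L\<close>, so no topological
  argument is needed in this case.
\<close>

section \<open>Trigonometric inequalities\<close>

text \<open>As \<open>b\<close> tends to 0 the profile becomes
  \<open>L / pi * sin (pi * r / L)\<close>, the chord of a planar circle of length \<open>L\<close>,
  so the decay of \<open>b\<close> measures the approach to roundness. The rate
  \<open>4 * pi^2 / L^2\<close> is dictated by cancellation: it adds two terms to the time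
  derivative of the profile, one absorbed exactly by Fenchel's lower bound
  \<open>4 * pi^2 / L\<close> for the integral of |k|^2 = \<kappa>^2 + 1, the other cancelling the
  leading part of the second derivative of the profile. In the circle configuration the remainder is
  the tangent line inequality for the convex function \<open>arccos^2\<close>.

  The chord is not differentiable where it vanishes, so a first touching pair must have positive
  chord. The perturbation \<epsilon> exp(2t) ensures this: at a coincident touching pair the profile
  would have to equal \<epsilon> exp(2t), while a curvature bound on a compact time interval keeps
  such parameters so far apart along the curve that the profile exceeds this value.\<close>

lemma sin_cube_ge:
  fixes x :: real
  assumes "0 < x" "x < pi / 2"
  shows "x ^ 3 * cos x \<le> sin x ^ 3"
proof -
  have x2: "x\<^sup>2 < 9"
  proof -
    have "x < 3" using assms pi_less_4 by simp
    then show ?thesis using assms power_strict_mono[of x 3 2] by simp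
  qed
  \<comment> \<open>The orders of the two Taylor polynomials are such that the cube of the first and
    \<open>x ^ 3\<close> times the second agree up to \<open>x ^ 5\<close> and differ by
    \<open>x ^ 7 / 216 * (9 - x\<^sup>2)\<close>.\<close>
  have s: "x - x ^ 3 / 6 \<le> sin x"
  proof -
    obtain t where "0 < t" "t < x" and
      eq: "sin x = (\<Sum>m<5. sin_coeff m * x ^ m) + sin (t + 1/2 * real 5 * pi) / fact 5 * x ^ 5"
      using Maclaurin_sin_expansion3[of 5 x] assms by auto
    have "sin (t + 1/2 * real 5 * pi) = cos t"
    proof -
      have "t + 1/2 * real 5 * pi = (t + pi/2) + 2 * pi" by simp
      then show ?thesis by (simp only: sin_periodic) (simp add: sin_add)
    qed
    moreover have "cos t \<ge> 0" using \<open>0 < t\<close> \<open>t < x\<close> assms by (intro cos_ge_zero) auto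
    ultimately have "sin x \<ge> (\<Sum>m<5. sin_coeff m * x ^ m)"
      using eq assms by simp
    then show ?thesis by (simp add: sin_coeff_def lessThan_nat_numeral fact_numeral)
  qed
  have c: "cos x \<le> 1 - x\<^sup>2 / 2 + x ^ 4 / 24"
  proof -
    obtain t where "0 < t" "t < x" and
      eq: "cos x = (\<Sum>m<6. cos_coeff m * x ^ m) + cos (t + 1/2 * real 6 * pi) / fact 6 * x ^ 6"
      using Maclaurin_cos_expansion2[of x 6] assms by auto
    have "cos (t + 1/2 * real 6 * pi) = - cos t"
    proof -
      have "t + 1/2 * real 6 * pi = (t + pi) + 2 * pi" by simp
      then show ?thesis by (simp only: cos_periodic) simp
    qed
    moreover have "cos t \<ge> 0" using \<open>0 < t\<close> \<open>t < x\<close> assms by (intro cos_ge_zero) auto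
    ultimately have "cos x \<le> (\<Sum>m<6. cos_coeff m * x ^ m)"
      using eq assms by simp
    then show ?thesis by (simp add: cos_coeff_def lessThan_nat_numeral fact_numeral)
  qed
  have "0 \<le> x - x ^ 3 / 6"
  proof -
    have "x * (1 - x\<^sup>2 / 6) \<ge> 0 \<or> x\<^sup>2 > 6" using assms by auto
    moreover have "x\<^sup>2 < 6"
    proof -
      have "x < 2" using assms pi_less_4 by simp
      then show ?thesis using assms power_strict_mono[of x 2 2] by simp
    qed
    ultimately show ?thesis by (simp add: algebra_simps power2_eq_square power3_eq_cube)
  qed
  then have "(x - x ^ 3 / 6) ^ 3 \<le> sin x ^ 3" using s by (intro power_mono) auto
  moreover have "x ^ 3 * cos x \<le> x ^ 3 * (1 - x\<^sup>2 / 2 + x ^ 4 / 24)"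
    using c assms by simp
  moreover have "(x - x ^ 3 / 6) ^ 3 - x ^ 3 * (1 - x\<^sup>2 / 2 + x ^ 4 / 24) = x ^ 7 / 216 * (9 - x\<^sup>2)"
    by (simp add: field_simps eval_nat_numeral)
  moreover have "x ^ 7 / 216 * (9 - x\<^sup>2) \<ge> 0" using x2 assms by simp
  ultimately show ?thesis by linarith
qed

lemma self_mult_cos_le_sin:
  fixes x :: real
  assumes "0 \<le> x" "x \<le> pi"
  shows "x * cos x \<le> sin x"
proof -
  have "sin 0 - 0 * cos 0 \<le> sin x - x * cos x"
  proof (rule DERIV_nonneg_imp_nondecreasing[OF assms(1), where f = "\<lambda>x. sin x - x * cos x"])
    fix t assume "0 \<le> t" "t \<le> x"
    then show "\<exists>d. ((\<lambda>x. sin x - x * cos x) has_real_derivative d) (at t) \<and> 0 \<le> d"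
      using assms sin_ge_zero[of t]
      by (intro exI[of _ "t * sin t"] conjI) (auto intro!: derivative_eq_intros)
  qed
  then show ?thesis by simp
qed

text \<open>The tangent line inequality of the convex function \<open>(arccos u)^2\<close> at
  \<open>u = cos x\<close>, evaluated at \<open>u = cos y\<close>. Monotonicity in \<open>y\<close>
  comes from the fact that \<open>sin t / t\<close> decreases.\<close>

lemma arccos_square_convex:
  fixes x y :: real
  assumes "0 < x" "x \<le> y" "y \<le> pi / 2"
  shows "2 * x * (cos x - cos y) \<le> sin x * (y\<^sup>2 - x\<^sup>2)"
proof -
  have sin_ratio: "x * sin t \<le> t * sin x" if "x \<le> t" "t \<le> pi / 2" for t
  proof -
    have "x * sin x - x * sin x \<le> t * sin x - x * sin t"
    proof (rule DERIV_nonneg_imp_nondecreasing[OF that(1), where f = "\<lambda>t. t * sin x - x * sin t"])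
      fix u assume u: "x \<le> u" "u \<le> t"
      have "x * cos u \<le> x * cos x"
        using assms that u by (intro mult_left_mono cos_monotone_0_pi_le) auto
      also have "\<dots> \<le> sin x" using self_mult_cos_le_sin[of x] assms by simp
      finally show "\<exists>y. ((\<lambda>t. t * sin x - x * sin t) has_real_derivative y) (at u) \<and> 0 \<le> y"
        by (intro exI[of _ "sin x - x * cos u"] conjI) (auto intro!: derivative_eq_intros)
    qed
    then show ?thesis by simp
  qed
  have "sin x * (x\<^sup>2 - x\<^sup>2) - 2 * x * (cos x - cos x) \<le> sin x * (y\<^sup>2 - x\<^sup>2) - 2 * x * (cos x - cos y)"
  proof (rule DERIV_nonneg_imp_nondecreasing[OF assms(2),
        where f = "\<lambda>y. sin x * (y\<^sup>2 - x\<^sup>2) - 2 * x * (cos x - cos y)"])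
    fix t assume t: "x \<le> t" "t \<le> y"
    show "\<exists>d. ((\<lambda>y. sin x * (y\<^sup>2 - x\<^sup>2) - 2 * x * (cos x - cos y)) has_real_derivative d) (at t) \<and> 0 \<le> d"
      using sin_ratio[of t] t assms
      by (intro exI[of _ "sin x * (2 * t) - 2 * x * sin t"] conjI)
         (auto intro!: derivative_eq_intros simp: mult_ac)
  qed
  then show ?thesis by simp
qed

text \<open>Meant for \<open>x = arctan (b * S)\<close> and \<open>y = arctan b\<close> with
  \<open>S = sin (pi * z)\<close>: the quotient of the squared tangents is then
  \<open>S\<^sup>2\<close>, so the left side contains \<open>(cos (pi * z))\<^sup>2\<close>. After
  division by \<open>x * cos x ^ 3\<close> both sides vanish at \<open>y = x\<close>, and it
  suffices to compare derivatives in \<open>y\<close>.\<close>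

lemma tan_ratio_bound:
  fixes x y :: real
  assumes "0 < x" "x < y" "y < pi / 2"
  shows "x * cos x ^ 3 * (1 - (tan x)\<^sup>2 / (tan y)\<^sup>2) \<le> sin x * (1 - x\<^sup>2 / y\<^sup>2)"
proof -
  define R where "R = sin x / (x * cos x ^ 3)"
  have cx: "0 < cos x" and sx: "0 < sin x"
    using assms by (auto intro!: cos_gt_zero sin_gt_zero)
  have R: "tan x ^ 2 \<le> R * x\<^sup>2"
  proof -
    have "R * x\<^sup>2 = sin x * x / cos x ^ 3"
      using assms cx by (simp add: R_def field_simps power2_eq_square)
    moreover have "tan x ^ 2 = sin x * (sin x * cos x) / cos x ^ 3"
      using cx by (simp add: tan_def field_simps eval_nat_numeral)
    moreover have "sin x * cos x \<le> x"
    proof -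
      have "sin x * cos x \<le> sin x" using sx by (simp add: mult_left_le)
      then show ?thesis using sin_x_le_x[of x] assms by simp
    qed
    ultimately show ?thesis using sx cx
      by (auto intro!: divide_right_mono mult_left_mono)
  qed
  have "R * (1 - x\<^sup>2 / x\<^sup>2) - 1 + (tan x)\<^sup>2 * (cos x)\<^sup>2 / (sin x)\<^sup>2
      \<le> R * (1 - x\<^sup>2 / y\<^sup>2) - 1 + (tan x)\<^sup>2 * (cos y)\<^sup>2 / (sin y)\<^sup>2"
  proof (rule DERIV_nonneg_imp_nondecreasing[of x y
        "\<lambda>y. R * (1 - x\<^sup>2 / y\<^sup>2) - 1 + (tan x)\<^sup>2 * (cos y)\<^sup>2 / (sin y)\<^sup>2"])
    show "x \<le> y" using assms by simp
    fix t assume t: "x \<le> t" "t \<le> y"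
    have t0: "0 < t" "t < pi / 2" using t assms by auto
    have ct: "0 < cos t" and st: "0 < sin t"
      using t assms by (auto intro!: cos_gt_zero sin_gt_zero)
    have D: "((\<lambda>y. R * (1 - x\<^sup>2 / y\<^sup>2) - 1 + (tan x)\<^sup>2 * (cos y)\<^sup>2 / (sin y)\<^sup>2) has_real_derivative
        2 * R * x\<^sup>2 / t ^ 3 - 2 * (tan x)\<^sup>2 * cos t / sin t ^ 3) (at t)"
    proof -
      have 1: "R * (x\<^sup>2 * (2 * t)) / (t\<^sup>2 * t\<^sup>2) = 2 * R * x\<^sup>2 / t ^ 3"
        using t0 by (simp add: field_simps eval_nat_numeral)
      have 2: "((\<lambda>y. (cos y)\<^sup>2 / (sin y)\<^sup>2) has_real_derivative - 2 * cos t / sin t ^ 3) (at t)"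
      proof -
        have "(2 * cos t * - sin t * (sin t)\<^sup>2 - (cos t)\<^sup>2 * (2 * sin t * cos t)) / ((sin t)\<^sup>2 * (sin t)\<^sup>2)
            = - 2 * cos t * sin t * ((sin t)\<^sup>2 + (cos t)\<^sup>2) / (sin t * sin t ^ 3)"
          by (rule arg_cong2[where f = "(/)"]) algebra+
        also have "\<dots> = - 2 * cos t / sin t ^ 3" using st by simp
        finally show ?thesis
          using st by (auto intro!: derivative_eq_intros simp: mult_ac)
      qed
      have "((\<lambda>y. R * (1 - x\<^sup>2 / y\<^sup>2) - 1) has_real_derivative 2 * R * x\<^sup>2 / t ^ 3) (at t)"
        using 1 t0 by (auto intro!: derivative_eq_intros simp: mult_ac)
      from DERIV_add[OF this DERIV_cmult[OF 2, of "(tan x)\<^sup>2"]] show ?thesis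
        by (simp add: mult_ac)
    qed
    \<comment> \<open>The sign of the derivative separates into one estimate in \<open>x\<close>
      alone and one in \<open>t\<close> alone.\<close>
    have "(tan x)\<^sup>2 * (t ^ 3 * cos t) \<le> R * x\<^sup>2 * sin t ^ 3"
      using R sin_cube_ge[OF t0] t0 ct
      by (intro mult_mono) (auto intro: order_trans[OF zero_le_power2])
    then have "2 * R * x\<^sup>2 / t ^ 3 - 2 * (tan x)\<^sup>2 * cos t / sin t ^ 3 \<ge> 0"
      using t0 st by (simp add: field_simps)
    with D show "\<exists>d. ((\<lambda>y. R * (1 - x\<^sup>2 / y\<^sup>2) - 1 + (tan x)\<^sup>2 * (cos y)\<^sup>2 / (sin y)\<^sup>2)
        has_real_derivative d) (at t) \<and> 0 \<le> d" by blast
  qed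
  moreover have "R * (1 - x\<^sup>2 / x\<^sup>2) - 1 + (tan x)\<^sup>2 * (cos x)\<^sup>2 / (sin x)\<^sup>2 = 0"
    using assms cx sx by (simp add: tan_def field_simps)
  moreover have "(tan x)\<^sup>2 * (cos y)\<^sup>2 / (sin y)\<^sup>2 = (tan x)\<^sup>2 / (tan y)\<^sup>2"
    by (simp add: tan_def field_simps)
  ultimately have "1 - (tan x)\<^sup>2 / (tan y)\<^sup>2 \<le> R * (1 - x\<^sup>2 / y\<^sup>2)" by linarith
  then have "x * cos x ^ 3 * (1 - (tan x)\<^sup>2 / (tan y)\<^sup>2) \<le> x * cos x ^ 3 * (R * (1 - x\<^sup>2 / y\<^sup>2))"
    using assms cx by (intro mult_left_mono) auto
  then show ?thesis using assms cx by (simp add: R_def)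
qed

section \<open>Closed spherical curves parametrised by arclength\<close>

text \<open>Cauchy-Schwarz against the constant 1, read off from the nonnegative integral of
  \<open>(f x - m)\<^sup>2\<close> with \<open>m\<close> the mean value.\<close>

lemma integral_square_le:
  fixes f :: "real \<Rightarrow> real"
  assumes "p \<le> q" and cont: "continuous_on {p..q} f"
  shows "(integral {p..q} f)\<^sup>2 \<le> (q - p) * integral {p..q} (\<lambda>x. (f x)\<^sup>2)"
proof (cases "p = q")
  case False
  define m where "m = integral {p..q} f / (q - p)"
  have qp: "q - p > 0" using False assms by simp
  have int: "f integrable_on {p..q}" "(\<lambda>x. (f x)\<^sup>2) integrable_on {p..q}"
    using cont by (auto intro!: integrable_continuous_interval continuous_intros)
  have "0 \<le> integral {p..q} (\<lambda>x. (f x - m)\<^sup>2)"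
    by (intro integral_nonneg) (auto intro!: integrable_continuous_interval continuous_intros cont)
  also have "(\<lambda>x. (f x - m)\<^sup>2) = (\<lambda>x. (f x)\<^sup>2 - (2 * m) * f x + m\<^sup>2)"
    by (auto simp: power2_diff algebra_simps)
  also have "integral {p..q} \<dots> = integral {p..q} (\<lambda>x. (f x)\<^sup>2) - (2 * m) * integral {p..q} f + m\<^sup>2 * (q - p)"
  proof (rule integral_unique)
    have "((\<lambda>x. m\<^sup>2) has_integral m\<^sup>2 * (q - p)) {p..q}"
      using has_integral_const_real[of "m\<^sup>2" p q] assms by (simp add: mult.commute)
    then show "((\<lambda>x. (f x)\<^sup>2 - (2 * m) * f x + m\<^sup>2) has_integral
        integral {p..q} (\<lambda>x. (f x)\<^sup>2) - (2 * m) * integral {p..q} f + m\<^sup>2 * (q - p)) {p..q}"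
      using int by (intro has_integral_add has_integral_diff has_integral_mult_right)
        (auto simp: has_integral_integral)
  qed
  also have "\<dots> = integral {p..q} (\<lambda>x. (f x)\<^sup>2) - m * integral {p..q} f"
  proof -
    have "m\<^sup>2 * (q - p) = m * integral {p..q} f"
      using qp by (simp add: m_def power2_eq_square)
    then show ?thesis by simp
  qed
  finally have "(q - p) * (m * integral {p..q} f) \<le> (q - p) * integral {p..q} (\<lambda>x. (f x)\<^sup>2)"
    using qp by simp
  then show ?thesis using qp by (simp add: m_def power2_eq_square)
qed simp

section \<open>Calculus at a minimum and along curves\<close>

lemma second_derivative_nonneg_at_min:
  fixes g g' :: "real \<Rightarrow> real"
  assumes "0 < r"
    and g': "\<And>x. \<bar>x\<bar> < r \<Longrightarrow> (g has_real_derivative g' x) (at x)"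
    and g'': "(g' has_real_derivative c) (at 0)"
    and min: "\<And>x. \<bar>x\<bar> < r \<Longrightarrow> g 0 \<le> g x"
  shows "g' 0 = 0" "0 \<le> c"
proof -
  show z: "g' 0 = 0"
    using DERIV_local_min[OF g'[of 0] \<open>0 < r\<close>] min \<open>0 < r\<close> by auto
  show "0 \<le> c"
  proof (rule ccontr)
    assume "\<not> 0 \<le> c"
    then obtain d where d: "0 < d" "\<And>h. 0 < h \<Longrightarrow> h < d \<Longrightarrow> g' h < g' 0"
      using DERIV_neg_dec_right[OF g''] by force
    define h where "h = min d r / 2"
    have h: "0 < h" "h < d" "h < r" using d(1) \<open>0 < r\<close> by (auto simp: h_def)
    have "g h < g 0"
    proof (rule DERIV_neg_imp_decreasing_open[OF h(1)])
      fix x assume "0 < x" "x < h"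
      then show "\<exists>y. DERIV g x :> y \<and> y < 0" using g'[of x] d(2)[of x] z h by auto
    next
      show "continuous_on {0..h} g"
        using g' h by (intro DERIV_continuous_on[of _ g g']) (auto intro: has_field_derivative_at_within)
    qed
    then show False using min[of h] h by simp
  qed
qed

lemma periodic_vector_derivative:
  fixes f :: "real \<Rightarrow> 'a::real_normed_vector"
  assumes "\<And>x. (f has_vector_derivative f' x) (at x)" "\<And>x. f (x + p) = f x"
  shows "f' (x + p) = f' x"
proof -
  have "((\<lambda>x. x + p) has_vector_derivative 1) (at x)"
    by (auto intro!: derivative_eq_intros simp flip: has_real_derivative_iff_has_vector_derivative)
  from vector_diff_chain_at[OF this assms(1)]
  have "(f has_vector_derivative f' (x + p)) (at x)" by (simp add: o_def assms(2))
  then show ?thesis using vector_derivative_unique_at[OF _ assms(1)] by blast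
qed

lemma has_real_derivative_inner:
  fixes u v :: "real \<Rightarrow> 'a::real_inner"
  assumes "(u has_vector_derivative u') (at x)" "(v has_vector_derivative v') (at x)"
  shows "((\<lambda>x. u x \<bullet> v x) has_real_derivative (u x \<bullet> v' + u' \<bullet> v x)) (at x)"
  unfolding has_real_derivative_iff_has_vector_derivative
  by (rule bounded_bilinear.has_vector_derivative[OF bounded_bilinear_inner assms])

lemma has_real_derivative_norm:
  fixes u :: "real \<Rightarrow> 'a::real_inner"
  assumes "(u has_vector_derivative u') (at x within X)" "u x \<noteq> 0"
  shows "((\<lambda>x. norm (u x)) has_real_derivative (u x \<bullet> u') / norm (u x)) (at x within X)"
proof -
  have "(norm has_derivative (\<lambda>y. u x \<bullet> y / norm (u x))) (at (u x))"
    using has_derivative_norm[OF assms(2)] by (simp add: sgn_div_norm inner_commute divide_inverse mult.commute)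
  then show ?thesis
    using vector_derivative_diff_chain_within[OF assms(1) has_derivative_at_withinI]
    by (simp add: o_def has_real_derivative_iff_has_vector_derivative)
qed

text \<open>\<open>k\<close> is the curvature vector in \<real>^3, not in the sphere: it includes
  the component \<open>- c\<close> forced by the sphere, whence \<open>norm (k s)\<close> is at
  least 1.\<close>

locale spherical_loop =
  fixes c T k :: "real \<Rightarrow> real^3" and L :: real
  assumes L_pos: "0 < L"
    and norm_c: "\<And>s. norm (c s) = 1"
    and c_deriv: "\<And>s. (c has_vector_derivative T s) (at s)"
    and norm_T: "\<And>s. norm (T s) = 1"
    and T_deriv: "\<And>s. (T has_vector_derivative k s) (at s)"
    and k_cont: "continuous_on UNIV k"
    and c_period: "\<And>s. c (s + L) = c s"
begin

lemma orthogonal_derivative: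
  fixes f :: "real \<Rightarrow> real^3" and g :: "real^3"
  assumes "\<And>s. norm (f s) = 1" "(f has_vector_derivative g) (at s)"
  shows "f s \<bullet> g = 0"
  using sphere_curve_orthogonal[of f 1 s] assms vector_derivative_at[OF assms(2)] differentiableI_vector[OF assms(2)]
  by auto

lemma c_T: "c s \<bullet> T s = 0" and T_k: "T s \<bullet> k s = 0"
  by (rule orthogonal_derivative[OF norm_c c_deriv], rule orthogonal_derivative[OF norm_T T_deriv])

lemma c_k: "c s \<bullet> k s = -1"
proof -
  have "((\<lambda>s. c s \<bullet> T s) has_vector_derivative (c s \<bullet> k s + T s \<bullet> T s)) (at s)"
    by (rule bounded_bilinear.has_vector_derivative[OF bounded_bilinear_inner c_deriv T_deriv])
  moreover have "((\<lambda>s. c s \<bullet> T s) has_vector_derivative 0) (at s)"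
    by (simp add: c_T)
  ultimately have "c s \<bullet> k s + T s \<bullet> T s = 0" using vector_derivative_unique_at by blast
  then show ?thesis using norm_T[of s] by (simp add: norm_eq_1)
qed

lemma c_c: "c s \<bullet> c s = 1" and T_T: "T s \<bullet> T s = 1"
  using norm_c norm_T by (simp_all add: norm_eq_1)

lemma norm_k: "1 \<le> norm (k s)"
  using Cauchy_Schwarz_ineq2[of "c s" "k s"] norm_c c_k by simp

lemma T_period: "T (s + L) = T s"
  by (rule periodic_vector_derivative[OF c_deriv c_period])

lemma T_cont: "continuous_on S T"
  using has_vector_derivative_continuous[OF has_vector_derivative_at_within[OF T_deriv]]
  by (simp add: continuous_on_eq_continuous_within)

lemma k_cont': "continuous_on S k"
  using k_cont continuous_on_subset by blast

lemma integrable_k: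
  "(\<lambda>s. norm (k s)) integrable_on {p..q}" "(\<lambda>s. (norm (k s))\<^sup>2) integrable_on {p..q}"
  by (auto intro!: integrable_continuous_interval continuous_intros k_cont')

lemma length_le_integral_square: "p \<le> q \<Longrightarrow> q - p \<le> integral {p..q} (\<lambda>s. (norm (k s))\<^sup>2)"
proof -
  assume "p \<le> q"
  have "integral {p..q} (\<lambda>s. 1) \<le> integral {p..q} (\<lambda>s. (norm (k s))\<^sup>2)"
    by (intro integral_le integrable_k) (auto simp: norm_k one_le_power)
  then show ?thesis using \<open>p \<le> q\<close> by simp
qed

lemma has_integral_T:
  assumes "p \<le> q" shows "(T has_integral (c q - c p)) {p..q}"
  using assms c_deriv by (intro fundamental_theorem_of_calculus) (auto intro: has_vector_derivative_at_within)

lemma has_integral_inner_T: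
  assumes "p \<le> q" shows "((\<lambda>s. T s \<bullet> m) has_integral ((c q - c p) \<bullet> m)) {p..q}"
  using has_integral_linear[OF has_integral_T[OF assms] bounded_linear_inner_left[of m]]
  by (simp add: o_def)

text \<open>The factor \<open>e < 1\<close> avoids the singularity of \<open>arccos\<close> at \<open>\<plusminus>1\<close>.\<close>

lemma arccos_scaled_le_integral:
  assumes "p \<le> q" "0 < e" "e < 1"
  shows "arccos (e * (T p \<bullet> T q)) - arccos e \<le> integral {p..q} (\<lambda>s. norm (k s))"
proof -
  define K where "K u = integral {p..u} (\<lambda>s. norm (k s))" for u
  define f where "f u = T p \<bullet> T u" for u
  have f_le: "\<bar>f u\<bar> \<le> 1" for u
    using Cauchy_Schwarz_ineq2[of "T p" "T u"] norm_T by (simp add: f_def)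
  have ef: "- 1 < e * f u" "e * f u < 1" for u
  proof -
    have "\<bar>e * f u\<bar> \<le> e * 1"
      unfolding abs_mult using f_le[of u] assms by (intro mult_mono) auto
    then show "- 1 < e * f u" "e * f u < 1" using assms by linarith+
  qed
  have f': "(f has_real_derivative (T p \<bullet> k u)) (at u)" for u
    unfolding f_def has_real_derivative_iff_has_vector_derivative
    using bounded_linear.has_vector_derivative[OF bounded_linear_inner_right T_deriv] by simp
  \<comment> \<open>Since \<open>k u\<close> is orthogonal to \<open>T u\<close>, only the component
    \<open>r\<close> of \<open>T p\<close> orthogonal to \<open>T u\<close> contributes; its norm is
    the sine of the angle between the two tangents.\<close>
  have f'_le: "e * \<bar>T p \<bullet> k u\<bar> \<le> norm (k u) * sqrt (1 - (e * f u)\<^sup>2)" for u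
  proof -
    define r where "r = T p - f u *\<^sub>R T u"
    have "r \<bullet> k u = T p \<bullet> k u" using T_k by (simp add: r_def inner_diff_left)
    then have "\<bar>T p \<bullet> k u\<bar> \<le> norm r * norm (k u)"
      using Cauchy_Schwarz_ineq2[of r "k u"] by simp
    moreover have "norm r = sqrt (1 - (f u)\<^sup>2)"
      using T_T by (simp add: r_def norm_eq_sqrt_inner inner_diff_left inner_diff_right f_def
          inner_commute power2_eq_square)
    ultimately have "e * \<bar>T p \<bullet> k u\<bar> \<le> norm (k u) * (e * sqrt (1 - (f u)\<^sup>2))"
      using assms by (simp add: mult.commute mult.left_commute)
    also have "e * sqrt (1 - (f u)\<^sup>2) \<le> sqrt (1 - (e * f u)\<^sup>2)"
    proof -
      have "e\<^sup>2 * (1 - (f u)\<^sup>2) \<le> 1 - (e * f u)\<^sup>2"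
        using assms by (simp add: algebra_simps power_mult_distrib power_le_one)
      then have "sqrt (e\<^sup>2 * (1 - (f u)\<^sup>2)) \<le> sqrt (1 - (e * f u)\<^sup>2)" by simp
      then show ?thesis using assms by (simp add: real_sqrt_mult)
    qed
    finally show ?thesis by (simp add: mult_left_mono)
  qed
  have K': "(K has_real_derivative norm (k u)) (at u within {p..q})" if "u \<in> {p..q}" for u
    using integral_has_real_derivative[of p q "\<lambda>s. norm (k s)"] that unfolding K_def
    by (auto intro!: continuous_intros k_cont')
  have "K p - arccos (e * f p) \<le> K q - arccos (e * f q)"
  proof (rule DERIV_nonneg_imp_increasing_open[OF assms(1), where f = "\<lambda>u. K u - arccos (e * f u)"])
    fix u assume u: "p < u" "u < q"
    have "(K has_real_derivative norm (k u)) (at u)"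
      using K'[of u] u at_within_interior[of u "{p..q}"] by simp
    moreover have "((\<lambda>u. arccos (e * f u)) has_real_derivative
        inverse (- sqrt (1 - (e * f u)\<^sup>2)) * (e * (T p \<bullet> k u))) (at u)"
      using DERIV_chain2[OF DERIV_arccos[OF ef] DERIV_cmult[OF f']] by blast
    ultimately have "((\<lambda>u. K u - arccos (e * f u)) has_real_derivative
        norm (k u) - inverse (- sqrt (1 - (e * f u)\<^sup>2)) * (e * (T p \<bullet> k u))) (at u)"
      by (rule DERIV_diff)
    moreover have "0 \<le> norm (k u) - inverse (- sqrt (1 - (e * f u)\<^sup>2)) * (e * (T p \<bullet> k u))"
    proof -
      have "(e * f u)\<^sup>2 < 1" using ef[of u] by (simp add: abs_square_less_1 abs_less_iff)
      then have "0 < sqrt (1 - (e * f u)\<^sup>2)" by simp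
      moreover have "e * - \<bar>T p \<bullet> k u\<bar> \<le> e * (T p \<bullet> k u)"
        using assms by (intro mult_left_mono) auto
      ultimately show ?thesis using f'_le[of u] by (simp add: field_simps)
    qed
    ultimately show "\<exists>y. ((\<lambda>u. K u - arccos (e * f u)) has_real_derivative y) (at u) \<and> 0 \<le> y"
      by blast
  next
    have "continuous_on {p..q} K" by (rule DERIV_continuous_on[OF K'])
    moreover have "continuous_on {p..q} f"
      unfolding f_def by (intro continuous_intros T_cont)
    ultimately show "continuous_on {p..q} (\<lambda>u. K u - arccos (e * f u))"
      using ef by (intro continuous_intros continuous_on_arccos) (auto intro: less_imp_le)
  qed
  then show ?thesis using T_T by (simp add: K_def f_def)
qed

text \<open>The tangent indicatrix moves on the unit sphere with speed \<open>norm (k s)\<close>, so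
  its length dominates the spherical distance of its end points. The scaled estimate is carried to
  the limit \<open>e = 1\<close> from the left.\<close>

lemma arccos_le_integral:
  assumes "p \<le> q" shows "arccos (T p \<bullet> T q) \<le> integral {p..q} (\<lambda>s. norm (k s))"
proof (rule tendsto_upperbound)
  define g where "g e = arccos (e * (T p \<bullet> T q)) - arccos e" for e :: real
  have le: "\<bar>T p \<bullet> T q\<bar> \<le> 1" using Cauchy_Schwarz_ineq2[of "T p" "T q"] norm_T by simp
  have "continuous_on {-1..1} g"
  proof -
    have "- 1 \<le> e * (T p \<bullet> T q) \<and> e * (T p \<bullet> T q) \<le> 1" if "e \<in> {-1..1}" for e
    proof -
      have "\<bar>e\<bar> * \<bar>T p \<bullet> T q\<bar> \<le> 1 * 1" using le that by (intro mult_mono) auto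
      then show ?thesis unfolding abs_mult[symmetric] by linarith
    qed
    then show ?thesis unfolding g_def
      by (intro continuous_on_diff continuous_on_arccos continuous_on_mult_right continuous_on_id) auto
  qed
  then have lim: "(g \<longlongrightarrow> g 1) (at 1 within {-1..1})" by (simp add: continuous_on)
  have "(g \<longlongrightarrow> g 1) (at 1 within {-1<..<1})"
    by (rule tendsto_within_subset[OF lim]) auto
  moreover have "at_left 1 = at 1 within {-1<..<1::real}"
    by (rule at_within_nhd[of _ "{-1<..}"]) auto
  moreover have "g 1 = arccos (T p \<bullet> T q)" by (simp add: g_def)
  ultimately show "(g \<longlongrightarrow> arccos (T p \<bullet> T q)) (at_left 1)" by simp
  show "\<forall>\<^sub>F e in at_left 1. g e \<le> integral {p..q} (\<lambda>s. norm (k s))"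
    unfolding eventually_at_left_field g_def
    using arccos_scaled_le_integral[OF assms] by (intro exI[of _ 0]) auto
qed simp

lemma turning_square_le:
  assumes "p \<le> q"
  shows "(arccos (T p \<bullet> T q))\<^sup>2 \<le> (q - p) * integral {p..q} (\<lambda>s. (norm (k s))\<^sup>2)"
proof -
  have "\<bar>T p \<bullet> T q\<bar> \<le> 1" using Cauchy_Schwarz_ineq2[of "T p" "T q"] norm_T by simp
  then have "0 \<le> arccos (T p \<bullet> T q)" by (intro arccos_lbound) auto
  then have "(arccos (T p \<bullet> T q))\<^sup>2 \<le> (integral {p..q} (\<lambda>s. norm (k s)))\<^sup>2"
    using arccos_le_integral[OF assms] by (intro power_mono)
  also have "\<dots> \<le> (q - p) * integral {p..q} (\<lambda>s. (norm (k s))\<^sup>2)"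
    by (intro integral_square_le assms continuous_intros k_cont')
  finally show ?thesis .
qed

end

text \<open>With \<open>y = arctan x\<close> the quotient becomes \<open>sin y * cos y\<close>,
  which is at most \<open>y\<close>.\<close>

lemma arctan_ge_quotient:
  fixes x :: real
  assumes "0 \<le> x" shows "x / (1 + x\<^sup>2) \<le> arctan x"
proof -
  define y where "y = arctan x"
  have y: "0 \<le> y" "y < pi / 2" "tan y = x"
    using assms arctan_bounded[of x] by (auto simp: y_def arctan)
  then have c: "cos y > 0" by (intro cos_gt_zero_pi) auto
  have "sin y * cos y \<le> y * 1"
    using y c sin_x_le_x[of y] by (intro mult_mono) auto
  moreover have "x / (1 + x\<^sup>2) = sin y * cos y"
  proof -
    have "1 + x\<^sup>2 = 1 / (cos y)\<^sup>2" using c y(3) tan_sec[of y] by (simp add: inverse_eq_divide power_divide)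
    then show ?thesis using c y(3)[symmetric] by (simp add: tan_def power2_eq_square)
  qed
  ultimately show ?thesis by (simp add: y_def)
qed

text \<open>Expansion of \<open>a \<bullet> b\<close> in the orthogonal frame \<open>v\<close>,
  \<open>w\<close>, \<open>cross3 v w\<close>, cleared of denominators and solved for the product of
  the components along the cross product.\<close>

lemma triple_product_mult:
  fixes a b v w :: "real^3"
  assumes "v \<bullet> w = 0"
  shows "(a \<bullet> cross3 v w) * (b \<bullet> cross3 v w)
    = (a \<bullet> b) * ((v \<bullet> v) * (w \<bullet> w)) - (a \<bullet> v) * ((b \<bullet> v) * (w \<bullet> w)) - (a \<bullet> w) * ((v \<bullet> v) * (b \<bullet> w))"
proof -
  have "(a \<bullet> cross3 v w) * (b \<bullet> cross3 v w)
    = (a \<bullet> b) * ((v \<bullet> v) * (w \<bullet> w) - (v \<bullet> w)\<^sup>2) - (a \<bullet> v) * ((b \<bullet> v) * (w \<bullet> w) - (v \<bullet> w) * (b \<bullet> w))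
      + (a \<bullet> w) * ((b \<bullet> v) * (v \<bullet> w) - (v \<bullet> v) * (b \<bullet> w))"
    unfolding inner_vec_def sum_3 cross3_def vector_3 inner_real_def by algebra
  then show ?thesis using assms by simp
qed

text \<open>
  A tangent vector of the sphere is determined up to a reflection by its component along a chord,
  so for two tangents with equal components there are only two possibilities for their inner product.
\<close>

lemma tangents_at_equal_chord_slope:
  fixes c1 c2 T1 T2 :: "real^3" and d f h :: real
  assumes unit: "norm c1 = 1" "norm c2 = 1" "norm T1 = 1" "norm T2 = 1"
    and orth: "c1 \<bullet> T1 = 0" "c2 \<bullet> T2 = 0"
    and d: "d = norm (c2 - c1)" "0 < d"
    and f: "(c2 - c1) \<bullet> T1 = d * f" "(c2 - c1) \<bullet> T2 = d * f"
    and h: "h = 1 - d\<^sup>2 / 4"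
  shows "f\<^sup>2 \<le> h"
    and "h * (T1 \<bullet> T2) = h * (2 * f\<^sup>2 - 1) \<or> h * (1 - T1 \<bullet> T2) = f\<^sup>2 * d\<^sup>2 / 2"
proof -
  \<comment> \<open>\<open>v\<close> and \<open>w\<close> are orthogonal because both end points
    have norm 1, and \<open>h\<close> is the squared distance of the midpoint of the chord from the
    origin. The components of both tangents along \<open>v\<close> and \<open>w\<close> are known,
    so each tangent is determined up to the sign of its component along
    \<open>cross3 v w\<close>.\<close>
  define v w where "v = c2 - c1" and "w = c1 + c2"
  have u: "c1 \<bullet> c1 = 1" "c2 \<bullet> c2 = 1" "T1 \<bullet> T1 = 1" "T2 \<bullet> T2 = 1"
    using unit by (auto simp: norm_eq_1)
  have vv: "v \<bullet> v = d\<^sup>2" by (simp add: v_def d power2_norm_eq_inner)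
  have ww: "w \<bullet> w = 4 * h"
    using vv u by (simp add: v_def w_def h inner_add inner_diff inner_commute)
  have vw: "v \<bullet> w = 0"
    using u by (simp add: v_def w_def inner_add inner_diff inner_commute)
  have t: "T1 \<bullet> v = d * f" "T2 \<bullet> v = d * f" "T1 \<bullet> w = d * f" "T2 \<bullet> w = - (d * f)"
    using f orth by (auto simp: v_def w_def inner_add inner_diff inner_commute)
  define x1 x2 where "x1 = T1 \<bullet> cross3 v w" and "x2 = T2 \<bullet> cross3 v w"
  have hd: "d\<^sup>2 = 4 - 4 * h" by (simp add: h)
  have "x1 * x1 = d\<^sup>2 * (4 * h - 4 * h * f\<^sup>2 - d\<^sup>2 * f\<^sup>2)" "x2 * x2 = d\<^sup>2 * (4 * h - 4 * h * f\<^sup>2 - d\<^sup>2 * f\<^sup>2)"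
    and x12: "x1 * x2 = d\<^sup>2 * (4 * h * (T1 \<bullet> T2) - 4 * h * f\<^sup>2 + d\<^sup>2 * f\<^sup>2)"
    unfolding x1_def x2_def triple_product_mult[OF vw] using t vv ww u
    by (auto simp: algebra_simps power2_eq_square)
  moreover have "4 * h - 4 * h * f\<^sup>2 - d\<^sup>2 * f\<^sup>2 = 4 * (h - f\<^sup>2)"
    unfolding hd by (simp add: algebra_simps)
  ultimately have x1: "x1 * x1 = d\<^sup>2 * (4 * (h - f\<^sup>2))" and x2: "x2 * x2 = d\<^sup>2 * (4 * (h - f\<^sup>2))"
    by auto
  have "0 \<le> d\<^sup>2 * (4 * (h - f\<^sup>2))" unfolding x1[symmetric] by simp
  then show "f\<^sup>2 \<le> h" using d(2) by (simp add: zero_le_mult_iff)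
  have "(x1 - x2) * (x1 + x2) = 0" using x1 x2 by (simp add: algebra_simps)
  then have "x2 = x1 \<or> x2 = - x1" by (auto simp: eq_neg_iff_add_eq_0 add.commute)
  \<comment> \<open>Equal signs give the configuration with both tangents on the same side of the
    chord, opposite signs the one of a circle cut by the chord.\<close>
  then consider "x1 * x2 = x1 * x1" | "x1 * x2 = - (x1 * x1)" by auto
  then show "h * (T1 \<bullet> T2) = h * (2 * f\<^sup>2 - 1) \<or> h * (1 - T1 \<bullet> T2) = f\<^sup>2 * d\<^sup>2 / 2"
  proof cases
    case 1
    then have "4 * h * (T1 \<bullet> T2) - 4 * h * f\<^sup>2 + d\<^sup>2 * f\<^sup>2 = 4 * (h - f\<^sup>2)"
      unfolding x12 x1 using d(2) by simp
    then have "h * (1 - T1 \<bullet> T2) = f\<^sup>2 * d\<^sup>2 / 2" unfolding hd by (simp add: algebra_simps)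
    then show ?thesis ..
  next
    case 2
    then have "d\<^sup>2 * (4 * h * (T1 \<bullet> T2) - 4 * h * f\<^sup>2 + d\<^sup>2 * f\<^sup>2) = d\<^sup>2 * - (4 * (h - f\<^sup>2))"
      unfolding x12 x1 by (simp only: mult_minus_right)
    then have "4 * h * (T1 \<bullet> T2) - 4 * h * f\<^sup>2 + d\<^sup>2 * f\<^sup>2 = - (4 * (h - f\<^sup>2))"
      using d(2) by (simp only: mult_cancel_left) auto
    then have "h * (T1 \<bullet> T2) = h * (2 * f\<^sup>2 - 1)" unfolding hd by (simp add: algebra_simps)
    then show ?thesis ..
  qed
qed

section \<open>Fenchel's theorem and variations of the chord\<close>

context spherical_loop
begin

lemma T_T_bound: "\<bar>T p \<bullet> T q\<bar> \<le> 1"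
  using Cauchy_Schwarz_ineq2[of "T p" "T q"] norm_T by simp

text \<open>Fenchel's theorem. The loop is cut at \<open>u\<close> into two arcs of equal total
  curvature. If each is less than \<open>pi\<close>, every tangent has positive inner product with
  \<open>T 0 + T u\<close>, whereas the tangents of a closed curve integrate to zero.\<close>

theorem total_curvature_ge: "2 * pi \<le> integral {0..L} (\<lambda>s. norm (k s))"
proof (rule ccontr)
  define F where "F u = integral {0..u} (\<lambda>s. norm (k s))" for u
  assume "\<not> ?thesis"
  then have FL: "F L < 2 * pi" by (simp add: F_def)
  have F0: "F 0 = 0" by (simp add: F_def)
  have F_mono: "integral {p..q} (\<lambda>s. norm (k s)) = F q - F p" if "0 \<le> p" "p \<le> q" for p q
    using Henstock_Kurzweil_Integration.integral_combine[of 0 p q "\<lambda>s. norm (k s)"] that integrable_k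
    by (simp add: F_def)
  have "continuous_on {0..L} F"
    unfolding F_def by (rule indefinite_integral_continuous_1[OF integrable_k(1)])
  moreover have "0 \<le> F L" unfolding F_def by (intro integral_nonneg integrable_k) auto
  ultimately obtain u where u: "0 \<le> u" "u \<le> L" "F u = F L / 2"
    using IVT'[of F 0 "F L / 2" L] F0 L_pos by auto
  \<comment> \<open>The angles from \<open>T r\<close> to the two end tangents add up to less than
    \<open>pi\<close>, so the sum of their cosines is positive.\<close>
  have pos: "0 < T p \<bullet> T r + T r \<bullet> T q" if "0 \<le> p" "p \<le> r" "r \<le> q" "F q - F p < pi" for p q r
  proof -
    have "arccos (T p \<bullet> T r) + arccos (T r \<bullet> T q) \<le> F q - F p"
      using arccos_le_integral[of p r] arccos_le_integral[of r q] that by (simp add: F_mono)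
    then have "arccos (T p \<bullet> T r) < arccos (- (T r \<bullet> T q))"
      using that T_T_bound[of r q] by (subst arccos_minus) (auto simp: abs_le_iff)
    then show ?thesis using T_T_bound[of p r] T_T_bound[of r q] by (subst (asm) arccos_less_mono) auto
  qed
  have TL: "T L = T 0" using T_period[of 0] by simp
  have *: "0 < T r \<bullet> (T 0 + T u)" if "r \<in> {0..L}" for r
  proof (cases "r \<le> u")
    case True
    then show ?thesis using pos[of 0 r u] that u FL F0 by (simp add: inner_add_right inner_commute)
  next
    case False
    then show ?thesis using pos[of u r L] that u FL TL by (simp add: inner_add_right inner_commute)
  qed
  have "integral {0..L} (\<lambda>s. 0) < integral {0..L} (\<lambda>s. T s \<bullet> (T 0 + T u))"
    by (intro integral_less_real continuous_intros T_cont) (use * L_pos in auto)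
  moreover have "integral {0..L} (\<lambda>s. T s \<bullet> (T 0 + T u)) = 0"
    using has_integral_inner_T[of 0 L "T 0 + T u"] L_pos c_period[of 0] by (simp add: integral_unique)
  ultimately show False by simp
qed

lemma integral_square_ge: "4 * pi\<^sup>2 / L \<le> integral {0..L} (\<lambda>s. (norm (k s))\<^sup>2)"
proof -
  have "(2 * pi)\<^sup>2 \<le> (integral {0..L} (\<lambda>s. norm (k s)))\<^sup>2"
    using total_curvature_ge by (intro power_mono) auto
  also have "\<dots> \<le> (L - 0) * integral {0..L} (\<lambda>s. (norm (k s))\<^sup>2)"
    using L_pos by (intro integral_square_le continuous_intros k_cont') auto
  finally show ?thesis using L_pos by (simp add: field_simps)
qed

text \<open>First and second order conditions when the end points move with velocities \<alpha> and
  \<beta>. Squares are compared, since the squared chord is smooth enough without a root; this keeps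
  the minimum as long as \<psi> - \<eta> is positive, hence near 0. As \<psi> sees only \<beta> -
  \<alpha>, equal velocities remove its second derivative, and opposite unit velocities give it
  weight 4.\<close>

lemma chord_variations:
  fixes \<psi> \<psi>' :: "real \<Rightarrow> real"
  assumes \<psi>: "\<And>r. (\<psi> has_real_derivative \<psi>' r) (at r)"
    and \<psi>': "(\<psi>' has_real_derivative r) (at (s2 - s1))"
    and min: "\<And>p q. \<psi> (q - p) - \<eta> \<le> norm (c q - c p)"
    and eq: "norm (c s2 - c s1) = \<psi> (s2 - s1) - \<eta>"
    and d: "d = norm (c s2 - c s1)" "0 < d"
    and f: "f = \<psi>' (s2 - s1)"
  shows "(c s2 - c s1) \<bullet> (\<beta> *\<^sub>R T s2 - \<alpha> *\<^sub>R T s1) = d * f * (\<beta> - \<alpha>)"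
    and "0 \<le> \<alpha>\<^sup>2 + \<beta>\<^sup>2 - 2 * \<alpha> * \<beta> * (T s1 \<bullet> T s2) + (c s2 - c s1) \<bullet> (\<beta>\<^sup>2 *\<^sub>R k s2 - \<alpha>\<^sup>2 *\<^sub>R k s1)
      - (f\<^sup>2 + d * r) * (\<beta> - \<alpha>)\<^sup>2"
proof -
  define P Q R where "P e = s1 + \<alpha> * e" and "Q e = s2 + \<beta> * e" and "R e = s2 - s1 + (\<beta> - \<alpha>) * e" for e :: real
  have PQR: "Q e - P e = R e" for e by (simp add: P_def Q_def R_def algebra_simps)
  define D where "D e = c (Q e) - c (P e)" for e
  define D' where "D' e = \<beta> *\<^sub>R T (Q e) - \<alpha> *\<^sub>R T (P e)" for e
  define g where "g e = D e \<bullet> D e - (\<psi> (R e) - \<eta>)\<^sup>2" for e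
  define g' where "g' e = 2 * (D e \<bullet> D' e) - 2 * (\<psi> (R e) - \<eta>) * (\<psi>' (R e) * (\<beta> - \<alpha>))" for e
  have c0: "D 0 = c s2 - c s1" "R 0 = s2 - s1" "D' 0 = \<beta> *\<^sub>R T s2 - \<alpha> *\<^sub>R T s1"
    by (simp_all add: D_def P_def Q_def R_def D'_def)
  have P': "(P has_real_derivative \<alpha>) (at e)" and Q': "(Q has_real_derivative \<beta>) (at e)"
    and R': "(R has_real_derivative (\<beta> - \<alpha>)) (at e)" for e
    unfolding P_def Q_def R_def by (auto intro!: derivative_eq_intros)
  have \<psi>R: "((\<lambda>e. \<psi> (R e)) has_real_derivative \<psi>' (R e) * (\<beta> - \<alpha>)) (at e)" for e
    using DERIV_chain2[OF \<psi> R'] by simp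
  have "isCont (\<lambda>e. \<psi> (R e) - \<eta>) 0"
    using DERIV_isCont[OF \<psi>R] by (intro continuous_diff continuous_const)
  then have "\<forall>\<^sub>F e in at 0. 0 < \<psi> (R e) - \<eta>"
    using eq d c0 by (intro order_tendstoD(1)[of _ "\<psi> (R 0) - \<eta>"]) (auto simp: isCont_def)
  then obtain \<rho> where \<rho>: "0 < \<rho>" "\<And>e. e \<noteq> 0 \<Longrightarrow> \<bar>e\<bar> < \<rho> \<Longrightarrow> 0 < \<psi> (R e) - \<eta>"
    by (auto simp: eventually_at dist_real_def)
  have g0: "g 0 = 0" using eq by (simp add: g_def c0 power2_norm_eq_inner[symmetric])
  have g_min: "g 0 \<le> g e" if "\<bar>e\<bar> < \<rho>" for e
  proof (cases "e = 0")
    case False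
    then have "0 < \<psi> (R e) - \<eta>" using \<rho> that by blast
    moreover have "\<psi> (R e) - \<eta> \<le> norm (D e)"
      using min[of "Q e" "P e"] by (simp add: PQR D_def)
    ultimately have "(\<psi> (R e) - \<eta>)\<^sup>2 \<le> (norm (D e))\<^sup>2" by (intro power_mono) auto
    then show ?thesis using g0 by (simp add: g_def power2_norm_eq_inner)
  qed simp
  note chain = vector_diff_chain_at[unfolded o_def, OF P'[unfolded has_real_derivative_iff_has_vector_derivative]]
    vector_diff_chain_at[unfolded o_def, OF Q'[unfolded has_real_derivative_iff_has_vector_derivative]]
  have D_D': "(D has_vector_derivative D' e) (at e)" for e
    unfolding D_def D'_def
    by (intro has_vector_derivative_diff chain c_deriv)
  have D'_D: "(D' has_vector_derivative (\<beta>\<^sup>2 *\<^sub>R k (Q e) - \<alpha>\<^sup>2 *\<^sub>R k (P e))) (at e)" for e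
    unfolding D'_def power2_eq_square scaleR_scaleR[symmetric]
    by (intro has_vector_derivative_diff chain T_deriv bounded_linear.has_vector_derivative[OF bounded_linear_scaleR_right])
  have g': "(g has_real_derivative g' e) (at e)" for e
    unfolding g_def g'_def
    by (rule derivative_eq_intros has_real_derivative_inner[OF D_D' D_D'] \<psi>R refl)+ (simp add: inner_commute)
  have "(\<psi>' has_real_derivative r) (at (R 0))" using \<psi>' c0 by simp
  then have \<psi>'R: "((\<lambda>e. \<psi>' (R e)) has_real_derivative r * (\<beta> - \<alpha>)) (at 0)"
    using DERIV_chain2[OF _ R'] by simp
  have g'': "(g' has_real_derivative 2 * (D 0 \<bullet> (\<beta>\<^sup>2 *\<^sub>R k (Q 0) - \<alpha>\<^sup>2 *\<^sub>R k (P 0)) + D' 0 \<bullet> D' 0)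
      - 2 * ((\<psi>' (R 0) * (\<beta> - \<alpha>))\<^sup>2 + (\<psi> (R 0) - \<eta>) * (r * (\<beta> - \<alpha>) * (\<beta> - \<alpha>)))) (at 0)"
    unfolding g'_def
    by (rule derivative_eq_intros has_real_derivative_inner[OF D_D' D'_D] \<psi>R \<psi>'R refl)+
       (simp add: algebra_simps power2_eq_square)
  note conds = second_derivative_nonneg_at_min[OF \<rho>(1) g' g'' g_min]
  show "(c s2 - c s1) \<bullet> (\<beta> *\<^sub>R T s2 - \<alpha> *\<^sub>R T s1) = d * f * (\<beta> - \<alpha>)"
    using conds(1) unfolding g'_def c0 d(1) f eq by algebra
  have "D' 0 \<bullet> D' 0 = \<alpha>\<^sup>2 + \<beta>\<^sup>2 - 2 * \<alpha> * \<beta> * (T s1 \<bullet> T s2)"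
    using T_T by (simp add: c0 inner_diff inner_commute power2_eq_square algebra_simps)
  moreover have "(\<psi>' (R 0) * (\<beta> - \<alpha>))\<^sup>2 + (\<psi> (R 0) - \<eta>) * (r * (\<beta> - \<alpha>) * (\<beta> - \<alpha>))
      = (f\<^sup>2 + d * r) * (\<beta> - \<alpha>)\<^sup>2"
    unfolding c0 f d(1) eq by algebra
  moreover have "Q 0 = s2" "P 0 = s1" by (simp_all add: P_def Q_def)
  ultimately show "0 \<le> \<alpha>\<^sup>2 + \<beta>\<^sup>2 - 2 * \<alpha> * \<beta> * (T s1 \<bullet> T s2) + (c s2 - c s1) \<bullet> (\<beta>\<^sup>2 *\<^sub>R k s2 - \<alpha>\<^sup>2 *\<^sub>R k s1)
      - (f\<^sup>2 + d * r) * (\<beta> - \<alpha>)\<^sup>2"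
    using conds(2) by (simp add: c0)
qed

end

section \<open>Scalar inequalities behind the two touching configurations\<close>

lemma circle_case_inequality:
  fixes L b z \<eta> d W J j :: real
  defines "S \<equiv> sin (pi * z)" and "C \<equiv> cos (pi * z)"
  defines "q \<equiv> 1 + b\<^sup>2 * S\<^sup>2" and "A \<equiv> arctan (b * S)"
  defines "f \<equiv> C / q"
  assumes pos: "0 < L" "0 < b" and z: "0 < z" "z \<le> 1 / 2"
    and d: "d = L * A / (pi * b) - \<eta>"
    and J: "4 * pi\<^sup>2 / L \<le> J"
    and j: "(2 * arccos f)\<^sup>2 \<le> z * L * j"
    and W: "- (4 * pi * S * (q + 2 * b\<^sup>2 * C\<^sup>2) / (L * q\<^sup>2)) \<le> W"
  shows "- \<eta> \<le> d + W - (L - J) * (A / (pi * b) - z * f) - f * (z * L - j)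
    - (4 * pi * A / b - 4 * pi * S / q) / L"
proof -
  define \<theta> where "\<theta> = arccos f"
  define \<phi> where "\<phi> = A / (pi * b)"
  have pz: "0 < pi * z" "pi * z \<le> pi / 2" using z by auto
  then have S: "0 < S" and C: "0 \<le> C" "C \<le> 1"
    unfolding S_def C_def using pi_gt_zero by (auto intro!: sin_gt_zero cos_ge_zero simp del: pi_gt_zero)
  have SC: "S\<^sup>2 + C\<^sup>2 = 1" by (simp add: S_def C_def)
  have q: "1 \<le> q" by (simp add: q_def)
  have f: "0 \<le> f" "f \<le> C" using C q by (auto simp: f_def divide_le_eq mult_le_cancel_left1)
  have zC: "pi * z * C \<le> S"
    unfolding C_def S_def using z by (intro self_mult_cos_le_sin) auto
  \<comment> \<open>This sign is what lets the lower bound on \<open>J\<close> enter.\<close>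
  have \<phi>_ge: "z * f \<le> \<phi>"
  proof -
    have "b * (pi * z * C) / q \<le> b * S / q" using zC pos q by (intro divide_right_mono mult_left_mono) auto
    also have "\<dots> \<le> A"
      using arctan_ge_quotient[of "b * S"] pos S by (simp add: q_def A_def power_mult_distrib)
    finally show ?thesis using pos by (simp add: \<phi>_def f_def field_simps)
  qed
  have "\<theta> \<ge> pi * z"
  proof -
    have "pi * z = arccos C" unfolding C_def using z by (simp add: arccos_cos field_simps)
    also have "\<dots> \<le> \<theta>" unfolding \<theta>_def using f C by (intro arccos_le_arccos) auto
    finally show ?thesis .
  qed
  moreover have "\<theta> \<le> pi / 2"
    using arccos_le_arccos[of 0 f] f C unfolding \<theta>_def by simp
  moreover have "cos \<theta> = f" using f C by (simp add: \<theta>_def)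
  ultimately have \<theta>: "2 * (pi * z) * (C - f) \<le> S * (\<theta>\<^sup>2 - (pi * z)\<^sup>2)"
    using arccos_square_convex[of "pi * z" \<theta>] z by (simp add: C_def S_def)
  have Cf: "C - f = C * b\<^sup>2 * S\<^sup>2 / q"
  proof -
    have "C * b\<^sup>2 * S\<^sup>2 = C * q - C" by (simp add: q_def algebra_simps)
    then show ?thesis using q by (simp add: f_def diff_divide_distrib)
  qed
  have "S * (2 * pi * z * C * b\<^sup>2 * S / q) \<le> S * (\<theta>\<^sup>2 - (pi * z)\<^sup>2)"
    using \<theta> unfolding Cf by (simp add: power2_eq_square mult_ac)
  then have \<theta>2: "2 * pi * z * C * b\<^sup>2 * S / q \<le> \<theta>\<^sup>2 - (pi * z)\<^sup>2"
    using S by (simp only: mult_le_cancel_left_pos)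
  \<comment> \<open>The first term, from the second derivative of the profile, splits into
    \<open>4 * pi * S / q\<close> and \<open>8 * pi * b\<^sup>2 * S * C\<^sup>2 / q\<^sup>2\<close>.
    The former cancels the last term, which stems from the decay of \<open>b\<close>; the latter is
    paid for by the excess of the turning angle \<open>2 * \<theta>\<close> over the value
    \<open>2 * pi * z\<close> of a round circle.\<close>
  have key: "0 \<le> - (4 * pi * S * (q + 2 * b\<^sup>2 * C\<^sup>2) / q\<^sup>2) - 4 * pi\<^sup>2 * z * f + f * (4 * \<theta>\<^sup>2 / z) + 4 * pi * S / q"
  proof -
    have "f * (4 * (2 * pi * z * C * b\<^sup>2 * S / q) / z) \<le> f * (4 * (\<theta>\<^sup>2 - (pi * z)\<^sup>2) / z)"
      using \<theta>2 z f by (intro mult_left_mono divide_right_mono) auto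
    moreover have "f * (4 * (\<theta>\<^sup>2 - (pi * z)\<^sup>2) / z) = f * (4 * \<theta>\<^sup>2 / z) - 4 * pi\<^sup>2 * z * f"
      using z by (simp add: field_simps power2_eq_square)
    moreover have "f * (4 * (2 * pi * z * C * b\<^sup>2 * S / q) / z) = 8 * pi * b\<^sup>2 * S * C\<^sup>2 / q\<^sup>2"
      using z q by (simp add: f_def power2_eq_square)
    moreover have "4 * pi * S * (q + 2 * b\<^sup>2 * C\<^sup>2) / q\<^sup>2 = 4 * pi * S / q + 8 * pi * b\<^sup>2 * S * C\<^sup>2 / q\<^sup>2"
      using q by (simp add: field_simps power2_eq_square)
    ultimately show ?thesis by linarith
  qed
  define X Y Z U V where "X = 4 * pi\<^sup>2 * \<phi> / L" and "Y = 4 * pi\<^sup>2 * z * f / L"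
    and "Z = f * (4 * \<theta>\<^sup>2 / z) / L" and "U = 4 * pi * S / q / L"
    and "V = 4 * pi * S * (q + 2 * b\<^sup>2 * C\<^sup>2) / q\<^sup>2 / L"
  \<comment> \<open>Fenchel's bound supplies \<open>X\<close>, which is exactly the other
    contribution of the decay of \<open>b\<close>.\<close>
  have "4 * pi\<^sup>2 / L * (\<phi> - z * f) \<le> J * (\<phi> - z * f)"
    using J \<phi>_ge by (intro mult_right_mono) auto
  moreover have "4 * pi\<^sup>2 / L * (\<phi> - z * f) = X - Y"
    unfolding X_def Y_def right_diff_distrib by (simp add: mult_ac)
  ultimately have "X - Y \<le> J * (\<phi> - z * f)" by simp
  moreover have "Z \<le> f * j"
  proof -
    have "4 * \<theta>\<^sup>2 / z / L \<le> j" using j z pos by (simp add: \<theta>_def field_simps power_mult_distrib)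
    then show ?thesis using f mult_left_mono[of "4 * \<theta>\<^sup>2 / z / L" j f] by (simp add: Z_def)
  qed
  moreover have "0 \<le> - V - Y + Z + U"
    using divide_right_mono[OF key, of L] pos
    by (simp add: V_def Y_def Z_def U_def diff_divide_distrib add_divide_distrib)
  moreover have "(L - J) * (\<phi> - z * f) = L * \<phi> - L * z * f - J * (\<phi> - z * f)" by (simp add: algebra_simps)
  moreover have "f * (z * L - j) = L * z * f - f * j" by (simp add: algebra_simps)
  moreover have "(4 * pi * A / b - 4 * pi * S / q) / L = X - U"
    by (simp add: X_def U_def \<phi>_def power2_eq_square diff_divide_distrib)
  moreover have "d = L * \<phi> - \<eta>" using d by (simp add: \<phi>_def)
  moreover have "- V \<le> W" using W by (simp add: V_def mult.commute[of L])
  ultimately show ?thesis unfolding \<phi>_def[symmetric] by linarith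
qed

text \<open>With \<open>cos A ^ 2 = 1 / (1 + b\<^sup>2 * S\<^sup>2)\<close> and
  \<open>C\<^sup>2 = 1 - (tan A)\<^sup>2 / (tan B)\<^sup>2\<close> this is
  \<open>tan_ratio_bound\<close> multiplied by \<open>cos A / A\<close>. That bound asks for
  \<open>A < B\<close>; for \<open>A = B\<close> the slope is 0.\<close>

lemma parallel_case_slope_bound:
  fixes b z h :: real
  defines "S \<equiv> sin (pi * z)" and "C \<equiv> cos (pi * z)"
  defines "A \<equiv> arctan (b * S)" and "B \<equiv> arctan b"
  assumes b: "0 < b" and z: "0 < z" "z \<le> 1 / 2" and h: "1 - A\<^sup>2 / B\<^sup>2 \<le> h"
  shows "(C / (1 + b\<^sup>2 * S\<^sup>2))\<^sup>2 \<le> h * (sin A * cos A / A)"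
proof -
  have S: "0 < S" "S \<le> 1"
    unfolding S_def using z by (auto intro!: sin_gt_zero simp: field_simps)
  have A: "0 < A" "A \<le> B" "B < pi / 2" "0 < B"
    using b S arctan_ubound by (auto simp: A_def B_def arctan_le_iff)
  have sA: "0 < sin A" and cA: "0 < cos A"
    using A by (auto intro!: sin_gt_zero cos_gt_zero)
  have tA: "tan A = b * S" and tB: "tan B = b" by (simp_all add: A_def B_def arctan)
  have q: "1 / (1 + b\<^sup>2 * S\<^sup>2) = (cos A)\<^sup>2"
    using tan_sec[of A] cA by (simp add: tA power_mult_distrib inverse_eq_divide power_divide)
  have C2: "C\<^sup>2 = 1 - (tan A)\<^sup>2 / (tan B)\<^sup>2"
    using b by (simp add: tA tB power_mult_distrib C_def S_def cos_squared_eq)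
  have "(C / (1 + b\<^sup>2 * S\<^sup>2))\<^sup>2 = C\<^sup>2 * (1 / (1 + b\<^sup>2 * S\<^sup>2))\<^sup>2" by (simp add: power_divide)
  also have "\<dots> = (cos A)\<^sup>2 * (cos A)\<^sup>2 * C\<^sup>2"
    unfolding q by (simp add: power2_eq_square)
  also have "\<dots> \<le> (sin A * cos A / A) * (1 - A\<^sup>2 / B\<^sup>2)"
  proof (cases "A = B")
    case False
    then have "A * cos A ^ 3 * C\<^sup>2 \<le> sin A * (1 - A\<^sup>2 / B\<^sup>2)"
      unfolding C2 using A by (intro tan_ratio_bound) auto
    then have "cos A / A * (A * cos A ^ 3 * C\<^sup>2) \<le> cos A / A * (sin A * (1 - A\<^sup>2 / B\<^sup>2))"
      using A cA by (intro mult_left_mono) auto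
    then show ?thesis using A by (simp add: eval_nat_numeral mult_ac)
  next
    case True
    then show ?thesis using A b C2 tB by simp
  qed
  also have "\<dots> \<le> (sin A * cos A / A) * h"
    using h A sA cA by (intro mult_left_mono) auto
  finally show ?thesis by (simp add: mult.commute)
qed

text \<open>By \<open>\<phi> * m = S / (pi * q)\<close> the decay of \<open>b\<close> costs
  \<open>4 * pi\<^sup>2 * \<phi> * (1 - m) / L\<close>, with the same factor \<open>1 - m\<close>
  that is left of the growth of the chord after the loss \<open>d * m\<close>. If \<open>L\<close>
  is at least \<open>2 * pi\<close>, the length of a great circle, the remaining growth
  \<open>L * \<phi> * (1 - m)\<close> suffices. If \<open>L\<close> is smaller, the deficit is
  covered by the excess of \<open>J\<close> over \<open>L\<close>, because
  \<open>z * f \<le> \<phi> * m\<close>.\<close>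

lemma parallel_case_inequality:
  fixes L b z \<eta> d W J j :: real
  defines "S \<equiv> sin (pi * z)" and "C \<equiv> cos (pi * z)"
  defines "q \<equiv> 1 + b\<^sup>2 * S\<^sup>2" and "A \<equiv> arctan (b * S)"
  defines "f \<equiv> C / q"
  assumes pos: "0 < L" "0 < b" "0 \<le> \<eta>" and z: "0 < z" "z \<le> 1 / 2"
    and d: "d = L * A / (pi * b) - \<eta>"
    and J: "4 * pi\<^sup>2 / L \<le> J" "L \<le> J"
    and j: "z * L \<le> j"
    and W: "- (d * (sin A * cos A / A)) \<le> W"
  shows "- \<eta> \<le> d + W - (L - J) * (A / (pi * b) - z * f) - f * (z * L - j)
    - (4 * pi * A / b - 4 * pi * S / q) / L"
proof -
  define \<phi> where "\<phi> = A / (pi * b)"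
  define m where "m = sin A * cos A / A"
  have pz: "0 < pi * z" "pi * z \<le> pi / 2" using z by auto
  then have S: "0 < S" and C: "0 \<le> C"
    unfolding S_def C_def using pi_gt_zero by (auto intro!: sin_gt_zero cos_ge_zero simp del: pi_gt_zero)
  have q: "1 \<le> q" by (simp add: q_def)
  have f: "0 \<le> f" using C q by (auto simp: f_def)
  have zC: "pi * z * C \<le> S"
    unfolding C_def S_def using z by (intro self_mult_cos_le_sin) auto
  have A: "0 < A" "A < pi / 2" using pos S arctan_ubound by (auto simp: A_def)
  have tA: "tan A = b * S" by (simp add: A_def arctan)
  have cA: "0 < cos A" using A by (intro cos_gt_zero) auto
  have "sin A * cos A = b * S / q"
  proof -
    have "sin A = b * S * cos A" using tA cA by (simp add: tan_def field_simps)
    moreover have "1 / q = (cos A)\<^sup>2"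
      using tan_sec[of A] cA by (simp add: q_def tA power_mult_distrib inverse_eq_divide power_divide)
    ultimately show ?thesis by (simp add: divide_inverse power2_eq_square)
  qed
  then have \<phi>m: "\<phi> * m = S / (pi * q)"
    using A pos by (simp add: \<phi>_def m_def)
  have m: "m \<le> 1"
  proof -
    have "sin A * cos A \<le> A * 1" using A cA sin_x_le_x[of A] by (intro mult_mono) auto
    then show ?thesis using A by (simp add: m_def)
  qed
  have \<phi>0: "0 < \<phi>" using A pos by (simp add: \<phi>_def)
  have \<phi>mf: "z * f \<le> \<phi> * m"
    unfolding \<phi>m f_def using zC q by (simp add: field_simps)
  then have \<phi>f: "z * f \<le> \<phi>" using m \<phi>0 by (smt (verit) mult_left_le)
  have "0 \<le> f * (j - z * L)" using j f by simp
  moreover have "4 * pi * A / b - 4 * pi * S / q = 4 * pi\<^sup>2 * (\<phi> * (1 - m))"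
    using \<phi>m by (simp add: right_diff_distrib) (simp add: \<phi>_def power2_eq_square)
  moreover have "L * A / (pi * b) = L * \<phi>" by (simp add: \<phi>_def)
  moreover have "- \<eta> \<le> d - d * m - (L - J) * (\<phi> - z * f) - 4 * pi\<^sup>2 * (\<phi> * (1 - m)) / L"
  proof (cases "4 * pi\<^sup>2 \<le> L\<^sup>2")
    case True
    have "0 \<le> (J - L) * (\<phi> - z * f)" using J \<phi>f by simp
    moreover have "4 * pi\<^sup>2 * (\<phi> * (1 - m)) / L \<le> L * \<phi> * (1 - m)"
      using mult_right_mono[OF True, of "\<phi> * (1 - m)"] pos m \<phi>0 by (simp add: field_simps power2_eq_square)
    moreover have "- \<eta> \<le> - \<eta> + \<eta> * m" using A pos cA by (simp add: m_def sin_ge_zero)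
    ultimately show ?thesis unfolding d using \<open>L * A / (pi * b) = L * \<phi>\<close> by (simp add: algebra_simps)
  next
    case False
    have "(4 * pi\<^sup>2 / L - L) * (\<phi> - z * f) \<le> (J - L) * (\<phi> - z * f)"
      using J \<phi>f by (intro mult_right_mono) auto
    moreover have "0 \<le> (4 * pi\<^sup>2 / L - L) * (\<phi> * m - z * f)"
      using False \<phi>mf pos by (intro mult_nonneg_nonneg) (auto simp: field_simps power2_eq_square)
    moreover have "(4 * pi\<^sup>2 / L - L) * (\<phi> * m - z * f)
        = (4 * pi\<^sup>2 / L - L) * (\<phi> - z * f) - 4 * pi\<^sup>2 * (\<phi> * (1 - m)) / L + L * \<phi> * (1 - m)"
      by (simp add: algebra_simps flip: add_divide_distrib)
    moreover have "- \<eta> \<le> - \<eta> + \<eta> * m" using A pos cA by (simp add: m_def sin_ge_zero)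
    ultimately show ?thesis unfolding d using \<open>L * A / (pi * b) = L * \<phi>\<close> by (simp add: algebra_simps)
  qed
  ultimately show ?thesis using W unfolding \<phi>_def[symmetric] m_def[symmetric]
    by (simp add: right_diff_distrib mult_ac)
qed

section \<open>The chord-arc profile and its touching pairs\<close>

text \<open>For \<open>b = a / pi\<close> this is \<open>L\<close> times the right side of the
  initial inequality. As a function of all real \<open>r\<close> it is odd and has period
  \<open>2 * L\<close>. It is negative for the reversed orientation, where a bound from below on the
  chord is trivial, so all pairs of parameters on the line can be compared without selecting an
  arc.\<close>

definition profile :: "real \<Rightarrow> real \<Rightarrow> real \<Rightarrow> real" where
  "profile b L r = L / (pi * b) * arctan (b * sin (pi * r / L))"

definition profile_slope :: "real \<Rightarrow> real \<Rightarrow> real \<Rightarrow> real" where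
  "profile_slope b L r = cos (pi * r / L) / (1 + b\<^sup>2 * (sin (pi * r / L))\<^sup>2)"

lemma profile_deriv:
  assumes "0 < L" "0 < b"
  shows "(profile b L has_real_derivative profile_slope b L r) (at r)"
proof -
  have "((\<lambda>r. b * sin (pi * r / L)) has_real_derivative b * (cos (pi * r / L) * (pi / L))) (at r)"
    using assms by (auto intro!: derivative_eq_intros)
  from DERIV_cmult[OF DERIV_chain2[OF DERIV_arctan this], of "L / (pi * b)"]
  have "(profile b L has_real_derivative L / (pi * b) *
      (inverse (1 + (b * sin (pi * r / L))\<^sup>2) * (b * (cos (pi * r / L) * (pi / L))))) (at r)"
    unfolding profile_def .
  moreover have "L / (pi * b) * (inverse (1 + (b * sin (pi * r / L))\<^sup>2) * (b * (cos (pi * r / L) * (pi / L))))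
      = L / (pi * b) * (b * (pi / L)) * profile_slope b L r"
    by (simp add: profile_slope_def power_mult_distrib inverse_eq_divide)
  moreover have "L / (pi * b) * (b * (pi / L)) = 1" using assms by simp
  ultimately show ?thesis by simp
qed

lemma profile_slope_deriv:
  fixes b L r :: real
  assumes "0 < L"
  defines "q \<equiv> 1 + b\<^sup>2 * (sin (pi * r / L))\<^sup>2"
  shows "(profile_slope b L has_real_derivative
    - (pi * sin (pi * r / L) * (q + 2 * b\<^sup>2 * (cos (pi * r / L))\<^sup>2) / (L * q\<^sup>2))) (at r)"
proof -
  have q: "0 < q" by (auto simp: q_def intro!: add_pos_nonneg)
  define s where "s = sin (pi * r / L)"
  define c where "c = cos (pi * r / L)"
  have S: "((\<lambda>r. sin (pi * r / L)) has_real_derivative c * (pi / L)) (at r)"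
    and C: "((\<lambda>r. cos (pi * r / L)) has_real_derivative - s * (pi / L)) (at r)"
    unfolding s_def c_def by (use assms(1) in \<open>auto intro!: derivative_eq_intros\<close>)
  have Q: "((\<lambda>r. 1 + b\<^sup>2 * (sin (pi * r / L))\<^sup>2) has_real_derivative 2 * b\<^sup>2 * s * (c * (pi / L))) (at r)"
    by (rule derivative_eq_intros S refl)+ (simp add: s_def)
  have "(profile_slope b L has_real_derivative
      ((- s * (pi / L)) * q - c * (2 * b\<^sup>2 * s * (c * (pi / L)))) / (q * q)) (at r)"
    using DERIV_divide[OF C Q] q unfolding profile_slope_def q_def c_def by simp
  moreover have "((- s * (pi / L)) * q - c * (2 * b\<^sup>2 * s * (c * (pi / L)))) / (q * q)
      = - (pi * s * (q + 2 * b\<^sup>2 * c\<^sup>2) / (L * q\<^sup>2))"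
    using q assms(1) by (simp add: field_simps power2_eq_square)
  ultimately show ?thesis by (simp add: s_def c_def)
qed

context spherical_loop
begin

text \<open>The right side is what the flow, with the prescribed decay of \<open>b\<close>, yields
  for the time derivative of chord minus profile. It is expressed through a single curve, so that
  the geometry at a touching pair is separated from the evolution.\<close>

theorem minimal_pair_inequality:
  fixes b \<eta> s1 s2 :: real
  defines "D \<equiv> c s2 - c s1"
  defines "z \<equiv> (s2 - s1) / L" and "\<phi> \<equiv> profile b L (s2 - s1) / L"
    and "f \<equiv> profile_slope b L (s2 - s1)"
  defines "S \<equiv> sin (pi * z)"
  assumes b: "0 < b" and \<eta>: "0 \<le> \<eta>" and z: "0 < z" "z \<le> 1 / 2"
    and min: "\<And>p q. profile b L (q - p) - \<eta> \<le> norm (c q - c p)"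
    and eq: "norm D = profile b L (s2 - s1) - \<eta>" and D: "0 < norm D"
  shows "- \<eta> \<le> norm D + (D \<bullet> (k s2 - k s1)) / norm D
      - (L - integral {0..L} (\<lambda>s. (norm (k s))\<^sup>2)) * (\<phi> - z * f)
      - f * (z * L - integral {s1..s2} (\<lambda>s. (norm (k s))\<^sup>2))
      - (4 * pi\<^sup>2 * \<phi> - 4 * pi * S / (1 + b\<^sup>2 * S\<^sup>2)) / L"
proof -
  define C A B where "C = cos (pi * z)" and "A = arctan (b * S)" and "B = arctan b"
  define d where "d = norm D"
  define p where "p = T s1 \<bullet> T s2"
  define J where "J = integral {0..L} (\<lambda>s. (norm (k s))\<^sup>2)"
  define j where "j = integral {s1..s2} (\<lambda>s. (norm (k s))\<^sup>2)"
  define W where "W = (D \<bullet> (k s2 - k s1)) / d"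
  define q where "q = 1 + b\<^sup>2 * S\<^sup>2"
  define r where "r = - (pi * S * (q + 2 * b\<^sup>2 * C\<^sup>2) / (L * q\<^sup>2))"
  have zL: "s2 - s1 = z * L" and s12: "s1 \<le> s2" and piz: "pi * (s2 - s1) / L = pi * z"
    using L_pos z by (auto simp: z_def zero_less_divide_iff)
  have \<phi>: "\<phi> = A / (pi * b)" and f: "f = C / q"
    using L_pos by (simp_all add: \<phi>_def profile_def f_def profile_slope_def piz A_def C_def S_def q_def)
  have d0: "0 < d" and dA: "d = L * A / (pi * b) - \<eta>"
    using D eq by (simp_all add: d_def profile_def piz A_def S_def)
  note var = chord_variations[OF profile_deriv[OF L_pos b] _ min eq[unfolded D_def] d_def[unfolded D_def] d0 f_def[THEN meta_eq_to_obj_eq],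
      of r, unfolded D_def[symmetric] p_def[symmetric]]
  have r: "(profile_slope b L has_real_derivative r) (at (s2 - s1))"
    using profile_slope_deriv[OF L_pos, of b "s2 - s1"] by (simp add: piz r_def S_def C_def q_def)
  have DT: "D \<bullet> T s1 = norm D * f" "D \<bullet> T s2 = norm D * f"
    using var(1)[OF r, of 0 1] var(1)[OF r, of 1 0] by (simp_all add: d_def)
  have plus: "0 \<le> 2 - 2 * p + D \<bullet> (k s2 - k s1)"
    using var(2)[OF r, of 1 1] by simp
  have minus: "0 \<le> 2 + 2 * p + D \<bullet> (k s2 - k s1) - 4 * (f\<^sup>2 + d * r)"
    using var(2)[OF r, of 1 "-1"] by simp
  define h where "h = 1 - d\<^sup>2 / 4"
  note cases = tangents_at_equal_chord_slope[of "c s1" "c s2" "T s1" "T s2" d f h,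
      OF norm_c norm_c norm_T norm_T c_T c_T d_def[unfolded D_def] d0 _ _ h_def,
      folded D_def p_def d_def, OF DT[folded d_def]]
  have J: "4 * pi\<^sup>2 / L \<le> J" "L \<le> J"
    unfolding J_def using integral_square_ge length_le_integral_square[of 0 L] L_pos by auto
  have j: "z * L \<le> j" "(arccos p)\<^sup>2 \<le> z * L * j"
    using length_le_integral_square[OF s12] turning_square_le[OF s12]
    by (simp_all add: j_def p_def zL)
  \<comment> \<open>For antipodal points \<open>h = 0\<close> and the algebraic alternative is void.
    There the variation with equal velocities forces \<open>p = - 1\<close>, which is the circle
    configuration with \<open>f = 0\<close>.\<close>
  consider (circle) "p = 2 * f\<^sup>2 - 1" | (parallel) "0 < h" "h * (1 - p) = f\<^sup>2 * d\<^sup>2 / 2"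
  proof (cases "h = 0")
    case True
    then have "f = 0" "d\<^sup>2 = 4" using cases(1) by (auto simp: h_def)
    then have "D \<bullet> D = 4" by (simp add: d_def power2_norm_eq_inner)
    then have "c s1 \<bullet> c s2 = - 1"
      using c_c by (simp add: D_def inner_diff inner_commute)
    then have "(c s1 + c s2) \<bullet> (c s1 + c s2) = 0" using c_c by (simp add: inner_add inner_commute)
    then have "c s2 = - c s1" by (simp add: eq_neg_iff_add_eq_0 add.commute)
    then have "D = 2 *\<^sub>R c s2" "D = - (2 *\<^sub>R c s1)" by (simp_all add: D_def scaleR_2)
    then have "D \<bullet> k s2 = - 2" "D \<bullet> k s1 = 2" using c_k by (metis inner_scaleR_left inner_minus_left mult_minus1_right mult_minus_right minus_minus)+
    then have "p \<le> - 1" using plus by (simp add: inner_diff_right)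
    moreover have "- 1 \<le> p" using T_T_bound[of s1 s2] by (simp add: p_def)
    ultimately show ?thesis using circle \<open>f = 0\<close> by simp
  next
    case False
    moreover have "0 \<le> h" using cases(1) zero_le_power2[of f] by linarith
    ultimately have "0 < h" by simp
    then show ?thesis using cases(2) circle parallel by auto
  qed
  then have "- \<eta> \<le> d + W - (L - J) * (A / (pi * b) - z * f) - f * (z * L - j)
    - (4 * pi * A / b - 4 * pi * S / q) / L"
  proof cases
    case circle
    have C: "0 \<le> C" unfolding C_def using z pi_gt_zero by (intro cos_ge_zero) (auto intro: order_trans[of _ 0])
    have "0 \<le> f" "f \<le> 1"
    proof -
      have "C \<le> q" using cos_le_one[of "pi * z"] unfolding C_def q_def by (smt (verit) mult_nonneg_nonneg zero_le_power2)
      then show "0 \<le> f" "f \<le> 1" using C by (auto simp: f q_def add_pos_nonneg)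
    qed
    then have "arccos p = 2 * arccos f"
    proof -
      have "cos (2 * arccos f) = p"
        using \<open>0 \<le> f\<close> \<open>f \<le> 1\<close> by (simp add: cos_double_cos circle)
      moreover have "0 \<le> 2 * arccos f" "2 * arccos f \<le> pi"
        using \<open>0 \<le> f\<close> \<open>f \<le> 1\<close> arccos_lbound[of f] arccos_le_arccos[of 0 f] by auto
      ultimately show ?thesis using arccos_cos by metis
    qed
    then have "(2 * arccos (C / q))\<^sup>2 \<le> z * L * j" using j(2) f by simp
    moreover have "- (4 * pi * S * (q + 2 * b\<^sup>2 * C\<^sup>2) / (L * q\<^sup>2)) \<le> W"
    proof -
      have "4 * (d * r) \<le> D \<bullet> (k s2 - k s1)" using minus circle by simp
      then have "4 * r \<le> W" using d0 by (simp add: W_def field_simps)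
      then show ?thesis by (simp add: r_def)
    qed
    ultimately show ?thesis
      unfolding f using circle_case_inequality[of L b z d \<eta> J j W] L_pos b z dA J
      by (simp only: S_def C_def q_def A_def)
  next
    case parallel
    \<comment> \<open>The profile at \<open>L / 2\<close> exceeds the chord 2 by at most \<eta>, and
      the profiles at \<open>s2 - s1\<close> and at \<open>L / 2\<close> have ratio
      \<open>A / B\<close>. Hence \<open>d / 2 \<le> A / B\<close>; the perturbation does no harm
      because \<open>A \<le> B\<close>.\<close>
    have "1 - A\<^sup>2 / B\<^sup>2 \<le> h"
    proof -
      have AB: "0 < B" "A \<le> B"
        using b z by (auto simp: A_def B_def S_def arctan_le_iff)
      have "profile b L (L / 2) - \<eta> \<le> 2"
        using min[of "L / 2" 0] norm_triangle_ineq4[of "c (L / 2)" "c 0"] norm_c by (smt (verit) diff_zero)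
      then have LB: "L * B / (pi * b) \<le> 2 + \<eta>" using L_pos by (simp add: profile_def B_def)
      have "d * B = L * B / (pi * b) * A - \<eta> * B"
        unfolding dA left_diff_distrib by (simp add: mult_ac)
      also have "\<dots> \<le> (2 + \<eta>) * A - \<eta> * B"
      proof -
        have "0 < A" using z b by (simp add: A_def S_def sin_gt_zero)
        then show ?thesis using mult_right_mono[OF LB, of A] by linarith
      qed
      also have "\<dots> \<le> 2 * A" using AB \<eta> mult_left_mono[of A B \<eta>] by (simp add: algebra_simps)
      finally have "d / 2 \<le> A / B" using AB by (simp add: field_simps)
      then have "(d / 2)\<^sup>2 \<le> (A / B)\<^sup>2" using d0 by (intro power_mono) auto
      then show ?thesis by (simp add: h_def power_divide)
    qed
    then have fh: "f\<^sup>2 \<le> h * (sin A * cos A / A)"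
      unfolding f q_def using parallel_case_slope_bound[of b z h] b z
      by (simp only: S_def C_def A_def B_def)
    have "- (d * (sin A * cos A / A)) \<le> W"
    proof -
      have "f\<^sup>2 / h \<le> sin A * cos A / A" using fh parallel(1) by (simp add: divide_le_eq mult.commute)
      then have "d * (f\<^sup>2 / h) \<le> d * (sin A * cos A / A)" using d0 by (intro mult_left_mono) auto
      moreover have "2 - 2 * p = d * (d * (f\<^sup>2 / h))"
        using parallel by (simp add: field_simps power2_eq_square)
      then have "- (d * (f\<^sup>2 / h)) \<le> W"
        using plus d0 by (simp add: W_def field_simps)
      ultimately show ?thesis by linarith
    qed
    then show ?thesis
      unfolding f using parallel_case_inequality[of L b \<eta> z d J j W] L_pos b \<eta> z dA J j
      by (simp only: S_def C_def q_def A_def)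
  qed
  moreover have "4 * pi * A / b = 4 * pi\<^sup>2 * \<phi>" by (simp add: \<phi> power2_eq_square)
  ultimately show "- \<eta> \<le> norm D + (D \<bullet> (k s2 - k s1)) / norm D
      - (L - integral {0..L} (\<lambda>s. (norm (k s))\<^sup>2)) * (\<phi> - z * f)
      - f * (z * L - integral {s1..s2} (\<lambda>s. (norm (k s))\<^sup>2))
      - (4 * pi\<^sup>2 * \<phi> - 4 * pi * S / (1 + b\<^sup>2 * S\<^sup>2)) / L"
    by (simp only: \<phi> q_def d_def W_def J_def j_def)
qed

end

section \<open>From chord-arc to curvature\<close>

text \<open>The origin of the factor \<open>1 + 2 * b\<^sup>2\<close>: the sine contributes
  \<open>b / 6\<close> and the arctangent \<open>b ^ 3 / 3\<close>, together
  \<open>b * (1 + 2 * b\<^sup>2) / 6\<close>.\<close>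

lemma arctan_sin_expansion:
  fixes b :: real
  assumes "0 < b"
  shows "((\<lambda>x. (arctan (b * sin x) - b * x) / x ^ 3) \<longlongrightarrow> - (b * (b * b) / 3) - b / 6) (at_right 0)"
  using assms by real_asymp

context spherical_loop
begin

lemma inner_deriv:
  "((\<lambda>s. c s \<bullet> m) has_real_derivative T s \<bullet> m) (at s)"
  "((\<lambda>s. T s \<bullet> m) has_real_derivative k s \<bullet> m) (at s)"
  unfolding has_real_derivative_iff_has_vector_derivative
  by (rule bounded_linear.has_vector_derivative[OF bounded_linear_inner_left c_deriv]
      bounded_linear.has_vector_derivative[OF bounded_linear_inner_left T_deriv])+

text \<open>Integration by parts: \<open>(c (p + s) - c p) \<bullet> k (p + s)\<close> is minus the integral of \<open>r (k (p + r) \<bullet> k (p + s))\<close>.\<close>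

lemma chord_inner_curvature_le:
  assumes "0 \<le> s" and *: "\<And>r. 0 \<le> r \<Longrightarrow> r \<le> s \<Longrightarrow> \<kappa> \<le> k (p + r) \<bullet> k (p + s)"
  shows "(c (p + s) - c p) \<bullet> k (p + s) \<le> - \<kappa> * s\<^sup>2 / 2"
proof -
  define m where "m = k (p + s)"
  define h where "h r = r * (T (p + r) \<bullet> m) - c (p + r) \<bullet> m - \<kappa> * r\<^sup>2 / 2" for r
  have shift: "((+) p has_real_derivative 1) (at r)" for r
    by (auto intro!: derivative_eq_intros)
  have "h 0 \<le> h s"
  proof (rule DERIV_nonneg_imp_nondecreasing[OF assms(1)])
    fix r assume r: "0 \<le> r" "r \<le> s"
    have "(h has_real_derivative r * (k (p + r) \<bullet> m) - \<kappa> * r) (at r)"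
      unfolding h_def
      by (auto intro!: derivative_eq_intros DERIV_chain2[OF inner_deriv(1) shift]
          DERIV_chain2[OF inner_deriv(2) shift])
    moreover have "0 \<le> r * (k (p + r) \<bullet> m) - \<kappa> * r"
      using mult_left_mono[OF *[OF r] r(1)] by (simp add: m_def mult.commute)
    ultimately show "\<exists>y. (h has_real_derivative y) (at r) \<and> 0 \<le> y" by blast
  qed
  then show ?thesis
    using T_k by (simp add: h_def m_def inner_diff_left)
qed

text \<open>Since \<open>k\<close> is merely continuous, a fourth order Taylor expansion is replaced
  by an inequality: near \<open>p\<close> all products \<open>k u \<bullet> k v\<close> exceed
  \<kappa>, which bounds the second derivative \<open>P2\<close> of the squared chord, and this
  bound is integrated twice.\<close>

lemma chord_square_le:
  assumes "\<kappa> < (norm (k p))\<^sup>2"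
  obtains r where "0 < r" "\<And>s. 0 \<le> s \<Longrightarrow> s < r \<Longrightarrow> (norm (c (p + s) - c p))\<^sup>2 \<le> s\<^sup>2 - \<kappa> * s ^ 4 / 12"
proof -
  have "continuous_on UNIV (\<lambda>(u, v). k u \<bullet> k v)"
    unfolding case_prod_beta
    by (intro continuous_intros continuous_on_compose2[OF k_cont]) auto
  then have "isCont (\<lambda>(u, v). k u \<bullet> k v) (p, p)" by (simp add: continuous_on_eq_continuous_at)
  then have "\<forall>\<^sub>F x in nhds (p, p). \<kappa> < (case x of (u, v) \<Rightarrow> k u \<bullet> k v)"
    using assms unfolding isCont_def tendsto_at_iff_tendsto_nhds
    by (intro order_tendstoD(1)[of _ "k p \<bullet> k p"]) (auto simp: power2_norm_eq_inner)
  then obtain e where e: "0 < e" "\<And>x. dist x (p, p) < e \<Longrightarrow> \<kappa> < (case x of (u, v) \<Rightarrow> k u \<bullet> k v)"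
    by (auto simp: eventually_nhds_metric)
  have k: "\<kappa> \<le> k (p + u) \<bullet> k (p + v)" if "0 \<le> u" "u < e / 2" "0 \<le> v" "v < e / 2" for u v
  proof -
    have "dist (p + u, p + v) (p, p) \<le> dist (p + u) p + dist (p + v) p"
      unfolding dist_prod_def by (simp add: sqrt_sum_squares_le_sum)
    also have "\<dots> < e" using that by (simp add: dist_real_def)
    finally show ?thesis using e(2)[of "(p + u, p + v)"] by simp
  qed
  define P where "P s = (c (p + s) - c p) \<bullet> (c (p + s) - c p)" for s
  define P1 where "P1 s = 2 * ((c (p + s) - c p) \<bullet> T (p + s))" for s
  define P2 where "P2 s = 2 + 2 * ((c (p + s) - c p) \<bullet> k (p + s))" for s
  have c': "((\<lambda>s. c (p + s) - c p) has_vector_derivative T (p + s)) (at s)"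
    and T': "((\<lambda>s. T (p + s)) has_vector_derivative k (p + s)) (at s)" for s
  proof -
    have sh: "((\<lambda>s. p + s) has_vector_derivative 1) (at s)"
      by (auto intro!: derivative_eq_intros simp flip: has_real_derivative_iff_has_vector_derivative)
    show "((\<lambda>s. c (p + s) - c p) has_vector_derivative T (p + s)) (at s)"
      using vector_diff_chain_at[OF sh c_deriv] by (simp add: o_def has_vector_derivative_diff_const)
    show "((\<lambda>s. T (p + s)) has_vector_derivative k (p + s)) (at s)"
      using vector_diff_chain_at[OF sh T_deriv] by (simp add: o_def)
  qed
  have P: "(P has_real_derivative P1 s) (at s)" for s
    unfolding P_def P1_def using has_real_derivative_inner[OF c' c', of s] by (simp add: inner_commute)
  have P1: "(P1 has_real_derivative P2 s) (at s)" for s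
    unfolding P1_def P2_def using DERIV_cmult[OF has_real_derivative_inner[OF c' T', of s], of 2] T_T by (simp add: add.commute)
  have P2: "P2 s \<le> 2 - \<kappa> * s\<^sup>2" if "0 \<le> s" "s < e / 2" for s
    using chord_inner_curvature_le[of s \<kappa> p] k that by (simp add: P2_def)
  have P1_le: "P1 s \<le> 2 * s - \<kappa> * s ^ 3 / 3" if "0 \<le> s" "s < e / 2" for s
  proof -
    have "2 * 0 - \<kappa> * 0 ^ 3 / 3 - P1 0 \<le> 2 * s - \<kappa> * s ^ 3 / 3 - P1 s"
    proof (rule DERIV_nonneg_imp_nondecreasing[OF that(1), where f = "\<lambda>s. 2 * s - \<kappa> * s ^ 3 / 3 - P1 s"])
      fix u assume u: "0 \<le> u" "u \<le> s"
      show "\<exists>y. ((\<lambda>s. 2 * s - \<kappa> * s ^ 3 / 3 - P1 s) has_real_derivative y) (at u) \<and> 0 \<le> y"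
        using P2[of u] u that
        by (intro exI[of _ "2 - \<kappa> * u\<^sup>2 - P2 u"] conjI) (auto intro!: derivative_eq_intros P1)
    qed
    then show ?thesis by (simp add: P1_def)
  qed
  have "P s \<le> s\<^sup>2 - \<kappa> * s ^ 4 / 12" if "0 \<le> s" "s < e / 2" for s
  proof -
    have "0\<^sup>2 - \<kappa> * 0 ^ 4 / 12 - P 0 \<le> s\<^sup>2 - \<kappa> * s ^ 4 / 12 - P s"
    proof (rule DERIV_nonneg_imp_nondecreasing[OF that(1), where f = "\<lambda>s. s\<^sup>2 - \<kappa> * s ^ 4 / 12 - P s"])
      fix u assume u: "0 \<le> u" "u \<le> s"
      show "\<exists>y. ((\<lambda>s. s\<^sup>2 - \<kappa> * s ^ 4 / 12 - P s) has_real_derivative y) (at u) \<and> 0 \<le> y"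
        using P1_le[of u] u that
        by (intro exI[of _ "2 * u - \<kappa> * u ^ 3 / 3 - P1 u"] conjI) (auto intro!: derivative_eq_intros P)
    qed
    then show ?thesis by (simp add: P_def)
  qed
  then show ?thesis using that[of "e / 2"] e(1) by (simp add: P_def power2_norm_eq_inner)
qed

text \<open>For small \<open>s\<close> the chord is at most
  \<open>s * (1 - \<kappa> * s\<^sup>2 / 24)\<close>, while the profile is
  \<open>s * (1 + x\<^sup>2 * \<rho> x / b)\<close> with \<open>x = pi * s / L\<close>. Comparing
  the cubic terms as \<open>x\<close> tends to 0 bounds every \<kappa> below the squared
  curvature.\<close>

theorem curvature_bound:
  assumes b: "0 < b" and chord: "\<And>p q. profile b L (q - p) \<le> norm (c q - c p)"
  shows "(norm (k p))\<^sup>2 \<le> (2 * pi / L)\<^sup>2 * (1 + 2 * b\<^sup>2)"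
proof (rule dense_le)
  fix \<kappa> assume "\<kappa> < (norm (k p))\<^sup>2"
  then obtain r where r: "0 < r"
    "\<And>s. 0 \<le> s \<Longrightarrow> s < r \<Longrightarrow> (norm (c (p + s) - c p))\<^sup>2 \<le> s\<^sup>2 - \<kappa> * s ^ 4 / 12"
    using chord_square_le by blast
  define \<rho> where "\<rho> x = (arctan (b * sin x) - b * x) / x ^ 3" for x
  have "- (b * (b * b) / 3) - b / 6 \<le> - (b * \<kappa> * L\<^sup>2 / (24 * pi\<^sup>2))"
  proof (rule tendsto_upperbound)
    show "(\<rho> \<longlongrightarrow> - (b * (b * b) / 3) - b / 6) (at_right 0)"
      unfolding \<rho>_def by (rule arctan_sin_expansion[OF b])
    have "\<rho> x \<le> - (b * \<kappa> * L\<^sup>2 / (24 * pi\<^sup>2))" if x: "0 < x" "x < pi * r / L" for x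
    proof -
      define s where "s = L * x / pi"
      have s: "0 < s" "s < r" using x L_pos by (auto simp: s_def field_simps)
      have prof: "profile b L s = s * (1 + x\<^sup>2 * \<rho> x / b)"
      proof -
        have "arctan (b * sin x) = b * x * (1 + x\<^sup>2 * \<rho> x / b)"
          using x b by (simp add: \<rho>_def field_simps eval_nat_numeral)
        moreover have "pi * s / L = x" using L_pos by (simp add: s_def)
        ultimately show ?thesis using b by (simp add: profile_def s_def)
      qed
      have "profile b L s \<le> s * (1 - \<kappa> * s\<^sup>2 / 24)"
      proof (cases "0 \<le> profile b L s")
        case True
        have "(profile b L s)\<^sup>2 \<le> (norm (c (p + s) - c p))\<^sup>2"
          using chord[of "p + s" p] True by (intro power_mono) auto
        also have "\<dots> \<le> s\<^sup>2 * (1 - \<kappa> * s\<^sup>2 / 12)"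
          using r(2)[of s] s by (simp add: algebra_simps power2_eq_square eval_nat_numeral)
        finally have le: "(profile b L s)\<^sup>2 \<le> s\<^sup>2 * (1 - \<kappa> * s\<^sup>2 / 12)" .
        then have "0 \<le> s\<^sup>2 * (1 - \<kappa> * s\<^sup>2 / 12)" using zero_le_power2 order_trans by blast
        then have "0 \<le> 1 - \<kappa> * s\<^sup>2 / 12" using s by (simp add: zero_le_mult_iff)
        then have "0 \<le> s * (1 - \<kappa> * s\<^sup>2 / 24)" using s by simp
        \<comment> \<open>Completing the square replaces an expansion of the square root.\<close>
        moreover have "(s * (1 - \<kappa> * s\<^sup>2 / 24))\<^sup>2 = s\<^sup>2 * (1 - \<kappa> * s\<^sup>2 / 12) + (s * (\<kappa> * s\<^sup>2 / 24))\<^sup>2"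
          by (simp add: algebra_simps power2_eq_square)
        then have "(profile b L s)\<^sup>2 \<le> (s * (1 - \<kappa> * s\<^sup>2 / 24))\<^sup>2"
          using le zero_le_power2[of "s * (\<kappa> * s\<^sup>2 / 24)"] by linarith
        ultimately show ?thesis by (rule power2_le_imp_le[rotated])
      next
        case False
        have "0 \<le> (norm (c (p + s) - c p))\<^sup>2" by simp
        also have "\<dots> \<le> s\<^sup>2 * (1 - \<kappa> * s\<^sup>2 / 12)"
          using r(2)[of s] s by (simp add: algebra_simps power2_eq_square eval_nat_numeral)
        finally have "0 \<le> 1 - \<kappa> * s\<^sup>2 / 12" using s by (simp add: zero_le_mult_iff)
        then have "0 \<le> s * (1 - \<kappa> * s\<^sup>2 / 24)" using s by simp
        then show ?thesis using False by linarith
      qed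
      then have "1 + x\<^sup>2 * \<rho> x / b \<le> 1 - \<kappa> * s\<^sup>2 / 24"
        unfolding prof using s by (simp only: mult_le_cancel_left_pos)
      then have "x\<^sup>2 * \<rho> x / b \<le> - (\<kappa> * s\<^sup>2 / 24)" by simp
      moreover have "\<kappa> * s\<^sup>2 / 24 = x\<^sup>2 * (b * \<kappa> * L\<^sup>2 / (24 * pi\<^sup>2)) / b"
        using b by (simp add: s_def power_mult_distrib power_divide mult_ac)
      ultimately have "x\<^sup>2 / b * \<rho> x \<le> x\<^sup>2 / b * - (b * \<kappa> * L\<^sup>2 / (24 * pi\<^sup>2))"
        using b by simp
      then show ?thesis using x b by (subst (asm) mult_le_cancel_left_pos) auto
    qed
    then show "\<forall>\<^sub>F x in at_right 0. \<rho> x \<le> - (b * \<kappa> * L\<^sup>2 / (24 * pi\<^sup>2))"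
      unfolding eventually_at_right_field using r(1) L_pos by (intro exI[of _ "pi * r / L"]) auto
  qed simp
  then have "b * \<kappa> * L\<^sup>2 / (24 * pi\<^sup>2) \<le> b * (1 + 2 * b\<^sup>2) / 6"
    by (simp add: algebra_simps power2_eq_square)
  then have "b * (\<kappa> * L\<^sup>2 / (24 * pi\<^sup>2)) \<le> b * ((1 + 2 * b\<^sup>2) / 6)" by simp
  then have "\<kappa> * L\<^sup>2 / (24 * pi\<^sup>2) \<le> (1 + 2 * b\<^sup>2) / 6" using b by (simp only: mult_le_cancel_left_pos)
  then show "\<kappa> \<le> (2 * pi / L)\<^sup>2 * (1 + 2 * b\<^sup>2)"
    using L_pos by (simp add: field_simps power_divide power_mult_distrib)
qed

text \<open>Along so short an arc the tangent stays within a right angle of \<open>T p\<close>, so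
  the chord has a positive component along \<open>T p\<close>. The constant 1 is just a convenient
  value below \<open>pi / 2\<close>.\<close>

lemma not_closed_if_short:
  assumes M: "\<And>s. norm (k s) \<le> M" and pq: "p < q" and short: "M * (q - p) < 1"
  shows "c q \<noteq> c p"
proof
  assume eq: "c q = c p"
  have "integral {p..q} (\<lambda>r. 0) < integral {p..q} (\<lambda>r. T r \<bullet> T p)"
  proof (intro integral_less_real continuous_intros T_cont)
    fix r assume r: "r \<in> {p<..<q}"
    have "arccos (T p \<bullet> T r) \<le> integral {p..r} (\<lambda>s. norm (k s))"
      using r by (intro arccos_le_integral) auto
    also have "\<dots> \<le> integral {p..r} (\<lambda>s. M)"
      using M by (intro integral_le integrable_k) auto
    also have "\<dots> = M * (r - p)" using r by simp
    also have "\<dots> \<le> M * (q - p)"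
      using r order_trans[OF norm_ge_zero M] by (intro mult_left_mono) auto
    also have "\<dots> < arccos 0" using short pi_gt3 by simp
    finally show "0 < T r \<bullet> T p"
      using T_T_bound[of p r] by (subst (asm) arccos_less_mono) (auto simp: inner_commute)
  qed (use pq in auto)
  moreover have "integral {p..q} (\<lambda>r. T r \<bullet> T p) = 0"
    using has_integral_inner_T[of p q "T p"] pq eq by (simp add: integral_unique)
  ultimately show False by simp
qed

end

text \<open>The curvature vector in \<real>^3 of a curve with velocity \<open>v\<close> and
  acceleration \<open>w\<close> in an arbitrary parameter: the part of \<open>w\<close> orthogonal
  to \<open>v\<close>, divided by the squared speed.\<close>

definition curvature_of :: "real^3 \<Rightarrow> real^3 \<Rightarrow> real^3" where
  "curvature_of v w = (1 / (norm v)\<^sup>2) *\<^sub>R w - ((v \<bullet> w) / norm v ^ 4) *\<^sub>R v"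

lemma normalized_deriv:
  fixes g :: "real \<Rightarrow> real^3"
  assumes "(g has_vector_derivative g') (at x)" "g x \<noteq> 0"
  shows "((\<lambda>x. (1 / norm (g x)) *\<^sub>R g x) has_vector_derivative norm (g x) *\<^sub>R curvature_of (g x) g') (at x)"
proof -
  have "((\<lambda>x. norm (g x)) has_real_derivative (g x \<bullet> g') / norm (g x)) (at x)"
    by (rule has_real_derivative_norm[OF assms])
  then have "((\<lambda>x. 1 / norm (g x)) has_real_derivative - ((g x \<bullet> g') / norm (g x)) / (norm (g x))\<^sup>2) (at x)"
    using assms(2) by (auto intro!: derivative_eq_intros simp: power2_eq_square)
  note deriv = has_vector_derivative_scaleR[OF this assms(1)]
  have "norm (g x) * (1 / (norm (g x))\<^sup>2) = 1 / norm (g x)"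
    "norm (g x) * ((g x \<bullet> g') / norm (g x) ^ 4) = (g x \<bullet> g') / norm (g x) / (norm (g x))\<^sup>2"
    using assms(2) by (simp_all add: field_simps eval_nat_numeral)
  then have "norm (g x) *\<^sub>R curvature_of (g x) g'
      = (1 / norm (g x)) *\<^sub>R g' + (- ((g x \<bullet> g') / norm (g x)) / (norm (g x))\<^sup>2) *\<^sub>R g x"
    unfolding curvature_of_def scaleR_right_diff_distrib scaleR_scaleR by simp
  with deriv show ?thesis by simp
qed

text \<open>The arclength function \<open>S\<close> is an argument, so that a flow can supply one
  that is jointly continuous in space and time. It is onto because it grows by the same positive
  amount over every period.\<close>

lemma arclength_parametrization:
  fixes g g1 g2 :: "real \<Rightarrow> real^3" and S :: "real \<Rightarrow> real"
  assumes norm_g: "\<And>x. norm (g x) = 1"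
    and g': "\<And>x. (g has_vector_derivative g1 x) (at x)"
    and g1': "\<And>x. (g1 has_vector_derivative g2 x) (at x)"
    and g2: "continuous_on UNIV g2" and g1: "\<And>x. g1 x \<noteq> 0"
    and per: "\<And>x. g (x + 2 * pi) = g x"
    and S0: "S 0 = 0" and S': "\<And>x. (S has_real_derivative norm (g1 x)) (at x)"
  obtains \<sigma> where "\<And>x. \<sigma> (S x) = x" "\<And>s. S (\<sigma> s) = s" "\<And>x. S (x + 2 * pi) = S x + S (2 * pi)"
    "spherical_loop (\<lambda>s. g (\<sigma> s)) (\<lambda>s. (1 / norm (g1 (\<sigma> s))) *\<^sub>R g1 (\<sigma> s))
       (\<lambda>s. curvature_of (g1 (\<sigma> s)) (g2 (\<sigma> s))) (S (2 * pi))"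
proof -
  have shift: "((\<lambda>x. x + 2 * pi) has_real_derivative 1) (at x)" for x :: real
    by (auto intro!: derivative_eq_intros)
  have g1_per: "g1 (x + 2 * pi) = g1 x" for x
    by (rule periodic_vector_derivative[OF g' per])
  have S_per: "S (x + 2 * pi) = S x + S (2 * pi)" for x
  proof -
    have "((\<lambda>x. S (x + 2 * pi) - S x) has_real_derivative 0) (at x)" for x
      using DERIV_diff[OF DERIV_chain2[OF S' shift] S'] by (simp add: g1_per)
    then have "S (x + 2 * pi) - S x = S (0 + 2 * pi) - S 0" using DERIV_isconst_all by blast
    then show ?thesis using S0 by simp
  qed
  have mono: "S x < S y" if "x < y" for x y
    using that S' g1 by (intro DERIV_pos_imp_increasing[OF that]) (metis zero_less_norm_iff)
  define L where "L = S (2 * pi)"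
  have L: "0 < L" using mono[of 0 "2 * pi"] S0 by (simp add: L_def)
  have S_cont: "isCont S x" for x using DERIV_isCont[OF S'] .
  have S_mult: "S (2 * pi * real n) = real n * L" "S (- (2 * pi * real n)) = - (real n * L)" for n
  proof (induction n)
    case (Suc n)
    { case 1 show ?case using S_per[of "2 * pi * real n"] Suc(1) by (simp add: L_def algebra_simps) }
    { case 2 show ?case using S_per[of "- (2 * pi * real (Suc n))"] Suc(2) by (simp add: L_def algebra_simps) }
  qed (simp_all add: S0)
  have surj: "\<exists>x. S x = s" for s
  proof -
    obtain n where n: "\<bar>s\<bar> < real n * L" using reals_Archimedean3[OF L] by blast
    then have "\<exists>x\<ge>- (2 * pi * real n). x \<le> 2 * pi * real n \<and> S x = s"
      using S_mult[of n] S_cont by (intro IVT) auto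
    then show ?thesis by blast
  qed
  define \<sigma> where "\<sigma> = inv S"
  have inj: "inj S" by (rule linorder_injI) (metis mono less_irrefl)
  have \<sigma>S: "\<sigma> (S x) = x" for x using inj by (simp add: \<sigma>_def)
  have S\<sigma>: "S (\<sigma> s) = s" for s using surj[of s] by (auto simp: \<sigma>_def inv_f_f[OF inj])
  have \<sigma>_cont: "isCont \<sigma> s" for s
    using isCont_inverse_function[of 1 "\<sigma> s" \<sigma> S] \<sigma>S S_cont by (simp add: S\<sigma>)
  have \<sigma>': "(\<sigma> has_vector_derivative inverse (norm (g1 (\<sigma> s)))) (at s)" for s
    unfolding has_real_derivative_iff_has_vector_derivative[symmetric]
    by (rule DERIV_inverse_function[where f = S and a = "s - 1" and b = "s + 1"])
       (use S' g1 S\<sigma> \<sigma>_cont in auto)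
  have \<sigma>_per: "\<sigma> (s + L) = \<sigma> s + 2 * pi" for s
    using \<sigma>S[of "\<sigma> s + 2 * pi"] by (simp add: S_per S\<sigma> L_def)
  have "spherical_loop (\<lambda>s. g (\<sigma> s)) (\<lambda>s. (1 / norm (g1 (\<sigma> s))) *\<^sub>R g1 (\<sigma> s))
       (\<lambda>s. curvature_of (g1 (\<sigma> s)) (g2 (\<sigma> s))) L"
  proof
    fix s
    show "0 < L" by (rule L)
    show "norm (g (\<sigma> s)) = 1" by (rule norm_g)
    show "((\<lambda>s. g (\<sigma> s)) has_vector_derivative (1 / norm (g1 (\<sigma> s))) *\<^sub>R g1 (\<sigma> s)) (at s)"
      using vector_diff_chain_at[OF \<sigma>' g'] by (simp add: o_def inverse_eq_divide)
    show "norm ((1 / norm (g1 (\<sigma> s))) *\<^sub>R g1 (\<sigma> s)) = 1" using g1 by simp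
    show "((\<lambda>s. (1 / norm (g1 (\<sigma> s))) *\<^sub>R g1 (\<sigma> s)) has_vector_derivative
        curvature_of (g1 (\<sigma> s)) (g2 (\<sigma> s))) (at s)"
      using vector_diff_chain_at[OF \<sigma>' normalized_deriv[OF g1' g1]] g1 by (simp add: o_def)
    have "continuous_on UNIV g1"
      using has_vector_derivative_continuous[OF g1'] by (simp add: continuous_on_eq_continuous_within)
    then have "continuous_on UNIV (\<lambda>x. curvature_of (g1 x) (g2 x))"
      unfolding curvature_of_def using g2 g1 by (intro continuous_intros) auto
    then show "continuous_on UNIV (\<lambda>s. curvature_of (g1 (\<sigma> s)) (g2 (\<sigma> s)))"
      by (rule continuous_on_compose2) (auto intro: continuous_at_imp_continuous_on \<sigma>_cont)
    show "g (\<sigma> (s + L)) = g (\<sigma> s)" by (simp add: \<sigma>_per per)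
  qed
  from that[OF \<sigma>S S\<sigma> S_per this[unfolded L_def]] show ?thesis .
qed

text \<open>The decay of \<open>b\<close> is responsible for the last quotient: the prefactor
  \<open>L / (pi * b)\<close> yields \<open>4 * pi\<^sup>2 * \<phi>\<close>, the argument of the
  arctangent the negative term.\<close>

lemma profile_time_deriv:
  fixes b L l :: "real \<Rightarrow> real" and t L' l' b' :: real
  defines "z \<equiv> l t / L t" and "\<phi> \<equiv> profile (b t) (L t) (l t) / L t" and "f \<equiv> profile_slope (b t) (L t) (l t)"
  assumes pos: "0 < L t" "0 < b t"
    and L': "(L has_real_derivative L') (at t within X)"
    and l': "(l has_real_derivative l') (at t within X)"
    and b': "(b has_real_derivative - (4 * pi\<^sup>2 * b t / (L t)\<^sup>2)) (at t within X)"
  shows "((\<lambda>t. profile (b t) (L t) (l t)) has_real_derivative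
    L' * (\<phi> - z * f) + f * l' + (4 * pi\<^sup>2 * \<phi> - 4 * pi * sin (pi * z) / (1 + (b t)\<^sup>2 * (sin (pi * z))\<^sup>2)) / L t)
    (at t within X)"
proof -
  define s where "s = sin (pi * z)"
  define c where "c = cos (pi * z)"
  define q where "q = 1 + (b t)\<^sup>2 * s\<^sup>2"
  define A where "A = arctan (b t * s)"
  have q: "0 < q" by (auto simp: q_def intro!: add_pos_nonneg)
  have f: "f = c / q" and \<phi>: "\<phi> = A / (pi * b t)"
    using pos by (simp_all add: f_def profile_slope_def \<phi>_def profile_def c_def s_def q_def A_def z_def)
  have "((\<lambda>t. pi * l t / L t) has_real_derivative pi * (l' - z * L') / L t) (at t within X)"
    using DERIV_divide[OF DERIV_cmult[OF l', of pi] L'] pos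
    by (simp add: z_def field_simps power2_eq_square)
  from DERIV_chain2[OF DERIV_sin this]
  have "((\<lambda>t. sin (pi * l t / L t)) has_real_derivative c * (pi * (l' - z * L') / L t)) (at t within X)"
    by (simp add: c_def z_def)
  from DERIV_chain2[OF DERIV_arctan DERIV_mult[OF b' this]]
  have A': "((\<lambda>t. arctan (b t * sin (pi * l t / L t))) has_real_derivative
      inverse q * (- (4 * pi\<^sup>2 * b t / (L t)\<^sup>2) * s + c * (pi * (l' - z * L') / L t) * b t)) (at t within X)"
    by (simp add: q_def s_def z_def power_mult_distrib)
  have B': "((\<lambda>t. L t / (pi * b t)) has_real_derivative
      (L' + 4 * pi\<^sup>2 / L t) / (pi * b t)) (at t within X)"
  proof -
    have "(L' * (pi * b t) - L t * (pi * - (4 * pi\<^sup>2 * b t / (L t)\<^sup>2))) / (pi * b t * (pi * b t))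
        = (L' + 4 * pi\<^sup>2 / L t) / (pi * b t)"
      using pos by (simp add: field_simps power2_eq_square)
    then show ?thesis using DERIV_divide[OF L' DERIV_cmult[OF b', of pi]] pos by simp
  qed
  have "((\<lambda>t. profile (b t) (L t) (l t)) has_real_derivative
      (L' + 4 * pi\<^sup>2 / L t) / (pi * b t) * A +
      inverse q * (- (4 * pi\<^sup>2 * b t / (L t)\<^sup>2) * s + c * (pi * (l' - z * L') / L t) * b t) * (L t / (pi * b t)))
      (at t within X)"
    using DERIV_mult[OF B' A'] by (simp add: profile_def A_def s_def z_def)
  moreover have "(L' + 4 * pi\<^sup>2 / L t) / (pi * b t) * A = L' * \<phi> + 4 * pi\<^sup>2 * \<phi> / L t"
    by (simp add: \<phi> add_divide_distrib distrib_right)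
  moreover have "inverse q * (- (4 * pi\<^sup>2 * b t / (L t)\<^sup>2) * s + c * (pi * (l' - z * L') / L t) * b t) * (L t / (pi * b t))
      = f * (l' - z * L') - 4 * pi * s / q / L t"
    using pos q by (simp add: f field_simps power2_eq_square)
  moreover have "L' * (\<phi> - z * f) + f * l' + (4 * pi\<^sup>2 * \<phi> - 4 * pi * s / q) / L t
      = L' * \<phi> + 4 * pi\<^sup>2 * \<phi> / L t + (f * (l' - z * L') - 4 * pi * s / q / L t)"
    by (simp add: algebra_simps diff_divide_distrib)
  ultimately show ?thesis
    unfolding s_def[symmetric] q_def[symmetric] by (simp only:)
qed

lemma profile_shift: "0 < L \<Longrightarrow> profile b L (r + 2 * L) = profile b L r"
  using sin_periodic[of "pi * r / L"] by (simp add: profile_def field_simps)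

lemma profile_reflect: "0 < L \<Longrightarrow> profile b L (L - r) = profile b L r"
  by (simp add: profile_def right_diff_distrib diff_divide_distrib)

lemma profile_pos_iff: "0 < L \<Longrightarrow> 0 < b \<Longrightarrow> 0 < profile b L r \<longleftrightarrow> 0 < sin (pi * r / L)"
  unfolding profile_def by (subst zero_less_mult_iff) (auto simp: zero_less_mult_iff divide_less_0_iff mult_less_0_iff)

section \<open>Chord-arc comparison along the flow\<close>

text \<open>\<open>g1\<close> and \<open>g2\<close> are the first two space derivatives,
  \<open>ht\<close> is the time derivative and \<open>h1\<close> the time derivative of
  \<open>g1\<close>; time derivatives are within \<open>I\<close>, hence one-sided at 0. The summand
  \<open>g\<close> in \<open>flow\<close> removes the normal component of the Euclidean curvature
  vector.\<close>

locale spherical_flow =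
  fixes I :: "real set" and g g1 g2 ht h1 :: "real \<Rightarrow> real \<Rightarrow> real^3"
  assumes I0: "0 \<in> I" and I_nonneg: "\<And>t. t \<in> I \<Longrightarrow> 0 \<le> t"
    and I_down: "\<And>s t. t \<in> I \<Longrightarrow> 0 \<le> s \<Longrightarrow> s \<le> t \<Longrightarrow> s \<in> I"
    and norm_g: "\<And>t x. t \<in> I \<Longrightarrow> norm (g t x) = 1"
    and per: "\<And>t x. t \<in> I \<Longrightarrow> g t (x + 2 * pi) = g t x"
    and g1_nz: "\<And>t x. t \<in> I \<Longrightarrow> g1 t x \<noteq> 0"
    and g_x: "\<And>t x. t \<in> I \<Longrightarrow> (g t has_vector_derivative g1 t x) (at x)"
    and g1_x: "\<And>t x. t \<in> I \<Longrightarrow> (g1 t has_vector_derivative g2 t x) (at x)"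
    and g_t: "\<And>t x. t \<in> I \<Longrightarrow> ((\<lambda>t. g t x) has_vector_derivative ht t x) (at t within I)"
    and g1_t: "\<And>t x. t \<in> I \<Longrightarrow> ((\<lambda>t. g1 t x) has_vector_derivative h1 t x) (at t within I)"
    and g_cont: "continuous_on (UNIV \<times> I) (\<lambda>(x, t). g t x)"
    and g1_cont: "continuous_on (UNIV \<times> I) (\<lambda>(x, t). g1 t x)"
    and g2_cont: "continuous_on (UNIV \<times> I) (\<lambda>(x, t). g2 t x)"
    and h1_cont: "continuous_on (UNIV \<times> I) (\<lambda>(x, t). h1 t x)"
    and flow: "\<And>t x. t \<in> I \<Longrightarrow> ht t x = curvature_of (g1 t x) (g2 t x) + g t x"
begin

lemma convex_I: "convex I"
proof -
  have "is_interval I" unfolding is_interval_1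
    using I_down I_nonneg by (meson order_trans)
  then show ?thesis by (rule is_interval_convex)
qed

lemma cont_along:
  fixes f :: "real \<Rightarrow> real \<Rightarrow> 'z::topological_space"
  assumes "continuous_on (UNIV \<times> I) (\<lambda>(x, t). f t x)"
    and "continuous_on X u" "continuous_on X v" "\<And>p. p \<in> X \<Longrightarrow> v p \<in> I"
  shows "continuous_on X (\<lambda>p. f (v p) (u p))"
proof -
  have "continuous_on X (\<lambda>p. case (u p, v p) of (x, t) \<Rightarrow> f t x)"
    by (rule continuous_on_compose2[OF assms(1)]) (use assms in \<open>auto intro!: continuous_intros\<close>)
  then show ?thesis by simp
qed

lemma slice:
  "continuous_on (UNIV \<times> I) (\<lambda>(x, t). f t x) \<Longrightarrow> t \<in> I \<Longrightarrow> continuous_on X (f t)"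
  for f :: "real \<Rightarrow> real \<Rightarrow> 'z::topological_space"
  using cont_along[of f X "\<lambda>x. x" "\<lambda>_. t"] by (simp add: continuous_on_id continuous_on_const)

definition V :: "real \<Rightarrow> real \<Rightarrow> real" where "V t x = norm (g1 t x)"
definition curv :: "real \<Rightarrow> real \<Rightarrow> real^3" where "curv t x = curvature_of (g1 t x) (g2 t x)"

text \<open>The arclength from \<open>0\<close>, written over a fixed interval so that it is defined for \<open>x < 0\<close> as well.\<close>

definition S :: "real \<Rightarrow> real \<Rightarrow> real" where "S t x = integral {0..1} (\<lambda>u. x * V t (x * u))"
definition L :: "real \<Rightarrow> real" where "L t = S t (2 * pi)"

section \<open>Evolution of speed and arclength\<close>

lemma V_cont: "continuous_on (UNIV \<times> I) (\<lambda>(x, t). V t x)"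
  using continuous_on_norm[OF g1_cont] by (simp add: V_def case_prod_beta)

lemma V_pos: "t \<in> I \<Longrightarrow> 0 < V t x"
  by (simp add: V_def g1_nz)

lemma curv_cont: "continuous_on (UNIV \<times> I) (\<lambda>(x, t). curv t x)"
  unfolding curv_def curvature_of_def case_prod_beta
  using g1_cont g2_cont g1_nz by (intro continuous_intros) (auto simp: case_prod_beta)

lemma S_deriv:
  assumes "t \<in> I" shows "(S t has_real_derivative V t x) (at x)"
proof -
  have cont: "continuous_on X (V t)" for X by (rule slice[OF V_cont assms])
  obtain G where G: "\<And>x. (G has_real_derivative V t x) (at x)"
    using einterval_antiderivative[of "-\<infinity>" \<infinity> "V t"] cont[of UNIV]
    by (auto simp: continuous_on_eq_continuous_at has_real_derivative_iff_has_vector_derivative)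
  have "S t x = G x - G 0" for x
  proof -
    have "((\<lambda>u. x * V t (x * u)) has_integral (G (x * 1) - G (x * 0))) {0..1}"
    proof (rule fundamental_theorem_of_calculus)
      fix u :: real
      have "((\<lambda>u. x * u) has_real_derivative x) (at u)" by (auto intro!: derivative_eq_intros)
      from DERIV_chain2[OF G this]
      show "((\<lambda>u. G (x * u)) has_vector_derivative x * V t (x * u)) (at u within {0..1})"
        by (simp add: has_real_derivative_iff_has_vector_derivative mult.commute has_vector_derivative_at_within)
    qed simp
    then show ?thesis unfolding S_def by (simp only: integral_unique) simp
  qed
  then have "S t = (\<lambda>x. G x - G 0)" by auto
  then show ?thesis using G by (auto intro!: derivative_eq_intros)
qed

lemma S_0: "S t 0 = 0" by (simp add: S_def)

lemma S_diff:
  assumes "t \<in> I" "x \<le> y" shows "(V t has_integral S t y - S t x) {x..y}"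
  using assms S_deriv[OF assms(1)]
  by (intro fundamental_theorem_of_calculus)
     (auto simp: has_real_derivative_iff_has_vector_derivative[symmetric] has_field_derivative_at_within)

lemma S_mono:
  assumes "t \<in> I" "u \<le> v" shows "S t u \<le> S t v"
  by (rule DERIV_nonneg_imp_nondecreasing[OF assms(2)])
    (use S_deriv[OF assms(1)] less_imp_le[OF V_pos[OF assms(1)]] in blast)

lemma S_cont: "continuous_on (UNIV \<times> I) (\<lambda>(x, t). S t x)"
proof -
  have "continuous_on ((UNIV \<times> I) \<times> cbox 0 1) (\<lambda>(p, u). fst p * V (snd p) (fst p * u))"
    unfolding case_prod_beta
    by (intro continuous_intros cont_along[OF V_cont]) auto
  then show ?thesis
    using integral_continuous_on_param[of "UNIV \<times> I" 0 1 "\<lambda>p u. fst p * V (snd p) (fst p * u)"]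
    by (simp add: S_def case_prod_beta)
qed

lemma L_cont: "continuous_on I L"
  unfolding L_def by (intro cont_along[OF S_cont] continuous_intros)

lemma loop:
  assumes "t \<in> I"
  obtains \<sigma> where "\<And>x. \<sigma> (S t x) = x" "\<And>s. S t (\<sigma> s) = s" "\<And>x. S t (x + 2 * pi) = S t x + L t"
    "spherical_loop (\<lambda>s. g t (\<sigma> s)) (\<lambda>s. (1 / norm (g1 t (\<sigma> s))) *\<^sub>R g1 t (\<sigma> s)) (\<lambda>s. curv t (\<sigma> s)) (L t)"
  using arclength_parametrization[of "g t" "g1 t" "g2 t" "S t", OF norm_g[OF assms] g_x[OF assms] g1_x[OF assms]
      slice[OF g2_cont assms] g1_nz[OF assms] per[OF assms] S_0 S_deriv[OF assms, unfolded V_def]]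
  unfolding L_def curv_def by blast

lemma L_pos: "t \<in> I \<Longrightarrow> 0 < L t"
  by (rule loop) (auto dest: spherical_loop.L_pos)

lemma S_shift: "t \<in> I \<Longrightarrow> S t (x + 2 * pi) = S t x + L t"
  by (rule loop) auto

lemma within_nontrivial: "t \<in> I \<Longrightarrow> 0 < t \<Longrightarrow> at t within I \<noteq> bot"
proof -
  assume t: "t \<in> I" "0 < t"
  have "at t within {0..t} \<noteq> bot" using t by (simp add: trivial_limit_within islimpt_Icc)
  moreover have "{0..t} \<subseteq> I" using t I_down by auto
  ultimately show ?thesis using at_le[of "{0..t}" I t] by (metis bot.extremum_uniqueI)
qed

text \<open>Symmetry of the mixed partial derivatives, from differentiating \<open>\<integral> g1\<close> under the integral sign.\<close>

lemma ht_x: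
  assumes t: "t \<in> I" "0 < t"
  shows "(ht t has_vector_derivative h1 t x) (at x)"
proof -
  define a where "a = x - 1"
  have diff: "ht t y - ht t a = integral {a..y} (h1 t)" if "a \<le> y" for y
  proof -
    have d: "((\<lambda>t. integral (cbox a y) (g1 t)) has_vector_derivative integral (cbox a y) (h1 t)) (at t within I)"
    proof (rule leibniz_rule_vector_derivative)
      show "continuous_on (I \<times> cbox a y) (\<lambda>(t, x). h1 t x)"
        unfolding case_prod_beta by (intro cont_along[OF h1_cont] continuous_intros) auto
    qed (use t convex_I g1_t slice[OF g1_cont] in \<open>auto intro!: integrable_continuous_interval\<close>)
    have "integral (cbox a y) (g1 s) = g s y - g s a" if "s \<in> I" for s
      unfolding cbox_interval
      by (intro integral_unique fundamental_theorem_of_calculus \<open>a \<le> y\<close> has_vector_derivative_at_within[OF g_x[OF that]])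
    then have "((\<lambda>t. g t y - g t a) has_vector_derivative integral {a..y} (h1 t)) (at t within I)"
      using has_vector_derivative_transform[OF t(1) _ d, of "\<lambda>t. g t y - g t a"] by simp
    moreover have "((\<lambda>t. g t y - g t a) has_vector_derivative ht t y - ht t a) (at t within I)"
      using t(1) by (intro has_vector_derivative_diff g_t)
    ultimately show ?thesis using vector_derivative_unique_within[OF within_nontrivial[OF t]] by blast
  qed
  have eq: "ht t y = ht t a + integral {a..y} (h1 t)" if "y \<in> {a..x + 1}" for y
    using diff[of y] that by (simp add: diff_eq_eq add.commute)
  have "((\<lambda>y. integral {a..y} (h1 t)) has_vector_derivative h1 t x) (at x within {a..x + 1})"
    by (rule integral_has_vector_derivative[OF slice[OF h1_cont t(1)]]) (simp add: a_def)
  from has_vector_derivative_add[OF has_vector_derivative_const this, of "ht t a"]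
  have "((\<lambda>y. ht t a + integral {a..y} (h1 t)) has_vector_derivative h1 t x) (at x within {a..x + 1})"
    by simp
  from has_vector_derivative_transform[OF _ eq this]
  have "(ht t has_vector_derivative h1 t x) (at x within {a..x + 1})"
    by (simp add: a_def)
  then show ?thesis using at_within_interior[of x "{a..x + 1}"] by (simp add: a_def)
qed

text \<open>The orthogonality of \<open>g1\<close> and \<open>curv\<close> is differentiated in
  \<open>x\<close>. The flow equation identifies the space derivative of \<open>curv\<close> with
  \<open>h1 - g1\<close>, so no third space derivative occurs.\<close>

lemma speed_t:
  assumes t: "t \<in> I" "0 < t"
  shows "g1 t x \<bullet> h1 t x = (V t x)\<^sup>2 * (1 - (norm (curv t x))\<^sup>2)"
proof -
  have "curv t = (\<lambda>x. ht t x - g t x)" using flow[OF t(1)] by (auto simp: curv_def)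
  then have k': "(curv t has_vector_derivative h1 t x - g1 t x) (at x)"
    using has_vector_derivative_diff[OF ht_x[OF t] g_x[OF t(1)], of x] by simp
  have perp: "g1 t y \<bullet> curv t y = 0" for y
    using g1_nz[OF t(1), of y] by (simp add: curv_def curvature_of_def inner_diff_right
        power2_norm_eq_inner[symmetric] eval_nat_numeral field_simps)
  have "((\<lambda>x. g1 t x \<bullet> curv t x) has_vector_derivative g1 t x \<bullet> (h1 t x - g1 t x) + g2 t x \<bullet> curv t x) (at x)"
    by (rule bounded_bilinear.has_vector_derivative[OF bounded_bilinear_inner g1_x[OF t(1)] k'])
  moreover have "((\<lambda>x. g1 t x \<bullet> curv t x) has_vector_derivative 0) (at x)"
    by (simp add: perp)
  ultimately have "g1 t x \<bullet> (h1 t x - g1 t x) + g2 t x \<bullet> curv t x = 0"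
    using vector_derivative_unique_at by blast
  moreover have "g2 t x \<bullet> curv t x = (V t x)\<^sup>2 * (norm (curv t x))\<^sup>2"
  proof -
    have "(V t x)\<^sup>2 *\<^sub>R curv t x = g2 t x - ((g1 t x \<bullet> g2 t x) / (V t x)\<^sup>2) *\<^sub>R g1 t x"
      using V_pos[OF t(1), of x] unfolding curv_def curvature_of_def V_def[symmetric]
      by (simp add: scaleR_right_diff_distrib eval_nat_numeral)
    then have "((V t x)\<^sup>2 *\<^sub>R curv t x) \<bullet> curv t x = g2 t x \<bullet> curv t x"
      by (simp add: inner_diff_left perp)
    then show ?thesis by (simp add: power2_norm_eq_inner)
  qed
  ultimately show ?thesis
    by (simp add: inner_diff_right V_def power2_norm_eq_inner[symmetric] algebra_simps)
qed

lemma V_t: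
  assumes "t \<in> I"
  shows "((\<lambda>t. V t x) has_real_derivative (g1 t x \<bullet> h1 t x) / V t x) (at t within I)"
  unfolding V_def by (rule has_real_derivative_norm[OF g1_t[OF assms] g1_nz[OF assms]])

text \<open>The growth term is the dilation by the summand \<open>g\<close> of the flow. The map
  \<sigma> inverts arclength at the fixed time \<open>t\<close> and only serves to write the
  curvature integral in arclength.\<close>

lemma arc_t:
  assumes t: "t \<in> I" "0 < t" and "x \<le> y"
    and \<sigma>: "\<And>x. \<sigma> (S t x) = x" and cont: "continuous_on UNIV (\<lambda>s. curv t (\<sigma> s))"
  shows "((\<lambda>t. S t y - S t x) has_real_derivative
    S t y - S t x - integral {S t x..S t y} (\<lambda>s. (norm (curv t (\<sigma> s)))\<^sup>2)) (at t within I)"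
proof -
  have int: "((\<lambda>t. integral (cbox x y) (V t)) has_real_derivative integral (cbox x y) (\<lambda>u. (g1 t u \<bullet> h1 t u) / V t u))
      (at t within I)"
  proof (rule leibniz_rule_field_derivative)
    show "continuous_on (I \<times> cbox x y) (\<lambda>(t, u). (g1 t u \<bullet> h1 t u) / V t u)"
      unfolding case_prod_beta
      by (intro continuous_intros cont_along[OF g1_cont] cont_along[OF h1_cont] cont_along[OF V_cont])
        (auto simp: less_imp_neq[OF V_pos, symmetric])
  qed (use t convex_I V_t slice[OF V_cont] in \<open>auto intro!: integrable_continuous_interval\<close>)
  have "integral (cbox x y) (V s) = S s y - S s x" if "s \<in> I" for s
    using S_diff[OF that \<open>x \<le> y\<close>] by (auto intro!: integral_unique)
  then have d: "((\<lambda>t. S t y - S t x) has_real_derivative integral {x..y} (\<lambda>u. (g1 t u \<bullet> h1 t u) / V t u))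
      (at t within I)"
    unfolding has_real_derivative_iff_has_vector_derivative
    using has_vector_derivative_transform[OF t(1) _ int[unfolded has_real_derivative_iff_has_vector_derivative], of "\<lambda>t. S t y - S t x"] by simp
  have "((\<lambda>u. V t u *\<^sub>R (norm (curv t (\<sigma> (S t u))))\<^sup>2) has_integral
      integral {S t x..S t y} (\<lambda>s. (norm (curv t (\<sigma> s)))\<^sup>2)) {x..y}"
  proof (rule has_integral_substitution)
    show "S t ` {x..y} \<subseteq> {S t x..S t y}" using S_mono[OF t(1)] by auto
    show "continuous_on {S t x..S t y} (\<lambda>s. (norm (curv t (\<sigma> s)))\<^sup>2)"
      by (intro continuous_on_power continuous_on_norm continuous_on_subset[OF cont subset_UNIV])
    show "(S t has_real_derivative V t u) (at u within {x..y})" for u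
      by (rule has_field_derivative_at_within[OF S_deriv[OF t(1)]])
  qed (use \<open>x \<le> y\<close> S_mono[OF t(1)] in auto)
  then have "((\<lambda>u. V t u - V t u * (norm (curv t u))\<^sup>2) has_integral
      S t y - S t x - integral {S t x..S t y} (\<lambda>s. (norm (curv t (\<sigma> s)))\<^sup>2)) {x..y}"
    using S_diff[OF t(1) \<open>x \<le> y\<close>] by (intro has_integral_diff) (auto simp: \<sigma>)
  moreover have "(g1 t u \<bullet> h1 t u) / V t u = V t u - V t u * (norm (curv t u))\<^sup>2" for u
    using V_pos[OF t(1), of u] by (simp add: speed_t[OF t] power2_eq_square) (simp add: algebra_simps)
  ultimately show ?thesis using d by (simp add: integral_unique)
qed


section \<open>The perturbed gap and its first zero\<close>

definition decay :: "real \<Rightarrow> real \<Rightarrow> real" where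
  "decay \<beta> t = \<beta> * exp (- 4 * pi\<^sup>2 * integral {0..t} (\<lambda>s. 1 / (L s)\<^sup>2))"

lemma initial_segment: "t \<in> I \<Longrightarrow> {0..t} \<subseteq> I"
  using I_down by auto

lemma L_cont': "t \<in> I \<Longrightarrow> continuous_on {0..t} L"
  using continuous_on_subset[OF L_cont initial_segment] .

lemma inverse_L_cont: "t \<in> I \<Longrightarrow> continuous_on {0..t} (\<lambda>s. 1 / (L s)\<^sup>2)"
  using L_pos initial_segment by (intro continuous_intros L_cont') (auto simp: less_le subset_iff)

lemma decay_deriv:
  assumes "t \<in> I"
  shows "(decay \<beta> has_real_derivative - (4 * pi\<^sup>2 * decay \<beta> t / (L t)\<^sup>2)) (at t within {0..t})"
proof -
  have "((\<lambda>t. integral {0..t} (\<lambda>s. 1 / (L s)\<^sup>2)) has_real_derivative 1 / (L t)\<^sup>2) (at t within {0..t})"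
    by (rule integral_has_real_derivative[OF inverse_L_cont[OF assms]]) (use I_nonneg[OF assms] in auto)
  from DERIV_cmult[OF DERIV_chain2[OF DERIV_exp DERIV_cmult[OF this, of "- 4 * pi\<^sup>2"]], of \<beta>]
  show ?thesis by (simp add: decay_def[abs_def] mult_ac)
qed

lemma decay_cont: "t \<in> I \<Longrightarrow> continuous_on {0..t} (decay \<beta>)"
  unfolding decay_def
  by (intro continuous_intros indefinite_integral_continuous_1 integrable_continuous_interval inverse_L_cont)

lemma decay_pos: "0 < \<beta> \<Longrightarrow> 0 < decay \<beta> t"
  by (simp add: decay_def)

lemma decay_0: "decay \<beta> 0 = \<beta>"
  by (simp add: decay_def)

text \<open>The term \<open>\<epsilon> exp (2 t)\<close> makes the initial inequality strict and keeps the diagonal harmless.\<close>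

definition gap :: "real \<Rightarrow> real \<Rightarrow> real \<Rightarrow> real \<Rightarrow> real \<Rightarrow> real" where
  "gap \<beta> \<epsilon> t x y = norm (g t y - g t x) - profile (decay \<beta> t) (L t) (S t y - S t x) + \<epsilon> * exp (2 * t)"

text \<open>A positive sine puts the arclength difference, modulo \<open>2 * L t\<close>, between 0
  and \<open>L t\<close>. If it exceeds half the length, the complementary arc from
  \<open>y1\<close> to \<open>x + 2 * pi\<close> is used, which has the same profile by
  reflection.\<close>

lemma normalize_pair:
  assumes t: "t \<in> I" and sin: "0 < sin (pi * (S t y - S t x) / L t)"
  obtains x' y' where "gap \<beta> \<epsilon> t x' y' = gap \<beta> \<epsilon> t x y" "norm (g t y' - g t x') = norm (g t y - g t x)"
    "0 < S t y' - S t x'" "S t y' - S t x' \<le> L t / 2"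
proof -
  note L = L_pos[OF t]
  interpret S': periodic_fun_simple "\<lambda>y. S t y - y * L t / (2 * pi)" "2 * pi"
    by standard (simp add: S_shift[OF t] add_divide_distrib distrib_right)
  interpret g': periodic_fun_simple "g t" "2 * pi"
    by standard (rule per[OF t])
  define r where "r = S t y - S t x"
  \<comment> \<open>Double turns are removed, since a single turn reverses the sign of the
    profile.\<close>
  define n where "n = \<lfloor>r / (2 * L t)\<rfloor>"
  define y1 where "y1 = y - of_int (2 * n) * (2 * pi)"
  have Sy1: "S t y1 = S t y - of_int n * (2 * L t)"
  proof -
    have "y1 * L t / (2 * pi) = y * L t / (2 * pi) - of_int n * (2 * L t)"
      by (simp add: y1_def left_diff_distrib diff_divide_distrib)
    then show ?thesis using S'.minus_of_int[of y "2 * n"] unfolding y1_def[symmetric] by linarith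
  qed
  have gy1: "g t y1 = g t y" unfolding y1_def by (rule g'.minus_of_int)
  define r1 where "r1 = S t y1 - S t x"
  have r1: "r1 = r - of_int n * (2 * L t)" by (simp add: r1_def r_def Sy1)
  have bounds: "0 \<le> r1" "r1 < 2 * L t"
    using L floor_divide_lower[of "2 * L t" r] floor_divide_upper[of "2 * L t" r]
    by (auto simp: r1 n_def algebra_simps)
  have sin_r1: "sin (pi * r1 / L t) = sin (pi * r / L t)"
  proof -
    have "pi * r1 / L t = pi * r / L t - of_int n * (2 * pi)" using L by (simp add: r1 field_simps)
    then show ?thesis using sin.minus_of_int[of "pi * r / L t" n] by simp
  qed
  have prof: "profile (decay \<beta> t) (L t) r1 = profile (decay \<beta> t) (L t) r"
    by (simp add: profile_def sin_r1)
  have pos: "0 < sin (pi * r1 / L t)" using sin sin_r1 by (simp add: r_def)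
  have r1_less: "0 < r1" "r1 < L t"
  proof -
    show "0 < r1" using pos bounds by (cases "r1 = 0") auto
    show "r1 < L t"
    proof (rule ccontr)
      assume "\<not> r1 < L t"
      then have "pi * 1 \<le> pi * (r1 / L t)" "pi * (r1 / L t) < pi * 2"
        using bounds L by (auto intro!: mult_left_mono mult_strict_left_mono simp: field_simps)
      then have "sin (pi * (r1 / L t)) \<le> 0" by (intro sin_le_zero) auto
      then show False using pos by simp
    qed
  qed
  show ?thesis
  proof (cases "r1 \<le> L t / 2")
    case True
    then show ?thesis using that[of x y1] r1_less prof gy1 by (simp add: gap_def r1_def r_def)
  next
    case False
    have "S t (x + 2 * pi) - S t y1 = L t - r1" by (simp add: S_shift[OF t] r1_def)
    moreover have "norm (g t (x + 2 * pi) - g t y1) = norm (g t y - g t x)"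
      by (simp add: per[OF t] gy1 norm_minus_commute)
    ultimately show ?thesis
      using that[of y1 "x + 2 * pi"] False r1_less prof profile_reflect[OF L, of "decay \<beta> t" r1]
      by (simp add: gap_def r_def)
  qed
qed

text \<open>At the touching pair the gap has derivative at least
  \<open>- \<eta> + 2 * \<eta>\<close>: the spatial minimum costs at most \<eta>, and the exponent 2
  in the perturbation is chosen to beat this. A positive derivative from the left makes the gap
  negative shortly before \<open>t\<close>.\<close>

lemma no_first_touching:
  assumes \<beta>: "0 < \<beta>" and \<epsilon>: "0 < \<epsilon>" and t: "t \<in> I" "0 < t"
    and past: "\<And>s. 0 \<le> s \<Longrightarrow> s < t \<Longrightarrow> 0 < gap \<beta> \<epsilon> s x y"
    and now: "\<And>x y. 0 \<le> gap \<beta> \<epsilon> t x y" and touch: "gap \<beta> \<epsilon> t x y = 0"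
    and emb: "g t x \<noteq> g t y"
    and half: "0 < S t y - S t x" "S t y - S t x \<le> L t / 2"
  shows False
proof -
  obtain \<sigma> where \<sigma>: "\<And>x. \<sigma> (S t x) = x" "\<And>s. S t (\<sigma> s) = s" and "\<And>x. S t (x + 2 * pi) = S t x + L t"
    and loop: "spherical_loop (\<lambda>s. g t (\<sigma> s)) (\<lambda>s. (1 / norm (g1 t (\<sigma> s))) *\<^sub>R g1 t (\<sigma> s)) (\<lambda>s. curv t (\<sigma> s)) (L t)"
    by (rule loop[OF t(1)], rule that)
  interpret spherical_loop "\<lambda>s. g t (\<sigma> s)" "\<lambda>s. (1 / norm (g1 t (\<sigma> s))) *\<^sub>R g1 t (\<sigma> s)" "\<lambda>s. curv t (\<sigma> s)" "L t"
    by (rule loop)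
  define \<eta> where "\<eta> = \<epsilon> * exp (2 * t)"
  define D where "D = g t y - g t x"
  define z where "z = (S t y - S t x) / L t"
  define \<phi> where "\<phi> = profile (decay \<beta> t) (L t) (S t y - S t x) / L t"
  define f where "f = profile_slope (decay \<beta> t) (L t) (S t y - S t x)"
  define J where "J = integral {0..L t} (\<lambda>s. (norm (curv t (\<sigma> s)))\<^sup>2)"
  define j where "j = integral {S t x..S t y} (\<lambda>s. (norm (curv t (\<sigma> s)))\<^sup>2)"
  define R where "R = (4 * pi\<^sup>2 * \<phi> - 4 * pi * sin (pi * z) / (1 + (decay \<beta> t)\<^sup>2 * (sin (pi * z))\<^sup>2)) / L t"
  have \<eta>: "0 < \<eta>" using \<epsilon> by (simp add: \<eta>_def)
  have D0: "D \<noteq> 0" using emb by (simp add: D_def)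
  have Lp: "0 < L t" by (rule L_pos)
  have min: "profile (decay \<beta> t) (L t) (q - p) - \<eta> \<le> norm (g t (\<sigma> q) - g t (\<sigma> p))" for p q
    using now[of "\<sigma> p" "\<sigma> q"] by (simp add: gap_def \<sigma>(2) \<eta>_def)
  have E: "- \<eta> \<le> norm D + (D \<bullet> (curv t y - curv t x)) / norm D - (L t - J) * (\<phi> - z * f) - f * (z * L t - j) - R"
  proof -
    have z: "0 < (S t y - S t x) / L t" "(S t y - S t x) / L t \<le> 1 / 2"
      using half Lp by (auto simp: field_simps)
    have eq: "norm (g t (\<sigma> (S t y)) - g t (\<sigma> (S t x))) = profile (decay \<beta> t) (L t) (S t y - S t x) - \<eta>"
      using touch by (simp add: gap_def \<eta>_def \<sigma>(1))
    have pos: "0 < norm (g t (\<sigma> (S t y)) - g t (\<sigma> (S t x)))" using D0 by (simp add: D_def \<sigma>(1))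
    show ?thesis
      using minimal_pair_inequality[OF decay_pos[OF \<beta>] less_imp_le[OF \<eta>] z min eq pos]
      by (simp only: \<sigma>(1) D_def z_def \<phi>_def f_def J_def j_def R_def)
  qed
  have sub: "{0..t} \<subseteq> I" using initial_segment[OF t(1)] .
  have xy: "x \<le> y"
  proof (rule ccontr)
    assume "\<not> x \<le> y"
    then have "S t y \<le> S t x"
      by (intro S_mono t(1)) auto
    then show False using half by simp
  qed
  have arc': "((\<lambda>t. S t v - S t u) has_real_derivative
      S t v - S t u - integral {S t u..S t v} (\<lambda>s. (norm (curv t (\<sigma> s)))\<^sup>2)) (at t within {0..t})" if "u \<le> v" for u v
    by (rule has_field_derivative_subset[OF arc_t[OF t that \<sigma>(1) k_cont] sub])
  have l': "((\<lambda>t. S t y - S t x) has_real_derivative z * L t - j) (at t within {0..t})"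
    using arc'[OF xy] Lp by (simp add: z_def j_def)
  have L': "(L has_real_derivative L t - J) (at t within {0..t})"
    using arc'[of 0 "2 * pi"] unfolding L_def[symmetric] J_def by (simp add: S_0)
  have prof': "((\<lambda>t. profile (decay \<beta> t) (L t) (S t y - S t x)) has_real_derivative
      (L t - J) * (\<phi> - z * f) + f * (z * L t - j) + R) (at t within {0..t})"
    using profile_time_deriv[where L = L and b = "decay \<beta>" and l = "\<lambda>t. S t y - S t x", OF Lp decay_pos[OF \<beta>] L' l' decay_deriv[OF t(1)]]
    by (simp add: z_def \<phi>_def f_def R_def)
  have norm': "((\<lambda>t. norm (g t y - g t x)) has_real_derivative
      norm D + (D \<bullet> (curv t y - curv t x)) / norm D) (at t within {0..t})"
  proof -
    have d: "((\<lambda>t. g t y - g t x) has_vector_derivative (curv t y - curv t x) + D) (at t within {0..t})"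
    proof -
      have gxy: "((\<lambda>t. g t y - g t x) has_vector_derivative ht t y - ht t x) (at t within I)"
        by (intro has_vector_derivative_diff g_t t(1))
      have hxy: "ht t y - ht t x = (curv t y - curv t x) + D"
        using flow[OF t(1)] by (simp add: curv_def D_def)
      show ?thesis by (rule has_vector_derivative_within_subset[OF gxy[unfolded hxy] sub])
    qed
    have "((\<lambda>t. norm (g t y - g t x)) has_real_derivative D \<bullet> ((curv t y - curv t x) + D) / norm D) (at t within {0..t})"
      using has_real_derivative_norm[OF d] D0 by (simp add: D_def)
    moreover have "D \<bullet> ((curv t y - curv t x) + D) / norm D = norm D + (D \<bullet> (curv t y - curv t x)) / norm D"
    proof -
      have "D \<bullet> D / norm D = norm D" using D0 by (simp add: dot_square_norm power2_eq_square)
      then show ?thesis by (simp add: inner_add_right add_divide_distrib)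
    qed
    ultimately show ?thesis by simp
  qed
  have "((\<lambda>t. gap \<beta> \<epsilon> t x y) has_real_derivative
      norm D + (D \<bullet> (curv t y - curv t x)) / norm D - ((L t - J) * (\<phi> - z * f) + f * (z * L t - j) + R) + 2 * \<eta>)
      (at t within {0..t})"
  proof -
    have "((\<lambda>t. \<epsilon> * exp (2 * t)) has_real_derivative 2 * \<eta>) (at t within {0..t})"
      unfolding \<eta>_def by (auto intro!: derivative_eq_intros)
    then show ?thesis unfolding gap_def by (intro DERIV_add DERIV_diff norm' prof')
  qed
  then obtain d where d: "0 < d" "\<And>h. 0 < h \<Longrightarrow> t - h \<in> {0..t} \<Longrightarrow> h < d \<Longrightarrow> gap \<beta> \<epsilon> (t - h) x y < gap \<beta> \<epsilon> t x y"
    using E \<eta> by (auto dest!: has_real_derivative_pos_inc_left)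
  define h where "h = min d t / 2"
  have "0 < h" "h < d" "t - h \<in> {0..t}" "t - h < t" using d(1) t(2) by (auto simp: h_def)
  then show False using d(2)[of h] past[of "t - h"] touch by auto
qed

end

lemma periodic_representative:
  fixes f :: "real \<Rightarrow> 'a"
  assumes "0 < p" "\<And>x. f (x + p) = f x"
  obtains x' where "x' \<in> {0..p}" "f x' = f x"
proof -
  interpret f: periodic_fun_simple f p by standard (rule assms(2))
  have "x - of_int \<lfloor>x / p\<rfloor> * p \<in> {0..p}"
    using assms(1) floor_divide_lower[of p x] floor_divide_upper[of p x] by (auto simp: algebra_simps)
  moreover have "f (x - of_int \<lfloor>x / p\<rfloor> * p) = f x" by (rule f.minus_of_int)
  ultimately show ?thesis by (rule that)
qed

context spherical_flow
begin

lemma curv_period: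
  assumes "t \<in> I" shows "curv t (x + 2 * pi) = curv t x"
proof -
  have 1: "g1 t (x + 2 * pi) = g1 t x" for x
    by (rule periodic_vector_derivative[OF g_x[OF assms] per[OF assms]])
  have "g2 t (x + 2 * pi) = g2 t x"
    by (rule periodic_vector_derivative[OF g1_x[OF assms] 1])
  with 1 show ?thesis by (simp add: curv_def)
qed

lemma curv_bounded:
  assumes "t1 \<in> I"
  obtains M where "0 < M" "\<And>t x. t \<in> {0..t1} \<Longrightarrow> norm (curv t x) \<le> M"
proof -
  have "compact ((\<lambda>p. curv (snd p) (fst p)) ` ({0..2 * pi} \<times> {0..t1}))"
    using initial_segment[OF assms]
    by (intro compact_continuous_image cont_along[OF curv_cont] continuous_intros compact_Times) auto
  from compact_imp_bounded[OF this] obtain M where M: "0 < M" "\<And>v. v \<in> (\<lambda>p. curv (snd p) (fst p)) ` ({0..2 * pi} \<times> {0..t1}) \<Longrightarrow> norm v \<le> M"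
    unfolding bounded_pos by blast
  have "norm (curv t x) \<le> M" if t: "t \<in> {0..t1}" for t x
  proof -
    have "t \<in> I" using t initial_segment[OF assms] by blast
    obtain x' where x': "x' \<in> {0..2 * pi}" "curv t x' = curv t x"
      by (rule periodic_representative[of "2 * pi" "curv t" x]) (auto simp: curv_period[OF \<open>t \<in> I\<close>])
    have "curv t x' \<in> (\<lambda>p. curv (snd p) (fst p)) ` ({0..2 * pi} \<times> {0..t1})"
      by (rule image_eqI[of _ _ "(x', t)"]) (use x'(1) t in auto)
    then show ?thesis using M(2) x'(2) by simp
  qed
  then show ?thesis using that M(1) by blast
qed

text \<open>Excludes zero chords at a touching pair. Bounded curvature keeps coincident points a
  definite arclength apart, so the profile there has a positive lower bound, uniform on the compact
  time interval.\<close>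

lemma coincidence_bound:
  assumes t1: "t1 \<in> I" and \<beta>: "0 < \<beta>"
  obtains \<kappa> where "0 < \<kappa>"
    "\<And>t x y. t \<in> {0..t1} \<Longrightarrow> g t x = g t y \<Longrightarrow> 0 < S t y - S t x \<Longrightarrow> S t y - S t x \<le> L t / 2 \<Longrightarrow>
      \<kappa> \<le> profile (decay \<beta> t) (L t) (S t y - S t x)"
proof -
  have sub: "{0..t1} \<subseteq> I" by (rule initial_segment[OF t1])
  have ne: "compact {0..t1}" "{0..t1} \<noteq> {}" using I_nonneg[OF t1] by auto
  obtain M where M: "0 < M" "\<And>t x. t \<in> {0..t1} \<Longrightarrow> norm (curv t x) \<le> M"
    using curv_bounded[OF t1] by blast
  obtain tm where tm: "tm \<in> {0..t1}" "\<And>t. t \<in> {0..t1} \<Longrightarrow> L t \<le> L tm"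
    using continuous_attains_sup[OF ne L_cont'[OF t1]] by blast
  define Lm where "Lm = L tm"
  have Lm: "0 < Lm" using L_pos sub tm(1) by (auto simp: Lm_def)
  \<comment> \<open>Coincident points are at least \<open>1 / M\<close> apart in arclength and no
    curve is longer than \<open>Lm\<close>, so \<open>z0\<close> is a lower bound for their
    separation relative to the length.\<close>
  define z0 where "z0 = 1 / (M * Lm)"
  have z0: "0 < z0" using M(1) Lm by (simp add: z0_def)
  define s0 where "s0 = sin (pi * min z0 (1 / 2))"
  have s0: "0 < s0" unfolding s0_def
  proof (rule sin_gt_zero)
    show "0 < pi * min z0 (1 / 2)" using z0 by simp
    have "pi * min z0 (1 / 2) \<le> pi * (1 / 2)" by (intro mult_left_mono) auto
    then show "pi * min z0 (1 / 2) < pi" using pi_gt_zero by linarith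
  qed
  define F where "F t = L t / (pi * decay \<beta> t) * arctan (decay \<beta> t * s0)" for t
  have F_pos: "0 < F t" if "t \<in> {0..t1}" for t
    using that sub L_pos decay_pos[OF \<beta>] s0 by (auto simp: F_def)
  have "continuous_on {0..t1} F" unfolding F_def
    using decay_pos[OF \<beta>] by (intro continuous_intros L_cont'[OF t1] decay_cont[OF t1]) (auto simp: less_imp_neq[symmetric])
  then obtain tF where tF: "tF \<in> {0..t1}" "\<And>t. t \<in> {0..t1} \<Longrightarrow> F tF \<le> F t"
    using continuous_attains_inf[OF ne] by blast
  have "F tF \<le> profile (decay \<beta> t) (L t) (S t y - S t x)"
    if t: "t \<in> {0..t1}" and eq: "g t x = g t y" and half: "0 < S t y - S t x" "S t y - S t x \<le> L t / 2" for t x y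
  proof -
    have tI: "t \<in> I" using t sub by blast
    have Lt: "0 < L t" "L t \<le> Lm" using L_pos[OF tI] tm(2)[OF t] by (simp_all add: Lm_def)
    obtain \<sigma> where \<sigma>: "\<And>x. \<sigma> (S t x) = x" "\<And>s. S t (\<sigma> s) = s" "\<And>x. S t (x + 2 * pi) = S t x + L t"
      and loop: "spherical_loop (\<lambda>s. g t (\<sigma> s)) (\<lambda>s. (1 / norm (g1 t (\<sigma> s))) *\<^sub>R g1 t (\<sigma> s)) (\<lambda>s. curv t (\<sigma> s)) (L t)"
      by (rule loop[OF tI], rule that)
    have "1 \<le> M * (S t y - S t x)"
      using spherical_loop.not_closed_if_short[OF loop, of M "S t x" "S t y"] M(2)[OF t] half eq
      by (simp add: \<sigma>(1)) (meson not_less)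
    also have "\<dots> = M * L t * ((S t y - S t x) / L t)" using Lt by simp
    also have "\<dots> \<le> M * Lm * ((S t y - S t x) / L t)"
      using Lt M(1) half by (intro mult_right_mono mult_left_mono) auto
    finally have "z0 \<le> (S t y - S t x) / L t"
      using M(1) Lm by (simp add: z0_def divide_le_eq mult.commute)
    moreover have "(S t y - S t x) / L t \<le> 1 / 2" using half Lt by (simp add: field_simps)
    ultimately have z: "min z0 (1 / 2) \<le> (S t y - S t x) / L t" "(S t y - S t x) / L t \<le> 1 / 2"
      by auto
    have "s0 \<le> sin (pi * ((S t y - S t x) / L t))" unfolding s0_def
    proof (rule sin_monotone_2pi_le)
      have "0 \<le> pi * min z0 (1 / 2)" using z0 by simp
      then show "- (pi / 2) \<le> pi * min z0 (1 / 2)" using pi_gt_zero by linarith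
      show "pi * min z0 (1 / 2) \<le> pi * ((S t y - S t x) / L t)"
        by (rule mult_left_mono[OF z(1)]) simp
      show "pi * ((S t y - S t x) / L t) \<le> pi / 2" using mult_left_mono[OF z(2), of pi] by simp
    qed
    then have "F t \<le> profile (decay \<beta> t) (L t) (S t y - S t x)"
      unfolding F_def profile_def using Lt decay_pos[OF \<beta>, of t]
      by (intro mult_left_mono) (auto simp: arctan_le_iff)
    then show ?thesis using tF(2)[OF t] by linarith
  qed
  then show ?thesis using that[of "F tF"] F_pos[OF tF(1)] by blast
qed

lemma gap_cont:
  assumes "t1 \<in> I" "0 < \<beta>"
  shows "continuous_on (X \<times> Y \<times> {0..t1}) (\<lambda>(x, y, t). gap \<beta> \<epsilon> t x y)"
proof -
  have sub: "{0..t1} \<subseteq> I" by (rule initial_segment[OF assms(1)])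
  have L: "continuous_on (X \<times> Y \<times> {0..t1}) (\<lambda>p. L (snd (snd p)))"
    and b: "continuous_on (X \<times> Y \<times> {0..t1}) (\<lambda>p. decay \<beta> (snd (snd p)))"
    by (rule continuous_on_compose2[OF L_cont'[OF assms(1)]] continuous_on_compose2[OF decay_cont[OF assms(1)]];
        auto intro!: continuous_intros)+
  show ?thesis
    unfolding gap_def profile_def case_prod_beta
    using sub L_pos decay_pos[OF assms(2)]
    by (intro continuous_intros L b cont_along[OF g_cont] cont_along[OF S_cont])
       (auto simp: less_imp_neq[symmetric] subset_iff)
qed

text \<open>The period is \<open>4 * pi\<close>, not \<open>2 * pi\<close>, because the profile
  changes sign when one end point makes a single turn.\<close>

lemma gap_period:
  assumes "t \<in> I"
  shows "gap \<beta> \<epsilon> t (x + 4 * pi) y = gap \<beta> \<epsilon> t x y" "gap \<beta> \<epsilon> t x (y + 4 * pi) = gap \<beta> \<epsilon> t x y"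
proof -
  have S: "S t (x + 4 * pi) = S t x + 2 * L t" and g: "g t (x + 4 * pi) = g t x" for x
    using S_shift[OF assms, of "x + 2 * pi"] S_shift[OF assms, of x] per[OF assms, of "x + 2 * pi"] per[OF assms, of x]
    by (simp_all add: algebra_simps)
  note p = profile_shift[OF L_pos[OF assms]]
  show "gap \<beta> \<epsilon> t (x + 4 * pi) y = gap \<beta> \<epsilon> t x y"
    using p[of "decay \<beta> t" "S t y - (S t x + 2 * L t)"] by (simp add: gap_def S g)
  show "gap \<beta> \<epsilon> t x (y + 4 * pi) = gap \<beta> \<epsilon> t x y"
  proof -
    have "S t y + 2 * L t - S t x = S t y - S t x + 2 * L t" by simp
    then show ?thesis unfolding gap_def S g by (simp only: p)
  qed
qed

text \<open>By periodicity the failures can be moved into a compact box, where the time attains its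
  least value. At that time the gap vanishes at some pair, and \<kappa> prevents its points from
  coinciding.\<close>

lemma gap_pos:
  assumes t1: "t1 \<in> I" and \<beta>: "0 < \<beta>" and \<epsilon>: "0 < \<epsilon>" "\<epsilon> * exp (2 * t1) < \<kappa>"
    and \<kappa>: "\<And>t x y. t \<in> {0..t1} \<Longrightarrow> g t x = g t y \<Longrightarrow> 0 < S t y - S t x \<Longrightarrow> S t y - S t x \<le> L t / 2 \<Longrightarrow>
      \<kappa> \<le> profile (decay \<beta> t) (L t) (S t y - S t x)"
    and init: "\<And>x y. profile \<beta> (L 0) (S 0 y - S 0 x) \<le> norm (g 0 y - g 0 x)"
    and t: "t \<in> {0..t1}"
  shows "0 < gap \<beta> \<epsilon> t x y"
proof (rule ccontr)
  assume neg: "\<not> 0 < gap \<beta> \<epsilon> t x y"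
  have sub: "{0..t1} \<subseteq> I" by (rule initial_segment[OF t1])
  define Q where "Q = {0..4 * pi} \<times> {0..4 * pi} \<times> {0..t1}"
  define bad where "bad = {p \<in> Q. (case p of (x, y, t) \<Rightarrow> gap \<beta> \<epsilon> t x y) \<le> 0}"
  have rep: "\<exists>x'\<in>{0..4 * pi}. \<exists>y'\<in>{0..4 * pi}. gap \<beta> \<epsilon> s x' y' = gap \<beta> \<epsilon> s x y" if "s \<in> {0..t1}" for s x y
  proof -
    have s: "s \<in> I" using that sub by blast
    obtain x' where x': "x' \<in> {0..4 * pi}" "gap \<beta> \<epsilon> s x' y = gap \<beta> \<epsilon> s x y"
      by (rule periodic_representative[of "4 * pi" "\<lambda>x. gap \<beta> \<epsilon> s x y" x]) (auto simp: gap_period(1)[OF s])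
    obtain y' where y': "y' \<in> {0..4 * pi}" "gap \<beta> \<epsilon> s x' y' = gap \<beta> \<epsilon> s x' y"
      by (rule periodic_representative[of "4 * pi" "gap \<beta> \<epsilon> s x'" y]) (auto simp: gap_period(2)[OF s])
    show ?thesis using x' y' by force
  qed
  have "compact Q" unfolding Q_def by (intro compact_Times) auto
  moreover have "closed bad"
    unfolding bad_def Q_def
    by (intro continuous_on_closed_Collect_le closed_Times gap_cont[OF t1 \<beta>] continuous_on_const closed_atLeastAtMost)
  moreover have "bad = Q \<inter> bad" by (auto simp: bad_def)
  ultimately have "compact bad" using compact_Int_closed by metis
  moreover have "bad \<noteq> {}"
  proof -
    obtain x' y' where "x' \<in> {0..4 * pi}" "y' \<in> {0..4 * pi}" "gap \<beta> \<epsilon> t x' y' = gap \<beta> \<epsilon> t x y"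
      using rep[OF t] by blast
    then have "(x', y', t) \<in> bad" using neg t by (simp add: bad_def Q_def)
    then show ?thesis by blast
  qed
  moreover have "continuous_on bad (\<lambda>p. snd (snd p))" by (intro continuous_intros)
  ultimately obtain p where p: "p \<in> bad" "\<And>q. q \<in> bad \<Longrightarrow> snd (snd p) \<le> snd (snd q)"
    using continuous_attains_inf[of bad "\<lambda>p. snd (snd p)"] by blast
  obtain x0 y0 t0 where p_eq: "p = (x0, y0, t0)" by (cases p)
  have t0: "t0 \<in> {0..t1}" and W0: "gap \<beta> \<epsilon> t0 x0 y0 \<le> 0" using p(1) by (auto simp: p_eq bad_def Q_def)
  have t0I: "t0 \<in> I" using t0 sub by blast
  have past: "0 < gap \<beta> \<epsilon> s x y" if "0 \<le> s" "s < t0" for s x y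
  proof (rule ccontr)
    assume "\<not> 0 < gap \<beta> \<epsilon> s x y"
    moreover have s: "s \<in> {0..t1}" using that t0 by auto
    moreover obtain x' y' where "x' \<in> {0..4 * pi}" "y' \<in> {0..4 * pi}" "gap \<beta> \<epsilon> s x' y' = gap \<beta> \<epsilon> s x y"
      using rep[OF s] by blast
    ultimately have "(x', y', s) \<in> bad" by (simp add: bad_def Q_def)
    then show False using p(2)[of "(x', y', s)"] that by (simp add: p_eq)
  qed
  have "t0 \<noteq> 0"
  proof
    assume "t0 = 0"
    then have "0 < gap \<beta> \<epsilon> t0 x0 y0" using init[of y0 x0] \<epsilon>(1) by (simp add: gap_def decay_0)
    then show False using W0 by simp
  qed
  then have t0_pos: "0 < t0" using t0 by auto
  have now: "0 \<le> gap \<beta> \<epsilon> t0 x y" for x y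
  proof (rule tendsto_lowerbound)
    have "continuous_on {0..t0} (\<lambda>t. case (x, y, t) of (x, y, t) \<Rightarrow> gap \<beta> \<epsilon> t x y)"
      by (rule continuous_on_compose2[OF gap_cont[OF t0I \<beta>, of UNIV UNIV]]) (auto intro!: continuous_intros)
    then have lim: "((\<lambda>t. gap \<beta> \<epsilon> t x y) \<longlongrightarrow> gap \<beta> \<epsilon> t0 x y) (at t0 within {0..t0})"
      using t0_pos by (simp add: continuous_on)
    have "at_left t0 = at t0 within {0<..<t0}"
      by (rule at_within_nhd[of _ "{0<..}"]) (use t0_pos in auto)
    moreover have "((\<lambda>t. gap \<beta> \<epsilon> t x y) \<longlongrightarrow> gap \<beta> \<epsilon> t0 x y) (at t0 within {0<..<t0})"
      by (rule tendsto_within_subset[OF lim]) auto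
    ultimately show "((\<lambda>t. gap \<beta> \<epsilon> t x y) \<longlongrightarrow> gap \<beta> \<epsilon> t0 x y) (at_left t0)" by simp
    show "\<forall>\<^sub>F t in at_left t0. 0 \<le> gap \<beta> \<epsilon> t x y"
      unfolding eventually_at_left_field using past t0_pos by (intro exI[of _ 0]) (auto intro: less_imp_le)
  qed simp
  have touch: "gap \<beta> \<epsilon> t0 x0 y0 = 0" using now[of x0 y0] W0 by simp
  \<comment> \<open>At a zero of the gap the profile equals chord plus perturbation, hence is
    positive; this fixes the sign of the sine and permits the normalisation.\<close>
  have "0 < profile (decay \<beta> t0) (L t0) (S t0 y0 - S t0 x0)"
  proof -
    have "0 < norm (g t0 y0 - g t0 x0) + \<epsilon> * exp (2 * t0)" using \<epsilon>(1) by (intro add_nonneg_pos) auto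
    then show ?thesis using touch by (simp add: gap_def)
  qed
  then have "0 < sin (pi * (S t0 y0 - S t0 x0) / L t0)"
    using profile_pos_iff[OF L_pos[OF t0I] decay_pos[OF \<beta>]] by simp
  from normalize_pair[OF t0I this, of \<beta> \<epsilon>] obtain x' y' where
    xy: "gap \<beta> \<epsilon> t0 x' y' = 0" "0 < S t0 y' - S t0 x'" "S t0 y' - S t0 x' \<le> L t0 / 2"
    using touch by metis
  have "g t0 x' \<noteq> g t0 y'"
  proof
    assume eq: "g t0 x' = g t0 y'"
    have "\<kappa> \<le> profile (decay \<beta> t0) (L t0) (S t0 y' - S t0 x')" by (rule \<kappa>[OF t0 eq xy(2,3)])
    also have "\<dots> = \<epsilon> * exp (2 * t0)" using xy(1) eq by (simp add: gap_def)
    also have "\<dots> \<le> \<epsilon> * exp (2 * t1)" using t0 \<epsilon>(1) by simp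
    finally show False using \<epsilon>(2) by simp
  qed
  from no_first_touching[OF \<beta> \<epsilon>(1) t0I t0_pos past now xy(1) this xy(2,3)] show False .
qed

theorem chord_arc_preserved:
  assumes t: "t \<in> I" and \<beta>: "0 < \<beta>"
    and init: "\<And>x y. profile \<beta> (L 0) (S 0 y - S 0 x) \<le> norm (g 0 y - g 0 x)"
  shows "profile (decay \<beta> t) (L t) (S t y - S t x) \<le> norm (g t y - g t x)"
proof (rule field_le_epsilon)
  fix e :: real assume e: "0 < e"
  obtain \<kappa> where \<kappa>: "0 < \<kappa>"
    "\<And>s x y. s \<in> {0..t} \<Longrightarrow> g s x = g s y \<Longrightarrow> 0 < S s y - S s x \<Longrightarrow> S s y - S s x \<le> L s / 2 \<Longrightarrow>
      \<kappa> \<le> profile (decay \<beta> s) (L s) (S s y - S s x)"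
    using coincidence_bound[OF t \<beta>] by metis
  define \<epsilon> where "\<epsilon> = min \<kappa> e / 2 / exp (2 * t)"
  have \<epsilon>: "0 < \<epsilon>" "\<epsilon> * exp (2 * t) < \<kappa>" "\<epsilon> * exp (2 * t) \<le> e" using e \<kappa>(1) by (auto simp: \<epsilon>_def)
  have "0 < gap \<beta> \<epsilon> t x y"
    by (rule gap_pos[OF t \<beta> \<epsilon>(1,2) \<kappa>(2) init]) (use I_nonneg[OF t] in auto)
  then show "profile (decay \<beta> t) (L t) (S t y - S t x) \<le> norm (g t y - g t x) + e"
    using \<epsilon>(3) by (simp add: gap_def)
qed

theorem curvature_preserved:
  assumes t: "t \<in> I" and \<beta>: "0 < \<beta>"
    and init: "\<And>x y. profile \<beta> (L 0) (S 0 y - S 0 x) \<le> norm (g 0 y - g 0 x)"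
  shows "(norm (curv t x))\<^sup>2 \<le> (2 * pi / L t)\<^sup>2 * (1 + 2 * (decay \<beta> t)\<^sup>2)"
proof -
  obtain \<sigma> where \<sigma>: "\<And>x. \<sigma> (S t x) = x" "\<And>s. S t (\<sigma> s) = s" "\<And>x. S t (x + 2 * pi) = S t x + L t"
    and loop: "spherical_loop (\<lambda>s. g t (\<sigma> s)) (\<lambda>s. (1 / norm (g1 t (\<sigma> s))) *\<^sub>R g1 t (\<sigma> s)) (\<lambda>s. curv t (\<sigma> s)) (L t)"
    by (rule loop[OF t], rule that)
  have "profile (decay \<beta> t) (L t) (q - p) \<le> norm (g t (\<sigma> q) - g t (\<sigma> p))" for p q
    using chord_arc_preserved[OF t \<beta> init, of "\<sigma> q" "\<sigma> p"] by (simp add: \<sigma>(2))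
  from spherical_loop.curvature_bound[OF loop decay_pos[OF \<beta>] this, of "S t x"] show ?thesis
    by (simp add: \<sigma>(1))
qed

end

section \<open>From the smooth flow to the evolution equations\<close>

lemma smooth_within_partials:
  fixes F :: "real \<times> real \<Rightarrow> real^3"
  assumes "smooth_within (UNIV \<times> I) F"
  obtains Fx Ft where "smooth_within (UNIV \<times> I) Fx" "smooth_within (UNIV \<times> I) Ft"
    "\<And>x t. t \<in> I \<Longrightarrow> ((\<lambda>x. F (x, t)) has_vector_derivative Fx (x, t)) (at x)"
    "\<And>x t. t \<in> I \<Longrightarrow> ((\<lambda>t. F (x, t)) has_vector_derivative Ft (x, t)) (at t within I)"
    "continuous_on (UNIV \<times> I) F"
proof -
  from assms obtain D where
    D: "\<And>p. p \<in> UNIV \<times> I \<Longrightarrow> (F has_derivative (\<lambda>h. D h p)) (at p within UNIV \<times> I)"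
    and sm: "\<And>h. smooth_within (UNIV \<times> I) (D h)"
    by (cases rule: smooth_within.cases) blast
  have x: "((\<lambda>x. F (x, t)) has_vector_derivative D (1, 0) (x, t)) (at x)" if "t \<in> I" for x t
  proof -
    have "((\<lambda>x. (x, t)) has_derivative (\<lambda>h. (h, 0))) (at x)"
      by (intro has_derivative_Pair has_derivative_ident has_derivative_const)
    moreover have "(F has_derivative (\<lambda>h. D h (x, t))) (at (x, t) within (\<lambda>x. (x, t)) ` UNIV)"
      by (rule has_derivative_subset[OF D]) (use that in auto)
    ultimately have *: "((\<lambda>x. F (x, t)) has_derivative (\<lambda>h. D (h, 0) (x, t))) (at x)"
      by (rule has_derivative_in_compose)
    have lin: "linear (\<lambda>h. D h (x, t))" by (rule has_derivative_linear[OF D]) (use that in simp)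
    have eq: "(\<lambda>h. D (h, 0) (x, t)) = (\<lambda>h. h *\<^sub>R D (1, 0) (x, t))"
    proof (intro ext)
      fix h :: real
      from linear_scale[OF lin, of h "(1, 0)"] show "D (h, 0) (x, t) = h *\<^sub>R D (1, 0) (x, t)" by simp
    qed
    show ?thesis using * unfolding has_vector_derivative_def eq .
  qed
  have t: "((\<lambda>t. F (x, t)) has_vector_derivative D (0, 1) (x, t)) (at t within I)" if "t \<in> I" for x t
  proof -
    have "((\<lambda>t. (x, t)) has_derivative (\<lambda>h. (0, h))) (at t within I)"
      by (intro has_derivative_Pair has_derivative_ident has_derivative_const)
    moreover have "(F has_derivative (\<lambda>h. D h (x, t))) (at (x, t) within (\<lambda>t. (x, t)) ` I)"
      by (rule has_derivative_subset[OF D]) (use that in auto)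
    ultimately have *: "((\<lambda>t. F (x, t)) has_derivative (\<lambda>h. D (0, h) (x, t))) (at t within I)"
      by (rule has_derivative_in_compose)
    have lin: "linear (\<lambda>h. D h (x, t))" by (rule has_derivative_linear[OF D]) (use that in simp)
    have eq: "(\<lambda>h. D (0, h) (x, t)) = (\<lambda>h. h *\<^sub>R D (0, 1) (x, t))"
    proof (intro ext)
      fix h :: real
      from linear_scale[OF lin, of h "(0, 1)"] show "D (0, h) (x, t) = h *\<^sub>R D (0, 1) (x, t)" by simp
    qed
    show ?thesis using * unfolding has_vector_derivative_def eq .
  qed
  have "continuous_on (UNIV \<times> I) F"
    unfolding continuous_on_eq_continuous_within using has_derivative_continuous[OF D] by blast
  from that[OF sm sm x t this] show ?thesis .
qed

lemma curvature_of_inner: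
  fixes c c1 :: "real \<Rightarrow> real^3"
  assumes "\<And>x. norm (c x) = 1" "\<And>x. (c has_vector_derivative c1 x) (at x)"
    and "(c1 has_vector_derivative w) (at x)" and "c1 x \<noteq> 0"
  shows "curvature_of (c1 x) w \<bullet> c x = - 1"
proof -
  have perp: "c y \<bullet> c1 y = 0" for y
    using sphere_curve_orthogonal[of c 1 y, OF assms(1) differentiableI_vector[OF assms(2)]]
    by (simp add: vector_derivative_at[OF assms(2)])
  have "((\<lambda>x. c x \<bullet> c1 x) has_vector_derivative c x \<bullet> w + c1 x \<bullet> c1 x) (at x)"
    by (rule bounded_bilinear.has_vector_derivative[OF bounded_bilinear_inner assms(2,3)])
  moreover have "((\<lambda>x. c x \<bullet> c1 x) has_vector_derivative 0) (at x)" by (simp add: perp)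
  ultimately have "c x \<bullet> w + c1 x \<bullet> c1 x = 0" using vector_derivative_unique_at by blast
  then have "w \<bullet> c x = - (norm (c1 x))\<^sup>2" by (simp add: power2_norm_eq_inner inner_commute)
  moreover have "c1 x \<bullet> c x = 0" using perp[of x] by (simp add: inner_commute)
  ultimately show ?thesis using assms(4) by (simp add: curvature_of_def inner_diff_left)
qed

text \<open>The component of the Euclidean curvature vector along \<open>c x\<close> is
  \<open>- 1\<close>, so the vector splits orthogonally into the curvature vector in the sphere and
  \<open>- c x\<close>; the second claim is Pythagoras.\<close>

lemma spherical_curvature:
  fixes c c1 :: "real \<Rightarrow> real^3"
  assumes norm: "\<And>x. norm (c x) = 1" and c1: "\<And>x. (c has_vector_derivative c1 x) (at x)"
    and c2: "\<And>x. (c1 has_vector_derivative c2 x) (at x)" and nz: "\<And>x. c1 x \<noteq> 0"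
  shows "curvature_vector c x = curvature_of (c1 x) (c2 x) + c x"
    and "(curvature c x)\<^sup>2 + 1 = (norm (curvature_of (c1 x) (c2 x)))\<^sup>2"
proof -
  have vd: "vector_derivative c (at x) = c1 x" for x by (rule vector_derivative_at[OF c1])
  have ut: "unit_tangent c = (\<lambda>x. (1 / norm (c1 x)) *\<^sub>R c1 x)"
    by (auto simp: unit_tangent_def speed_def vd)
  have ut': "(unit_tangent c has_vector_derivative norm (c1 x) *\<^sub>R curvature_of (c1 x) (c2 x)) (at x)"
    unfolding ut by (rule normalized_deriv[OF c2 nz])
  have inner: "curvature_of (c1 x) (c2 x) \<bullet> c x = - 1"
    by (rule curvature_of_inner[OF norm c1 c2 nz])
  have cc: "c x \<bullet> c x = 1" using norm by (simp add: norm_eq_1)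
  show cv: "curvature_vector c x = curvature_of (c1 x) (c2 x) + c x"
    using nz[of x] inner by (simp add: curvature_vector_def vector_derivative_at[OF ut'] speed_def vd)
  have "curvature_vector c x = - curvature c x *\<^sub>R unit_normal c x"
    by (rule curvature_vector_eq[OF norm differentiableI_vector[OF c1] _ differentiableI_vector[OF ut']]) (simp add: vd nz)
  moreover have "norm (unit_normal c x) = 1"
    by (rule unit_normal_frame(1)[OF norm differentiableI_vector[OF c1]]) (simp add: vd nz)
  ultimately have "(curvature c x)\<^sup>2 = (norm (curvature_vector c x))\<^sup>2" by simp
  also have "\<dots> = (norm (curvature_of (c1 x) (c2 x)))\<^sup>2 - 1"
    using inner cc by (simp add: cv power2_norm_eq_inner inner_add inner_commute)
  finally show "(curvature c x)\<^sup>2 + 1 = (norm (curvature_of (c1 x) (c2 x)))\<^sup>2" by simp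
qed

lemma flow_locale:
  assumes flow: "curve_shortening_flow T \<gamma>" and T: "0 < T"
  obtains g1 g2 ht h1 where "spherical_flow (time_interval T) \<gamma> g1 g2 ht h1"
proof -
  define I where "I = time_interval T"
  have sm: "smooth_within (UNIV \<times> I) (\<lambda>(x, t). \<gamma> t x)"
    and per: "\<And>t. t \<in> I \<Longrightarrow> periodic_curve (\<gamma> t)"
    and norm: "\<And>t x. t \<in> I \<Longrightarrow> norm (\<gamma> t x) = 1"
    and nz: "\<And>t x. t \<in> I \<Longrightarrow> vector_derivative (\<gamma> t) (at x) \<noteq> 0"
    and csf: "\<And>t x. t \<in> I \<Longrightarrow> ((\<lambda>s. \<gamma> s x) has_vector_derivative curvature_vector (\<gamma> t) x) (at t within I)"
    using flow by (auto simp: curve_shortening_flow_def I_def)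
  obtain Gx Gt where G: "smooth_within (UNIV \<times> I) Gx" "smooth_within (UNIV \<times> I) Gt"
    "\<And>x t. t \<in> I \<Longrightarrow> ((\<lambda>x. \<gamma> t x) has_vector_derivative Gx (x, t)) (at x)"
    "\<And>x t. t \<in> I \<Longrightarrow> ((\<lambda>t. \<gamma> t x) has_vector_derivative Gt (x, t)) (at t within I)"
    "continuous_on (UNIV \<times> I) (\<lambda>(x, t). \<gamma> t x)"
    using smooth_within_partials[OF sm] by (simp only: prod.case) blast
  obtain Gxx Gxt where H: "smooth_within (UNIV \<times> I) Gxx" "smooth_within (UNIV \<times> I) Gxt"
    "\<And>x t. t \<in> I \<Longrightarrow> ((\<lambda>x. Gx (x, t)) has_vector_derivative Gxx (x, t)) (at x)"
    "\<And>x t. t \<in> I \<Longrightarrow> ((\<lambda>t. Gx (x, t)) has_vector_derivative Gxt (x, t)) (at t within I)"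
    "continuous_on (UNIV \<times> I) Gx"
    by (rule smooth_within_partials[OF G(1)], rule that)
  have cont: "continuous_on (UNIV \<times> I) F" if "smooth_within (UNIV \<times> I) F" for F :: "real \<times> real \<Rightarrow> real^3"
    by (rule smooth_within_partials[OF that])
  have Gx_nz: "Gx (x, t) \<noteq> 0" if "t \<in> I" for x t
    using nz[OF that, of x] by (simp add: vector_derivative_at[OF G(3)[OF that]])
  have "spherical_flow I \<gamma> (\<lambda>t x. Gx (x, t)) (\<lambda>t x. Gxx (x, t)) (\<lambda>t x. curvature_vector (\<gamma> t) x) (\<lambda>t x. Gxt (x, t))"
  proof
    fix s t x :: real
    show "0 \<in> I" using T by (simp add: I_def time_interval_def zero_ereal_def)
    show "t \<in> I \<Longrightarrow> 0 \<le> t" by (simp add: I_def time_interval_def)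
    show "t \<in> I \<Longrightarrow> 0 \<le> s \<Longrightarrow> s \<le> t \<Longrightarrow> s \<in> I"
      by (auto simp: I_def time_interval_def intro: le_less_trans[of "ereal s" "ereal t"])
    show "t \<in> I \<Longrightarrow> \<gamma> t (x + 2 * pi) = \<gamma> t x"
      using per by (simp add: periodic_curve_def)
    show "t \<in> I \<Longrightarrow> curvature_vector (\<gamma> t) x = curvature_of (Gx (x, t)) (Gxx (x, t)) + \<gamma> t x"
      by (rule spherical_curvature(1)[OF norm G(3) H(3) Gx_nz])
  qed (use norm G H csf Gx_nz cont in \<open>simp_all\<close>)
  then show ?thesis using that by (simp add: I_def)
qed

section \<open>Length, curvature and the initial inequality in terms of the flow\<close>

context spherical_flow
begin

lemma curve_length_eq:
  assumes "t \<in> I" shows "curve_length (g t) = L t"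
proof -
  have "speed (g t) = V t"
    by (auto simp: speed_def V_def vector_derivative_at[OF g_x[OF assms]])
  then show ?thesis
    using integral_unique[OF S_diff[OF assms, of 0 "2 * pi"]] by (simp add: curve_length_def L_def S_0)
qed

lemma curvature_eq:
  "t \<in> I \<Longrightarrow> (curvature (g t) x)\<^sup>2 + 1 = (norm (curv t x))\<^sup>2"
  unfolding curv_def by (rule spherical_curvature(2)[OF norm_g g_x g1_x g1_nz])

lemma tau_eq:
  assumes "t \<in> I" shows "tau g t = integral {0..t} (\<lambda>s. 1 / (L s)\<^sup>2)"
  unfolding tau_def using initial_segment[OF assms] by (intro integral_cong) (auto simp: curve_length_eq)

text \<open>Passing to the other arc reflects the angle at \<open>pi / 2\<close>, and exchanging the
  end points reverses its sign; the absolute value of the sine survives both.\<close>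

lemma sin_arclength:
  assumes t: "t \<in> I" and x: "x \<in> {0..<2 * pi}" and y: "y \<in> {0..<2 * pi}"
  shows "sin (pi * arclength (g t) x y / curve_length (g t)) = \<bar>sin (pi * (S t y - S t x) / L t)\<bar>"
proof -
  define s where "s = S t (max x y) - S t (min x y)"
  note Lp = L_pos[OF t]
  have sp: "speed (g t) = V t"
    by (auto simp: speed_def V_def vector_derivative_at[OF g_x[OF t]])
  have al: "arclength (g t) x y = min s (L t - s)"
    using integral_unique[OF S_diff[OF t, of "min x y" "max x y"]]
    by (simp add: arclength_def Let_def sp curve_length_eq[OF t] s_def)
  have s: "0 \<le> s" "s \<le> L t"
    using S_mono[OF t, of "min x y" "max x y"] S_mono[OF t, of 0 "min x y"] S_mono[OF t, of "max x y" "2 * pi"] x y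
    by (auto simp: s_def S_0 L_def)
  have "sin (pi * (L t - s) / L t) = sin (pi * s / L t)"
    using Lp by (simp add: right_diff_distrib diff_divide_distrib)
  then have "sin (pi * min s (L t - s) / L t) = sin (pi * s / L t)"
    by (simp add: min_def)
  also have "\<dots> = \<bar>sin (pi * s / L t)\<bar>"
  proof -
    have "pi * s / L t \<le> pi * L t / L t" using s Lp by (intro divide_right_mono mult_left_mono) auto
    then have "0 \<le> sin (pi * s / L t)" using s Lp by (intro sin_ge_zero) auto
    then show ?thesis by simp
  qed
  also have "\<dots> = \<bar>sin (pi * (S t y - S t x) / L t)\<bar>"
  proof (cases "x \<le> y")
    case False
    then have "pi * s / L t = - (pi * (S t y - S t x) / L t)"
      by (simp add: s_def max_def min_def minus_divide_left[symmetric] right_diff_distrib diff_divide_distrib)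
    then show ?thesis by simp
  qed (simp add: s_def max_def min_def)
  finally show ?thesis by (simp add: al curve_length_eq[OF t])
qed

lemma fundamental_representative:
  assumes t: "t \<in> I"
  obtains x' n where "x' \<in> {0..<2 * pi}" "g t x' = g t x" "S t x = S t x' + of_int n * L t"
proof -
  interpret S': periodic_fun_simple "\<lambda>y. S t y - y * L t / (2 * pi)" "2 * pi"
    by standard (simp add: S_shift[OF t] add_divide_distrib distrib_right)
  interpret g': periodic_fun_simple "g t" "2 * pi"
    by standard (rule per[OF t])
  define n where "n = \<lfloor>x / (2 * pi)\<rfloor>"
  define x' where "x' = x - of_int n * (2 * pi)"
  have "x' \<in> {0..<2 * pi}"
    using floor_divide_lower[of "2 * pi" x] floor_divide_upper[of "2 * pi" x] by (auto simp: x'_def n_def algebra_simps)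
  moreover have "g t x' = g t x" unfolding x'_def by (rule g'.minus_of_int)
  moreover have "S t x = S t x' + of_int n * L t"
  proof -
    have "x' * L t / (2 * pi) = x * L t / (2 * pi) - of_int n * L t"
      by (simp add: x'_def left_diff_distrib diff_divide_distrib)
    then show ?thesis using S'.minus_of_int[of x n] unfolding x'_def[symmetric] by linarith
  qed
  ultimately show ?thesis by (rule that)
qed

text \<open>Moving the parameters into the fundamental domain changes the sine at most by a sign.
  The hypothesis concerns its absolute value, and the profile increases with the sine.\<close>

lemma initial_chord_arc:
  assumes a: "0 < a" and init: "\<forall>x \<in> {0..<2 * pi}. \<forall>y \<in> {0..<2 * pi}.
      dist (g 0 x) (g 0 y) / curve_length (g 0)
      \<ge> 1 / a * arctan (a / pi * sin (pi * arclength (g 0) x y / curve_length (g 0)))"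
  shows "profile (a / pi) (L 0) (S 0 y - S 0 x) \<le> norm (g 0 y - g 0 x)"
proof -
  note Lp = L_pos[OF I0]
  obtain x' m where x': "x' \<in> {0..<2 * pi}" "g 0 x' = g 0 x" "S 0 x = S 0 x' + of_int m * L 0"
    by (rule fundamental_representative[OF I0])
  obtain y' n where y': "y' \<in> {0..<2 * pi}" "g 0 y' = g 0 y" "S 0 y = S 0 y' + of_int n * L 0"
    by (rule fundamental_representative[OF I0])
  have "pi * (S 0 y - S 0 x) / L 0 = pi * (S 0 y' - S 0 x') / L 0 + pi * of_int (n - m)"
    using Lp by (simp add: x'(3) y'(3) field_simps)
  then have "\<bar>sin (pi * (S 0 y - S 0 x) / L 0)\<bar> = \<bar>sin (pi * (S 0 y' - S 0 x') / L 0)\<bar>"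
    by (simp only: sin_add sin_npi_int cos_npi_int) simp
  then have "sin (pi * (S 0 y - S 0 x) / L 0) \<le> sin (pi * arclength (g 0) x' y' / curve_length (g 0))"
    unfolding sin_arclength[OF I0 x'(1) y'(1)] by linarith
  then have "profile (a / pi) (L 0) (S 0 y - S 0 x)
      \<le> L 0 * (1 / a * arctan (a / pi * sin (pi * arclength (g 0) x' y' / curve_length (g 0))))"
    using Lp a by (simp add: profile_def divide_right_mono mult_left_mono arctan_le_iff)
  also have "\<dots> \<le> L 0 * (dist (g 0 x') (g 0 y') / L 0)"
    using init x'(1) y'(1) Lp by (intro mult_left_mono) (auto simp: curve_length_eq[OF I0])
  also have "\<dots> = norm (g 0 y - g 0 x)"
    using Lp by (simp add: x'(2) y'(2) dist_norm norm_minus_commute)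
  finally show ?thesis .
qed

end

theorem corollary4p1:
  fixes T :: ereal and \<gamma> :: "real \<Rightarrow> real \<Rightarrow> real^3" and a :: real
  assumes "0 < T"
    and "curve_shortening_flow T \<gamma>"
    and "simple_closed_curve (\<gamma> 0)"
    and "a > 0"
    and "\<forall>x \<in> {0..<2 * pi}. \<forall>y \<in> {0..<2 * pi}.
           dist (\<gamma> 0 x) (\<gamma> 0 y) / curve_length (\<gamma> 0)
           \<ge> 1 / a * arctan (a / pi * sin (pi * arclength (\<gamma> 0) x y / curve_length (\<gamma> 0)))"
  shows "\<forall>t \<in> time_interval T. \<forall>x.
           (curvature (\<gamma> t) x)\<^sup>2 + 1
           \<le> (2 * pi / curve_length (\<gamma> t))\<^sup>2 *
               (1 + 2 * a\<^sup>2 / pi\<^sup>2 * exp (- 8 * pi\<^sup>2 * tau \<gamma> t))"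
proof (intro ballI allI)
  fix t x assume t: "t \<in> time_interval T"
  obtain g1 g2 ht h1 where "spherical_flow (time_interval T) \<gamma> g1 g2 ht h1"
    by (rule flow_locale[OF assms(2,1)])
  then interpret spherical_flow "time_interval T" \<gamma> g1 g2 ht h1 .
  have "(norm (curv t x))\<^sup>2 \<le> (2 * pi / L t)\<^sup>2 * (1 + 2 * (decay (a / pi) t)\<^sup>2)"
    using curvature_preserved[OF t _ initial_chord_arc[OF assms(4,5)]] assms(4) by simp
  \<comment> \<open>Squaring \<open>b\<close> doubles the exponent, which is why 8 appears instead
    of 4.\<close>
  moreover have "2 * (decay (a / pi) t)\<^sup>2 = 2 * a\<^sup>2 / pi\<^sup>2 * exp (- 8 * pi\<^sup>2 * tau \<gamma> t)"
    by (simp add: decay_def tau_eq[OF t] power_mult_distrib power_divide flip: exp_of_nat_mult)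
  ultimately show "(curvature (\<gamma> t) x)\<^sup>2 + 1
      \<le> (2 * pi / curve_length (\<gamma> t))\<^sup>2 * (1 + 2 * a\<^sup>2 / pi\<^sup>2 * exp (- 8 * pi\<^sup>2 * tau \<gamma> t))"
    by (simp add: curvature_eq[OF t] curve_length_eq[OF t])
qed

end
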